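(* A spectral measure over $\mathbb{T}^2$ for the group $\mathrm{L}=\Sigma(360\times3)\cong TA_6$ (the ternary $A_6$ group, a subgroup of $SU(3)$ of order 1080) is $$\mathrm{d}\varepsilon=\frac{1}{96\pi^4}J^2\,\mathrm{d}^{(4)}+\frac{1}{108\pi^4}J^2\,\mathrm{d}^{(3)}+\frac16\,\mathrm{d}^{(2)}-\frac7{180}\,\mathrm{d}^{(1)}+\frac15\,\mathrm{d}^{((5))}+\frac15\,\mathrm{d}^{((5/2))}.$$
   Context: The group $\mathrm{L}$ is a subgroup of $SU(3)$ of order 1080 which contains the centre $\{1,\omega,\omega^2\}$ of $SU(3)$, $\omega=e^{2\pi i/3}$, and whose quotient by this centre is isomorphic to the alternating group $A_6$ (an extension of $A_6$ by a cyclic group of order 3). For a finite subgroup $\Gamma\subset SU(3)$ let $\rho$ be the 3-dimensional representation given by the inclusion. The McKay graph $\mathcal{G}_\Gamma$ has as vertices the irreducible representations of $\Gamma$ (up to isomorphism), with adjacency matrix $\Delta_{\sigma,\sigma'}$ = multiplicity of $\sigma'$ in $\rho\otimes\sigma$; $\Delta$ is normal. Let $e_1$ be the basis vector of the trivial representation. With $\mathbb{T}$ the unit circle and $R_{m,n}(\omega_1,\omega_2)=(\omega_1+\omega_2^{-1}+\omega_1^{-1}\omega_2)^{m}(\omega_1^{-1}+\omega_2+\omega_1\omega_2^{-1})^{n}$, a measure $\varepsilon$ on $\mathbb{T}^2$ is called a spectral measure over $\mathbb{T}^2$ of $\Gamma$ if $\int_{\mathbb{T}^2}R_{m,n}\,\mathrm{d}\varepsilon=\langle\Delta^{m}(\Delta^\ast)^{n}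 e_1,e_1\rangle$ for all integers $m,n\ge0$. The group $S_3$ acts on $\mathbb{T}^2$, generated by $(\omega_1,\omega_2)\mapsto(\omega_2^{-1},\omega_1^{-1})$ and $(\omega_1,\omega_2)\mapsto(\omega_2^{-1},\omega_1\omega_2^{-1})$. For rational $s\ge2$ and $\tau=e^{2\pi i/s}$, $\mathrm{d}^{((s))}$ is the uniform probability measure on the union of the $S_3$-orbits of $(\tau,\tau)$, $(\overline{\omega}\,\overline{\tau},\omega)$, $(\omega,\overline{\omega}\,\overline{\tau})$. For $N\in\mathbb{N}$, $\mathrm{d}^{(N)}$ is the uniform probability measure on $D_N=\{(e^{2\pi iq_1/3N},e^{2\pi iq_2/3N}) : q_1,q_2\in\{0,\dots,3N-1\},\ q_1+q_2\equiv0 \bmod 3\}$. $J$ is the function on $\mathbb{T}^2$ given at $(e^{2\pi i\theta_1},e^{2\pi i\theta_2})$ by $J=4\pi^2\big(\sin(2\pi(\theta_1+\theta_2))-\sin(2\pi(2\theta_1-\theta_2))-\sin(2\pi(2\theta_2-\theta_1))\big)$, and $J^2\mathrm{d}^{(N)}$ is the measure with density $J^2$ with respect to $\mathrm{d}^{(N)}$. *)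

theory Defs
  imports
    "HOL-Analysis.Analysis"
    "HOL-Algebra.Algebra"
    "Jordan_Normal_Form.VS_Connect"
    "Jordan_Normal_Form.Schur_Decomposition"
begin

hide_const (open) Determinants.det Finite_Cartesian_Product.mat Finite_Cartesian_Product.vec

section \<open>Complex matrix groups\<close>

definition GL :: "nat \<Rightarrow> complex mat monoid" where
  "GL n = units_of (ring_mat TYPE(complex) n ())"

definition SU :: "nat \<Rightarrow> complex mat monoid" where
  "SU n = (GL n)\<lparr>carrier :=
     {A \<in> carrier_mat n n. A * mat_adjoint A = 1\<^sub>m n \<and> Determinant.det A = 1}\<rparr>"

definition \<omega> :: complex where
  "\<omega> = cis (2 * pi / 3)"

definition SU3_centre :: "complex mat set" where
  "SU3_centre = {c \<cdot>\<^sub>m 1\<^sub>m 3 | c. c \<in> {1, \<omega>, \<omega>\<^sup>2}}"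

section \<open>Matrix representations\<close>

text \<open>A representation of degree \<open>n\<close> is a homomorphism into \<open>GL n\<close>. It is a function on the whole
  type, but only its values on the carrier matter.\<close>

definition rep_equiv :: "'g monoid \<Rightarrow> ('g \<Rightarrow> complex mat) \<Rightarrow> ('g \<Rightarrow> complex mat) \<Rightarrow> bool" where
  "rep_equiv G \<pi> \<pi>' \<longleftrightarrow>
     (\<exists>n. \<pi> \<in> hom G (GL n) \<and> \<pi>' \<in> hom G (GL n) \<and>
        (\<exists>P \<in> carrier (GL n). \<forall>g \<in> carrier G. P * \<pi> g = \<pi>' g * P))"

definition irreducible_rep :: "'g monoid \<Rightarrow> ('g \<Rightarrow> complex mat) \<Rightarrow> bool" where
  "irreducible_rep G \<pi> \<longleftrightarrow>
     (\<exists>n>0. \<pi> \<in> hom G (GL n) \<and>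
        (\<forall>W. subspace class_ring W (module_vec TYPE(complex) n) \<longrightarrow>
             (\<forall>g \<in> carrier G. \<forall>v \<in> W. \<pi> g *\<^sub>v v \<in> W) \<longrightarrow>
             W = {0\<^sub>v n} \<or> W = carrier_vec n))"

definition trivial_rep :: "'g \<Rightarrow> complex mat" where
  "trivial_rep g = 1\<^sub>m 1"

definition kronecker :: "complex mat \<Rightarrow> complex mat \<Rightarrow> complex mat" where
  "kronecker A B = Matrix.mat (dim_row A * dim_row B) (dim_col A * dim_col B)
     (\<lambda>(i, j). A $$ (i div dim_row B, j div dim_col B) * B $$ (i mod dim_row B, j mod dim_col B))"

definition tensor_rep ::
    "('g \<Rightarrow> complex mat) \<Rightarrow> ('g \<Rightarrow> complex mat) \<Rightarrow> 'g \<Rightarrow> complex mat" where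
  "tensor_rep \<pi> \<pi>' g = kronecker (\<pi> g) (\<pi>' g)"

definition direct_sum_rep :: "('g \<Rightarrow> complex mat) list \<Rightarrow> 'g \<Rightarrow> complex mat" where
  "direct_sum_rep rs g = diag_block_mat (map (\<lambda>r. r g) rs)"

text \<open>The number of summands equivalent to \<open>\<sigma>\<close> in a decomposition of \<open>\<pi>\<close> into irreducibles; for a
  finite group, a decomposition exists and this number does not depend on it.\<close>

definition multiplicity_rep ::
    "'g monoid \<Rightarrow> ('g \<Rightarrow> complex mat) \<Rightarrow> ('g \<Rightarrow> complex mat) \<Rightarrow> nat" where
  "multiplicity_rep G \<sigma> \<pi> =
     (THE k. \<exists>rs. (\<forall>r \<in> set rs. irreducible_rep G r) \<and> rep_equiv G \<pi> (direct_sum_rep rs) \<and>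
                 k = length (filter (rep_equiv G \<sigma>) rs))"

section \<open>The McKay graph of a finite subgroup of \<open>SU(3)\<close>\<close>

definition irrep_list :: "'g monoid \<Rightarrow> ('g \<Rightarrow> complex mat) list \<Rightarrow> bool" where
  "irrep_list G \<sigma>s \<longleftrightarrow>
     (\<forall>\<sigma> \<in> set \<sigma>s. irreducible_rep G \<sigma>) \<and>
     (\<forall>\<pi>. irreducible_rep G \<pi> \<longrightarrow> (\<exists>!i. i < length \<sigma>s \<and> rep_equiv G \<pi> (\<sigma>s ! i))) \<and>
     rep_equiv G trivial_rep (\<sigma>s ! 0)"

text \<open>The vertices are listed by representatives of the classes of irreducible representations,
  with the trivial one at position \<open>0\<close>. The choice of the list affects the adjacency matrix only by
  a permutation of the remaining basis vectors.\<close>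

definition mckay_vertices :: "complex mat set \<Rightarrow> (complex mat \<Rightarrow> complex mat) list" where
  "mckay_vertices \<Gamma> = (SOME \<sigma>s. irrep_list ((SU 3)\<lparr>carrier := \<Gamma>\<rparr>) \<sigma>s)"

definition mckay_matrix :: "complex mat set \<Rightarrow> complex mat" where
  "mckay_matrix \<Gamma> =
     (let \<sigma>s = mckay_vertices \<Gamma> in
      Matrix.mat (length \<sigma>s) (length \<sigma>s)
        (\<lambda>(i, j). of_nat (multiplicity_rep ((SU 3)\<lparr>carrier := \<Gamma>\<rparr>) (\<sigma>s ! j)
                            (tensor_rep (\<lambda>g. g) (\<sigma>s ! i)))))"

section \<open>Spectral measures over the torus\<close>

definition torus :: "(complex \<times> complex) measure" where
  "torus = restrict_space borel (sphere 0 1 \<times> sphere 0 1)"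

definition R :: "nat \<Rightarrow> nat \<Rightarrow> complex \<times> complex \<Rightarrow> complex" where
  "R m n = (\<lambda>(w1, w2). (w1 + inverse w2 + inverse w1 * w2) ^ m *
                       (inverse w1 + w2 + w1 * inverse w2) ^ n)"

definition spectral_measure :: "complex mat set \<Rightarrow> (complex \<times> complex) measure \<Rightarrow> bool" where
  "spectral_measure \<Gamma> \<epsilon> \<longleftrightarrow> sets \<epsilon> = sets torus \<and>
     (\<forall>m n. let \<Delta> = mckay_matrix \<Gamma>; e1 = unit_vec (dim_row \<Delta>) 0 in
        (\<integral>w. R m n w \<partial>\<epsilon>) = (((\<Delta> ^\<^sub>m m) * (mat_adjoint \<Delta> ^\<^sub>m n)) *\<^sub>v e1) \<bullet>c e1)"

definition uniform_on_torus :: "(complex \<times> complex) set \<Rightarrow> (complex \<times> complex) measure" where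
  "uniform_on_torus D = distr (uniform_count_measure D) torus (\<lambda>w. w)"

text \<open>The two maps generate an action of \<open>S\<^sub>3\<close>. They have finite order, so closing up under the maps
  themselves, without their inverses, already gives the orbit.\<close>

inductive_set S3_orbit :: "complex \<times> complex \<Rightarrow> (complex \<times> complex) set" for w where
  base: "w \<in> S3_orbit w"
| flip: "(w1, w2) \<in> S3_orbit w \<Longrightarrow> (inverse w2, inverse w1) \<in> S3_orbit w"
| rot: "(w1, w2) \<in> S3_orbit w \<Longrightarrow> (inverse w2, w1 * inverse w2) \<in> S3_orbit w"

text \<open>\<open>d_orb s\<close> and \<open>d_lat N\<close> are the measures written \<open>d\<^sup>(\<^sup>(\<^sup>s\<^sup>)\<^sup>)\<close> and \<open>d\<^sup>(\<^sup>N\<^sup>)\<close>.\<close>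

definition d_orb :: "rat \<Rightarrow> (complex \<times> complex) measure" where
  "d_orb s =
     (let \<tau> = cis (2 * pi / of_rat s) in
      uniform_on_torus (S3_orbit (\<tau>, \<tau>) \<union> S3_orbit (cnj \<omega> * cnj \<tau>, \<omega>)
                        \<union> S3_orbit (\<omega>, cnj \<omega> * cnj \<tau>)))"

definition d_lat :: "nat \<Rightarrow> (complex \<times> complex) measure" where
  "d_lat N = uniform_on_torus
     {(cis (2 * pi * real q1 / (3 * real N)), cis (2 * pi * real q2 / (3 * real N))) | q1 q2.
        q1 < 3 * N \<and> q2 < 3 * N \<and> (q1 + q2) mod 3 = 0}"

definition J :: "complex \<times> complex \<Rightarrow> real" where
  "J = (\<lambda>(w1, w2).
     let \<theta>1 = Arg w1 / (2 * pi); \<theta>2 = Arg w2 / (2 * pi) in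
     4 * pi\<^sup>2 * (sin (2 * pi * (\<theta>1 + \<theta>2)) - sin (2 * pi * (2 * \<theta>1 - \<theta>2))
                - sin (2 * pi * (2 * \<theta>2 - \<theta>1))))"

lemma J_cis:
  "J (cis (2 * pi * \<theta>1), cis (2 * pi * \<theta>2)) =
     4 * pi\<^sup>2 * (sin (2 * pi * (\<theta>1 + \<theta>2)) - sin (2 * pi * (2 * \<theta>1 - \<theta>2))
                - sin (2 * pi * (2 * \<theta>2 - \<theta>1)))"
proof -
  define F :: "real \<Rightarrow> real \<Rightarrow> real"
    where "F a b = Im (cis a * cis b) - Im (cis a * cis a * cnj (cis b))
                   - Im (cis b * cis b * cnj (cis a))" for a b
  have F: "F a b = sin (a + b) - sin (2 * a - b) - sin (2 * b - a)" for a b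
    unfolding F_def cis_cnj cis_mult by (simp add: algebra_simps)
  have Arg_cis: "cis (Arg (cis t)) = cis t" for t
    by (metis cis_Arg cis_neq_zero norm_cis scaleR_one sgn_div_norm inverse_1)
  have "F (Arg (cis (2 * pi * \<theta>1))) (Arg (cis (2 * pi * \<theta>2))) = F (2 * pi * \<theta>1) (2 * pi * \<theta>2)"
    unfolding F_def by (simp only: Arg_cis)
  moreover have "J (w1, w2) = 4 * pi\<^sup>2 * F (Arg w1) (Arg w2)" for w1 w2
    unfolding F J_def by (simp add: Let_def field_simps)
  moreover have "F (2 * pi * \<theta>1) (2 * pi * \<theta>2) =
      sin (2 * pi * (\<theta>1 + \<theta>2)) - sin (2 * pi * (2 * \<theta>1 - \<theta>2))
      - sin (2 * pi * (2 * \<theta>2 - \<theta>1))"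
    unfolding F by (simp add: algebra_simps)
  ultimately show ?thesis
    by simp
qed

definition J2_d_lat :: "nat \<Rightarrow> (complex \<times> complex) measure" where
  "J2_d_lat N = density (d_lat N) (\<lambda>w. ennreal ((J w)\<^sup>2))"

end

theory Submission
  imports Defs
begin

text \<open>
  Over \<open>L\<close> the McKay matrix acts on irreducible characters as multiplication by the character of the
  inclusion, so \<open>\<langle>\<Delta>\<^sup>m (\<Delta>\<^sup>*)\<^sup>n e\<^sub>1, e\<^sub>1\<rangle>\<close> is the mean of \<open>tr(g)\<^sup>m cnj(tr(g))\<^sup>n\<close> over \<open>g \<in> L\<close>. An element of \<open>A\<^sub>6\<close> of
  order 2, 4 or 5 has a unique lift of the same order. A lifted involution has trace \<open>-1\<close>; the elements
  of order 4 and 5 are inverted by an involution, so their lifts have real trace, and the identity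
  \<open>tr(g\<^sup>2) = tr(g)\<^sup>2 - 2 cnj(tr(g))\<close> of \<open>SU(3)\<close> forces trace \<open>1\<close> respectively \<open>(1 \<plusminus> \<surd>5)/2\<close>, where squaring
  exchanges the two values. An element of order 3 permutes the involutions of some Klein four group
  cyclically, which forces trace \<open>0\<close>. The remaining elements of \<open>L\<close> are central multiples of these.
  On the side of the measure, \<open>R\<close> depends on a point only through \<open>t = \<omega>\<^sub>1 + \<omega>\<^sub>2\<^sup>-\<^sup>1 + \<omega>\<^sub>1\<^sup>-\<^sup>1\<omega>\<^sub>2\<close>, and \<open>t\<close> takes the
  same values with the same weights.
\<close>

text \<open>\<open>L\<close> is known only through its order and its quotient, so every trace has to
  be forced by relations in A_6 together with unitarity and determinant 1. As 2, 4 and 5 are prime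
  to 3, lifts of these orders can be normalised uniquely, and then a relation between such elements
  of A_6 becomes an equation of matrices. Elements of order 3 admit no such normalisation; hence the
  detour through a Klein four group, whose involutions do lift. The coefficients come from the class
  sizes 1, 45, 80, 90, 144. In units of 1/1080, and up to multiples of the trace by cube roots of
  unity, the six terms contribute 90 at trace 1, 80 at 0, then 15 at 3 and 45 at -1, then -14 at 3,
  and finally 72 at each of the two golden values. The negative coefficient is harmless because the
  points of \<open>d_lat 1\<close> are among those of \<open>d_lat 2\<close>: the mass left there is
  1/72 - 7/540 = 1/1080, the weight of one central element. The McKay matrix is defined by choices
  of matrix representations, so complete reducibility and orthogonality of characters are proved
  directly for matrices.\<close>

no_notation Finite_Cartesian_Product.vec_nth (infixl "$" 90)

section \<open>Traces and Kronecker products\<close>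

definition mtrace :: "'a::comm_monoid_add mat \<Rightarrow> 'a" where
  "mtrace A = (\<Sum>i<dim_row A. A $$ (i, i))"

lemma mult_mat_entry:
  assumes "A \<in> carrier_mat n k" "B \<in> carrier_mat k m" "i < n" "j < m"
  shows "(A * B) $$ (i, j) = (\<Sum>l<k. A $$ (i, l) * B $$ (l, j))"
  using assms by (simp add: scalar_prod_def atLeast0LessThan)

lemma mult_mat_vec_entry:
  assumes "A \<in> carrier_mat n k" "v \<in> carrier_vec k" "i < n"
  shows "(A *\<^sub>v v) $ i = (\<Sum>l<k. A $$ (i, l) * v $ l)"
  using assms by (simp add: scalar_prod_def atLeast0LessThan)

lemma mult_unit_vec_entry:
  assumes "A \<in> carrier_mat n m" "i < n" "j < m"
  shows "(A *\<^sub>v unit_vec m j) $ i = (A $$ (i, j) :: 'a::semiring_1)"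
  using assms
  by (simp add: mult_mat_vec_entry[OF assms(1)] unit_vec_def if_distrib[of "\<lambda>x. _ * x"] cong: if_cong
      del: index_mult_mat_vec)

lemma mtrace_mult_commute:
  fixes A B :: "'a::comm_semiring_0 mat"
  assumes "A \<in> carrier_mat n k" "B \<in> carrier_mat k n"
  shows "mtrace (A * B) = mtrace (B * A)"
proof -
  have "mtrace (A * B) = (\<Sum>i<n. \<Sum>l<k. A $$ (i, l) * B $$ (l, i))"
    using assms unfolding mtrace_def by (simp add: mult_mat_entry[OF assms] del: index_mult_mat(1))
  also have "\<dots> = (\<Sum>l<k. \<Sum>i<n. B $$ (l, i) * A $$ (i, l))"
    by (subst sum.swap) (simp add: mult.commute)
  also have "\<dots> = mtrace (B * A)"
    using assms unfolding mtrace_def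
    by (simp add: mult_mat_entry[OF assms(2,1)] del: index_mult_mat(1))
  finally show ?thesis .
qed

lemma mtrace_one: "mtrace (1\<^sub>m n :: 'a::semiring_1 mat) = of_nat n"
  by (simp add: mtrace_def)

lemma mtrace_smult:
  "mtrace (c \<cdot>\<^sub>m A) = c * mtrace (A :: 'a::semiring_0 mat)" if "A \<in> carrier_mat n n"
  using that by (simp add: mtrace_def sum_distrib_left)

lemma mtrace_add:
  "mtrace (A + B) = mtrace A + mtrace B" if "A \<in> carrier_mat n n" "B \<in> carrier_mat n n"
  using that by (simp add: mtrace_def sum.distrib)

lemma mtrace_four_block:
  assumes "A \<in> carrier_mat n n" "D \<in> carrier_mat m m"
  shows "mtrace (four_block_mat A B C D) = mtrace A + mtrace D"
proof -
  have "mtrace (four_block_mat A B C D) =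
      (\<Sum>i<n. A $$ (i, i)) + (\<Sum>i\<in>{n..<n+m}. D $$ (i - n, i - n))"
    using assms sum.atLeastLessThan_concat[of 0 n "n + m" "\<lambda>i. four_block_mat A B C D $$ (i, i)", symmetric]
    unfolding mtrace_def lessThan_atLeast0 by (simp add: four_block_mat_def Let_def)
  also have "(\<Sum>i\<in>{n..<n+m}. D $$ (i - n, i - n)) = (\<Sum>i<m. D $$ (i, i))"
    by (rule sum.reindex_bij_witness[of _ "\<lambda>i. i + n" "\<lambda>i. i - n"]) auto
  finally show ?thesis using assms by (simp add: mtrace_def)
qed

lemma mult_add_less: "i < m \<Longrightarrow> j < n \<Longrightarrow> i * n + j < m * (n::nat)"
  using mult_le_mono1[of "Suc i" m n] by simp

text \<open>Quotient and remainder are how \<open>kronecker\<close> packs a pair of indices into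
  one, so this turns every sum over Kronecker indices into a double sum.\<close>

lemma sum_div_mod:
  fixes f :: "nat \<Rightarrow> nat \<Rightarrow> 'a::comm_monoid_add"
  shows "(\<Sum>k<m * n. f (k div n) (k mod n)) = (\<Sum>i<m. \<Sum>j<n. f i j)"
proof (cases "n = 0")
  case False
  have "(\<Sum>i<m. \<Sum>j<n. f i j) = (\<Sum>(i, j)\<in>{..<m} \<times> {..<n}. f i j)"
    by (simp add: sum.cartesian_product)
  also have "\<dots> = (\<Sum>k<m * n. f (k div n) (k mod n))"
    using False
    by (intro sum.reindex_bij_witness[of _ "\<lambda>k. (k div n, k mod n)" "\<lambda>(i, j). i * n + j"])
       (auto simp: less_mult_imp_div_less mult_add_less)
  finally show ?thesis ..
qed simp

lemma kronecker_carrier: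
  "A \<in> carrier_mat n n \<Longrightarrow> B \<in> carrier_mat m m \<Longrightarrow> kronecker A B \<in> carrier_mat (n * m) (n * m)"
  by (simp add: kronecker_def)

lemma mtrace_kronecker:
  assumes "A \<in> carrier_mat n n" "B \<in> carrier_mat m m"
  shows "mtrace (kronecker A B) = mtrace A * mtrace B"
  using assms sum_div_mod[where f = "\<lambda>i j. A $$ (i, i) * B $$ (j, j)" and m = n and n = m]
  by (simp add: mtrace_def kronecker_def sum_product)

lemma kronecker_mult:
  assumes A: "A \<in> carrier_mat n n" "A' \<in> carrier_mat n n"
    and B: "B \<in> carrier_mat m m" "B' \<in> carrier_mat m m"
  shows "kronecker (A * A') (B * B') = kronecker A B * kronecker A' B'"
proof (rule eq_matI)
  fix i j
  assume "i < dim_row (kronecker A B * kronecker A' B')" "j < dim_col (kronecker A B * kronecker A' B')"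
  then have ij: "i < n * m" "j < n * m"
    using A B by (auto simp: kronecker_def)
  then have m: "m > 0" by (cases m) auto
  have b: "i div m < n" "j div m < n" "i mod m < m" "j mod m < m"
    using ij m by (auto simp: less_mult_imp_div_less)
  have "(kronecker A B * kronecker A' B') $$ (i, j) =
      (\<Sum>l<n * m. kronecker A B $$ (i, l) * kronecker A' B' $$ (l, j))"
    using A B ij by (intro mult_mat_entry) (auto intro: kronecker_carrier)
  also have "\<dots> = (\<Sum>l<n * m. A $$ (i div m, l div m) * B $$ (i mod m, l mod m)
      * (A' $$ (l div m, j div m) * B' $$ (l mod m, j mod m)))"
    using A B ij by (intro sum.cong) (auto simp: kronecker_def)
  also have "\<dots> = (\<Sum>p<n. \<Sum>q<m. A $$ (i div m, p) * B $$ (i mod m, q)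
      * (A' $$ (p, j div m) * B' $$ (q, j mod m)))"
    by (rule sum_div_mod)
  also have "\<dots> = (A * A') $$ (i div m, j div m) * (B * B') $$ (i mod m, j mod m)"
    using b by (simp add: mult_mat_entry[OF A] mult_mat_entry[OF B] sum_product mult_ac
        del: index_mult_mat(1))
  also have "\<dots> = kronecker (A * A') (B * B') $$ (i, j)"
    using A B ij by (simp add: kronecker_def)
  finally show "kronecker (A * A') (B * B') $$ (i, j) = (kronecker A B * kronecker A' B') $$ (i, j)" ..
qed (use A B in \<open>auto simp: kronecker_def\<close>)

lemma kronecker_one: "kronecker (1\<^sub>m n) (1\<^sub>m m) = 1\<^sub>m (n * m)"
proof (rule eq_matI)
  fix i j assume "i < dim_row (1\<^sub>m (n * m) :: complex mat)" "j < dim_col (1\<^sub>m (n * m) :: complex mat)"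
  then have ij: "i < n * m" "j < n * m" by auto
  then have m: "m > 0" by (cases m) auto
  have "i = j \<longleftrightarrow> i div m = j div m \<and> i mod m = j mod m"
    by (metis div_mult_mod_eq)
  then show "kronecker (1\<^sub>m n) (1\<^sub>m m) $$ (i, j) = 1\<^sub>m (n * m) $$ (i, j)"
    using ij m by (auto simp: kronecker_def less_mult_imp_div_less)
qed (auto simp: kronecker_def)

section \<open>Subspaces and matrices\<close>

abbreviation (input) vec_subspace :: "complex vec set \<Rightarrow> nat \<Rightarrow> bool" where
  "vec_subspace W n \<equiv> VectorSpace.subspace class_ring W (module_vec TYPE(complex) n)"

lemma subspace_vecI:
  assumes "W \<subseteq> carrier_vec n" "0\<^sub>v n \<in> W"
    "\<And>v w. v \<in> W \<Longrightarrow> w \<in> W \<Longrightarrow> v + w \<in> W" "\<And>c v. v \<in> W \<Longrightarrow> c \<cdot>\<^sub>v v \<in> W"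
  shows "subspace class_ring W (module_vec TYPE('a::field) n)"
  unfolding VectorSpace.subspace_def submodule_def
  using assms vec_vs vec_module by (auto simp: module_vec_def)

lemma subspace_vecD:
  assumes "subspace class_ring W (module_vec TYPE('a::field) n)"
  shows "W \<subseteq> carrier_vec n" "0\<^sub>v n \<in> W"
    "\<And>v w. v \<in> W \<Longrightarrow> w \<in> W \<Longrightarrow> v + w \<in> W" "\<And>c v. v \<in> W \<Longrightarrow> c \<cdot>\<^sub>v v \<in> W"
  using assms unfolding VectorSpace.subspace_def submodule_def
  by (auto simp: module_vec_def class_ring_simps)

definition inj_mat :: "'a::field mat \<Rightarrow> bool" where
  "inj_mat A \<longleftrightarrow> (\<forall>v \<in> carrier_vec (dim_col A). A *\<^sub>v v = 0\<^sub>v (dim_row A) \<longrightarrow> v = 0\<^sub>v (dim_col A))"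

definition mat_range :: "'a::field mat \<Rightarrow> 'a vec set" where
  "mat_range A = (\<lambda>v. A *\<^sub>v v) ` carrier_vec (dim_col A)"

lemma mat_eqI_vec:
  fixes A B :: "'a::semiring_1 mat"
  assumes A: "A \<in> carrier_mat n m" and B: "B \<in> carrier_mat n m"
    and eq: "\<And>v. v \<in> carrier_vec m \<Longrightarrow> A *\<^sub>v v = B *\<^sub>v v"
  shows "A = B"
proof (rule eq_matI)
  fix i j assume "i < dim_row B" "j < dim_col B"
  then have ij: "i < n" "j < m" using B by auto
  show "A $$ (i, j) = B $$ (i, j)"
    using mult_unit_vec_entry[OF A ij] mult_unit_vec_entry[OF B ij] by (simp add: eq)
qed (use A B in auto)

text \<open>Surjectivity gives a right inverse column by column and injectivity makes it two-sided.
  Comparing the traces of \<open>T * S\<close> and \<open>S * T\<close> then yields equal dimensions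
  without any dimension theory.\<close>

lemma inj_surj_mat:
  fixes T :: "complex mat"
  assumes T: "T \<in> carrier_mat n' n" and inj: "inj_mat T" and surj: "mat_range T = carrier_vec n'"
  shows "n' = n" and "\<exists>S \<in> carrier_mat n n. T * S = 1\<^sub>m n \<and> S * T = 1\<^sub>m n"
proof -
  have "\<forall>i. \<exists>v \<in> carrier_vec n. T *\<^sub>v v = unit_vec n' i"
  proof
    fix i
    have "unit_vec n' i \<in> mat_range T" by (simp add: surj)
    then show "\<exists>v \<in> carrier_vec n. T *\<^sub>v v = unit_vec n' i"
      using T by (auto simp: mat_range_def)
  qed
  then obtain p where p: "\<And>i. p i \<in> carrier_vec n" "\<And>i. T *\<^sub>v p i = unit_vec n' i" by metis
  define S where "S = Matrix.mat n n' (\<lambda>(i, j). p j $ i)"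
  have S: "S \<in> carrier_mat n n'" by (simp add: S_def)
  have TS: "T * S = 1\<^sub>m n'"
  proof (rule eq_matI)
    fix i j assume "i < dim_row (1\<^sub>m n' :: complex mat)" "j < dim_col (1\<^sub>m n' :: complex mat)"
    then have ij: "i < n'" "j < n'" by auto
    have "(T * S) $$ (i, j) = (T *\<^sub>v p j) $ i"
      using mult_mat_entry[OF T S ij] mult_mat_vec_entry[OF T p(1) ij(1)] ij by (simp add: S_def)
    then show "(T * S) $$ (i, j) = 1\<^sub>m n' $$ (i, j)" using p(2) ij by (simp add: unit_vec_def)
  qed (use T S in auto)
  have ST: "S * T = 1\<^sub>m n"
  proof (rule mat_eqI_vec)
    fix v :: "complex vec" assume v: "v \<in> carrier_vec n"
    have Sv: "S *\<^sub>v (T *\<^sub>v v) \<in> carrier_vec n" using S T v by auto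
    have "T *\<^sub>v (S *\<^sub>v (T *\<^sub>v v) - v) = T *\<^sub>v (S *\<^sub>v (T *\<^sub>v v)) - T *\<^sub>v v"
      using T Sv v by (rule mult_minus_distrib_mat_vec)
    also have "T *\<^sub>v (S *\<^sub>v (T *\<^sub>v v)) = (T * S) *\<^sub>v (T *\<^sub>v v)"
      using T S v by (simp add: assoc_mult_mat_vec[OF T S])
    also have "(T * S) *\<^sub>v (T *\<^sub>v v) - T *\<^sub>v v = 0\<^sub>v n'"
      unfolding TS using T v by auto
    finally have "S *\<^sub>v (T *\<^sub>v v) - v = 0\<^sub>v n"
      using inj T v Sv unfolding inj_mat_def by auto
    then have "(S *\<^sub>v (T *\<^sub>v v) - v) $ i = 0" if "i < n" for i
      using that by simp
    then have "S *\<^sub>v (T *\<^sub>v v) = v"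
      using v Sv S by (intro eq_vecI) (auto simp del: index_mult_mat_vec)
    then show "S * T *\<^sub>v v = 1\<^sub>m n *\<^sub>v v" using v T S by auto
  qed (use S T in auto)
  have "of_nat n' = mtrace (T * S)" unfolding TS by (simp add: mtrace_one)
  also have "\<dots> = mtrace (S * T)" using T S by (rule mtrace_mult_commute)
  also have "\<dots> = of_nat n" unfolding ST by (simp add: mtrace_one)
  finally show "n' = n" by simp
  then show "\<exists>S \<in> carrier_mat n n. T * S = 1\<^sub>m n \<and> S * T = 1\<^sub>m n" using S TS ST by auto
qed

text \<open>If there were more columns than rows, padding with zero rows would give a singular
  square matrix, and a vector in its kernel is killed by \<open>P\<close>. The bound makes the
  extension of bases terminate.\<close>

lemma inj_mat_dim_le:
  fixes P :: "complex mat"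
  assumes P: "P \<in> carrier_mat n r" and inj: "inj_mat P"
  shows "r \<le> n"
proof (rule ccontr)
  assume "\<not> r \<le> n"
  define Q where "Q = Matrix.mat r r (\<lambda>(i, j). if i < n then P $$ (i, j) else 0)"
  have Q: "Q \<in> carrier_mat r r" by (simp add: Q_def)
  have "Determinant.det Q = 0"
  proof -
    have "Determinant.det Q = (\<Sum>j<r. Q $$ (n, j) * cofactor Q n j)"
      using \<open>\<not> r \<le> n\<close> by (intro laplace_expansion_row[OF Q]) auto
    also have "\<dots> = 0" using \<open>\<not> r \<le> n\<close> by (intro sum.neutral) (auto simp: Q_def)
    finally show ?thesis .
  qed
  then obtain v where v: "v \<in> carrier_vec r" "v \<noteq> 0\<^sub>v r" "Q *\<^sub>v v = 0\<^sub>v r"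
    using det_0_iff_vec_prod_zero_field[OF Q] by auto
  have "P *\<^sub>v v = 0\<^sub>v n"
  proof (rule eq_vecI)
    fix i assume "i < dim_vec (0\<^sub>v n :: complex vec)"
    then have i: "i < n" "i < r" using \<open>\<not> r \<le> n\<close> by auto
    have "(P *\<^sub>v v) $ i = (Q *\<^sub>v v) $ i"
      using mult_mat_vec_entry[OF P v(1) i(1)] mult_mat_vec_entry[OF Q v(1) i(2)] i
      by (simp add: Q_def)
    then show "(P *\<^sub>v v) $ i = 0\<^sub>v n $ i" using v i by simp
  qed (use P in auto)
  then show False using inj P v unfolding inj_mat_def by auto
qed

lemma assoc_mult_mat_dim:
  "dim_col A = dim_row B \<Longrightarrow> dim_col B = dim_row C \<Longrightarrow> A * B * C = A * (B * C :: 'a::semiring_0 mat)"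
  by (rule assoc_mult_mat) auto

lemma smult_one_mult_vec:
  fixes v :: "'a::comm_semiring_1 vec"
  assumes v: "v \<in> carrier_vec n"
  shows "(c \<cdot>\<^sub>m 1\<^sub>m n) *\<^sub>v v = c \<cdot>\<^sub>v v"
proof (rule eq_vecI)
  fix i assume "i < dim_vec (c \<cdot>\<^sub>v v)"
  then have i: "i < n" using v by simp
  have "((c \<cdot>\<^sub>m 1\<^sub>m n) *\<^sub>v v) $ i = (\<Sum>l<n. (c \<cdot>\<^sub>m 1\<^sub>m n) $$ (i, l) * v $ l)"
    using v i by (intro mult_mat_vec_entry) auto
  also have "\<dots> = (\<Sum>l<n. if l = i then c * v $ l else 0)"
    using i by (intro sum.cong) auto
  finally show "((c \<cdot>\<^sub>m 1\<^sub>m n) *\<^sub>v v) $ i = (c \<cdot>\<^sub>v v) $ i"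
    using i v by simp
qed (use v in auto)

section \<open>Matrix representations of finite groups\<close>

text \<open>Matrices of varying size form no additive monoid in the type, hence the entrywise sum.\<close>

definition msum :: "nat \<Rightarrow> nat \<Rightarrow> ('g \<Rightarrow> 'a::semiring_0 mat) \<Rightarrow> 'g set \<Rightarrow> 'a mat" where
  "msum n m f S = Matrix.mat n m (\<lambda>(i, j). \<Sum>g\<in>S. f g $$ (i, j))"

lemma msum_carrier [simp]: "msum n m f S \<in> carrier_mat n m"
  by (simp add: msum_def)

lemma msum_dim [simp]: "dim_row (msum n m f S) = n" "dim_col (msum n m f S) = m"
  by (simp_all add: msum_def)

lemma msum_entry: "i < n \<Longrightarrow> j < m \<Longrightarrow> msum n m f S $$ (i, j) = (\<Sum>g\<in>S. f g $$ (i, j))"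
  by (simp add: msum_def)

lemma msum_cong: "(\<And>g. g \<in> S \<Longrightarrow> f g = f' g) \<Longrightarrow> msum n m f S = msum n m f' S"
  by (simp add: msum_def cong: sum.cong)

lemma mult_msum:
  assumes A: "A \<in> carrier_mat k n" and f: "\<And>g. g \<in> S \<Longrightarrow> f g \<in> carrier_mat n m"
  shows "A * msum n m f S = msum k m (\<lambda>g. A * f g) S"
proof (rule eq_matI)
  fix i j assume "i < dim_row (msum k m (\<lambda>g. A * f g) S)" "j < dim_col (msum k m (\<lambda>g. A * f g) S)"
  then have ij: "i < k" "j < m" by auto
  have "(A * msum n m f S) $$ (i, j) = (\<Sum>l<n. \<Sum>g\<in>S. A $$ (i, l) * f g $$ (l, j))"
    using mult_mat_entry[OF A msum_carrier ij, of f S] ij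
    by (simp add: msum_entry sum_distrib_left del: index_mult_mat)
  also have "\<dots> = (\<Sum>g\<in>S. (A * f g) $$ (i, j))"
    using f by (subst sum.swap) (intro sum.cong refl, simp add: mult_mat_entry[OF A _ ij] del: index_mult_mat)
  finally show "(A * msum n m f S) $$ (i, j) = msum k m (\<lambda>g. A * f g) S $$ (i, j)"
    using ij by (simp add: msum_entry del: index_mult_mat)
qed (use A in auto)

lemma msum_mult:
  assumes A: "A \<in> carrier_mat m k" and f: "\<And>g. g \<in> S \<Longrightarrow> f g \<in> carrier_mat n m"
  shows "msum n m f S * A = msum n k (\<lambda>g. f g * A) S"
proof (rule eq_matI)
  fix i j assume "i < dim_row (msum n k (\<lambda>g. f g * A) S)" "j < dim_col (msum n k (\<lambda>g. f g * A) S)"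
  then have ij: "i < n" "j < k" by auto
  have "(msum n m f S * A) $$ (i, j) = (\<Sum>l<m. \<Sum>g\<in>S. f g $$ (i, l) * A $$ (l, j))"
    using mult_mat_entry[OF msum_carrier A ij, of f S] ij
    by (simp add: msum_entry sum_distrib_right del: index_mult_mat)
  also have "\<dots> = (\<Sum>g\<in>S. (f g * A) $$ (i, j))"
    using f by (subst sum.swap) (intro sum.cong refl, simp add: mult_mat_entry[OF _ A ij] del: index_mult_mat)
  finally show "(msum n m f S * A) $$ (i, j) = msum n k (\<lambda>g. f g * A) S $$ (i, j)"
    using ij by (simp add: msum_entry del: index_mult_mat)
qed (use A in auto)

lemma msum_add:
  assumes "\<And>g. g \<in> S \<Longrightarrow> f g \<in> carrier_mat n m" "\<And>g. g \<in> S \<Longrightarrow> f' g \<in> carrier_mat n m"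
  shows "msum n m (\<lambda>g. f g + f' g) S = msum n m f S + msum n m f' S"
proof (rule eq_matI)
  fix i j assume "i < dim_row (msum n m f S + msum n m f' S)" "j < dim_col (msum n m f S + msum n m f' S)"
  then have ij: "i < n" "j < m" by auto
  have "(f g + f' g) $$ (i, j) = f g $$ (i, j) + f' g $$ (i, j)" if "g \<in> S" for g
    using assms[OF that] ij by auto
  then show "msum n m (\<lambda>g. f g + f' g) S $$ (i, j) = (msum n m f S + msum n m f' S) $$ (i, j)"
    using ij by (simp add: msum_entry sum.distrib)
qed auto

lemma msum_const:
  assumes "A \<in> carrier_mat n m"
  shows "msum n m (\<lambda>g. A) S = of_nat (card S) \<cdot>\<^sub>m (A :: 'a::semiring_1 mat)"
  using assms by (intro eq_matI) (auto simp: msum_entry)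

lemma mtrace_msum:
  assumes "\<And>g. g \<in> S \<Longrightarrow> f g \<in> carrier_mat n n"
  shows "mtrace (msum n n f S) = (\<Sum>g\<in>S. mtrace (f g))"
proof -
  have "mtrace (msum n n f S) = (\<Sum>i<n. \<Sum>g\<in>S. f g $$ (i, i))"
    by (simp add: mtrace_def msum_entry)
  also have "\<dots> = (\<Sum>g\<in>S. mtrace (f g))"
    using assms by (subst sum.swap) (auto intro!: sum.cong simp: mtrace_def)
  finally show ?thesis .
qed

lemma GL_simps:
  "A \<in> carrier (GL n) \<longleftrightarrow> A \<in> carrier_mat n n \<and> (\<exists>B \<in> carrier_mat n n. B * A = 1\<^sub>m n \<and> A * B = 1\<^sub>m n)"
  "mult (GL n) = (*)" "one (GL n) = 1\<^sub>m n"
  by (auto simp: GL_def units_of_def Units_def ring_mat_def)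

locale finite_group = group G for G :: "'g monoid" (structure) +
  assumes fin: "finite (carrier G)"
begin

text \<open>Invertibility comes for free: the matrix at the inverse element is the inverse
  matrix.\<close>

lemma repI:
  assumes "\<And>g. g \<in> carrier G \<Longrightarrow> \<pi> g \<in> carrier_mat n n"
    and "\<And>g h. g \<in> carrier G \<Longrightarrow> h \<in> carrier G \<Longrightarrow> \<pi> (g \<otimes> h) = \<pi> g * \<pi> h"
    and "\<pi> \<one> = 1\<^sub>m n"
  shows "\<pi> \<in> hom G (GL n)"
  unfolding hom_def using assms
  apply (auto simp: GL_simps)
  subgoal for g
    by (rule bexI[of _ "\<pi> (inv g)"]) (simp_all flip: assms(2))
  done

lemma repD:
  assumes "\<pi> \<in> hom G (GL n)"
  shows "g \<in> carrier G \<Longrightarrow> \<pi> g \<in> carrier_mat n n"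
    and "g \<in> carrier G \<Longrightarrow> h \<in> carrier G \<Longrightarrow> \<pi> (g \<otimes> h) = \<pi> g * \<pi> h"
    and "\<pi> \<one> = 1\<^sub>m n"
    and "g \<in> carrier G \<Longrightarrow> \<pi> g * \<pi> (inv g) = 1\<^sub>m n"
    and "g \<in> carrier G \<Longrightarrow> \<pi> (inv g) * \<pi> g = 1\<^sub>m n"
proof -
  show c: "\<pi> g \<in> carrier_mat n n" if "g \<in> carrier G" for g
    using assms that by (auto simp: hom_def GL_simps)
  show m: "\<pi> (g \<otimes> h) = \<pi> g * \<pi> h" if "g \<in> carrier G" "h \<in> carrier G" for g h
    using assms that by (auto simp: hom_def GL_simps)
  \<comment> \<open>The image of the unit is idempotent and invertible, hence the identity
    matrix.\<close>
  have "\<pi> \<one> \<in> carrier (GL n)" using assms by (auto simp: hom_def)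
  then obtain B where B: "B \<in> carrier_mat n n" "B * \<pi> \<one> = 1\<^sub>m n"
    unfolding GL_simps by blast
  have "\<pi> \<one> = B * \<pi> \<one> * \<pi> \<one>" using B c[of \<one>] by simp
  also have "\<dots> = B * (\<pi> \<one> * \<pi> \<one>)" using B(1) c[of \<one>] by (intro assoc_mult_mat) auto
  also have "\<pi> \<one> * \<pi> \<one> = \<pi> \<one>" using m[of \<one> \<one>] by simp
  finally show 1: "\<pi> \<one> = 1\<^sub>m n" using B by simp
  show "\<pi> g * \<pi> (inv g) = 1\<^sub>m n" "\<pi> (inv g) * \<pi> g = 1\<^sub>m n" if "g \<in> carrier G"
    using that 1 by (simp_all flip: m)
qed

lemma rep_conj:
  assumes \<pi>: "\<pi> \<in> hom G (GL n)" and P: "P \<in> carrier_mat n m" "Q \<in> carrier_mat m n"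
    and PQ: "P * Q = 1\<^sub>m n" "Q * P = 1\<^sub>m m"
  shows "(\<lambda>g. Q * \<pi> g * P) \<in> hom G (GL m)"
proof (rule repI)
  fix g h assume "g \<in> carrier G" "h \<in> carrier G"
  note r = repD(1)[OF \<pi> this(1)] repD(1)[OF \<pi> this(2)] repD(2)[OF \<pi> this]
  have "Q * \<pi> g * P * (Q * \<pi> h * P) = Q * \<pi> g * (P * Q) * \<pi> h * P"
    using r P by (simp add: assoc_mult_mat_dim)
  then show "Q * \<pi> (g \<otimes> h) * P = Q * \<pi> g * P * (Q * \<pi> h * P)"
    unfolding PQ using r P by (simp add: assoc_mult_mat_dim)
qed (use P PQ repD[OF \<pi>] in auto)

lemma rep_equivI:
  assumes "\<pi> \<in> hom G (GL n)" "\<pi>' \<in> hom G (GL n)" "P \<in> carrier_mat n n" "Q \<in> carrier_mat n n"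
    "P * Q = 1\<^sub>m n" "Q * P = 1\<^sub>m n" "\<And>g. g \<in> carrier G \<Longrightarrow> P * \<pi> g = \<pi>' g * P"
  shows "rep_equiv G \<pi> \<pi>'"
proof -
  have "P \<in> carrier (GL n)" using assms(3-6) by (auto simp: GL_simps)
  then show ?thesis unfolding rep_equiv_def using assms(1,2,7) by blast
qed

lemma rep_equivE:
  assumes "rep_equiv G \<pi> \<pi>'"
  obtains n P Q where "\<pi> \<in> hom G (GL n)" "\<pi>' \<in> hom G (GL n)" "P \<in> carrier_mat n n" "Q \<in> carrier_mat n n"
    "P * Q = 1\<^sub>m n" "Q * P = 1\<^sub>m n" "\<And>g. g \<in> carrier G \<Longrightarrow> P * \<pi> g = \<pi>' g * P"
proof -
  from assms obtain n P where P: "\<pi> \<in> hom G (GL n)" "\<pi>' \<in> hom G (GL n)" "P \<in> carrier (GL n)"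
    "\<And>g. g \<in> carrier G \<Longrightarrow> P * \<pi> g = \<pi>' g * P"
    unfolding rep_equiv_def by blast
  from P(3) obtain Q where "P \<in> carrier_mat n n" "Q \<in> carrier_mat n n" "Q * P = 1\<^sub>m n" "P * Q = 1\<^sub>m n"
    unfolding GL_simps by blast
  with P that show ?thesis by blast
qed

text \<open>The degree is hidden behind an existential quantifier in \<open>rep_equiv\<close> and
  \<open>irreducible_rep\<close>; the size of the matrix at the unit recovers it.\<close>

lemma rep_dim_unique: "\<pi> \<in> hom G (GL n) \<Longrightarrow> \<pi> \<in> hom G (GL m) \<Longrightarrow> n = m"
  using repD(1)[of \<pi> n \<one>] repD(1)[of \<pi> m \<one>] by auto

lemma rep_equiv_refl: "\<pi> \<in> hom G (GL n) \<Longrightarrow> rep_equiv G \<pi> \<pi>"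
  by (rule rep_equivI[of _ n _ "1\<^sub>m n" "1\<^sub>m n"]) (auto dest: repD(1))

lemma rep_equiv_conj:
  assumes \<pi>: "\<pi> \<in> hom G (GL n)" and P: "P \<in> carrier_mat n n" "Q \<in> carrier_mat n n"
    and PQ: "P * Q = 1\<^sub>m n" "Q * P = 1\<^sub>m n"
  shows "rep_equiv G \<pi> (\<lambda>g. Q * \<pi> g * P)"
proof (rule rep_equivI[OF \<pi> rep_conj[OF \<pi> P PQ] P(2,1) PQ(2,1)])
  fix g assume "g \<in> carrier G"
  then have r: "\<pi> g \<in> carrier_mat n n" by (rule repD(1)[OF \<pi>])
  show "Q * \<pi> g = Q * \<pi> g * P * Q" using r P PQ by (simp add: assoc_mult_mat_dim)
qed

lemma rep_equiv_sym: "rep_equiv G \<pi> \<pi>' \<Longrightarrow> rep_equiv G \<pi>' \<pi>"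
proof (elim rep_equivE)
  fix n P Q assume *: "\<pi> \<in> hom G (GL n)" "\<pi>' \<in> hom G (GL n)" "P \<in> carrier_mat n n" "Q \<in> carrier_mat n n"
    "P * Q = 1\<^sub>m n" "Q * P = 1\<^sub>m n" "\<And>g. g \<in> carrier G \<Longrightarrow> P * \<pi> g = \<pi>' g * P"
  show ?thesis
  proof (rule rep_equivI[OF *(2,1,4,3,6,5)])
    fix g assume g: "g \<in> carrier G"
    note r = repD(1)[OF *(1) g] repD(1)[OF *(2) g]
    have "Q * \<pi>' g = Q * (\<pi>' g * P) * Q" using r * by (simp add: assoc_mult_mat_dim)
    also have "\<dots> = (Q * P) * \<pi> g * Q" unfolding *(7)[OF g, symmetric]
      using r *(3,4) by (simp add: assoc_mult_mat_dim)
    finally show "Q * \<pi>' g = \<pi> g * Q" using r * by simp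
  qed
qed

lemma rep_equiv_trans: "rep_equiv G \<pi> \<pi>' \<Longrightarrow> rep_equiv G \<pi>' \<pi>'' \<Longrightarrow> rep_equiv G \<pi> \<pi>''"
proof (elim rep_equivE)
  fix n P Q m P' Q'
  assume *: "\<pi> \<in> hom G (GL n)" "\<pi>' \<in> hom G (GL n)" "P \<in> carrier_mat n n" "Q \<in> carrier_mat n n"
    "P * Q = 1\<^sub>m n" "Q * P = 1\<^sub>m n" "\<And>g. g \<in> carrier G \<Longrightarrow> P * \<pi> g = \<pi>' g * P"
    and **: "\<pi>' \<in> hom G (GL m)" "\<pi>'' \<in> hom G (GL m)" "P' \<in> carrier_mat m m" "Q' \<in> carrier_mat m m"
    "P' * Q' = 1\<^sub>m m" "Q' * P' = 1\<^sub>m m" "\<And>g. g \<in> carrier G \<Longrightarrow> P' * \<pi>' g = \<pi>'' g * P'"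
  have [simp]: "m = n" using *(2) **(1) rep_dim_unique by blast
  show ?thesis
  proof (rule rep_equivI[of _ n _ "P' * P" "Q * Q'"])
    have "P' * P * (Q * Q') = P' * (P * Q) * Q'" using *(3,4) **(3,4) by (simp add: assoc_mult_mat_dim)
    then show "P' * P * (Q * Q') = 1\<^sub>m n" using * ** by simp
    have "Q * Q' * (P' * P) = Q * (Q' * P') * P" using *(3,4) **(3,4) by (simp add: assoc_mult_mat_dim)
    then show "Q * Q' * (P' * P) = 1\<^sub>m n" using * ** by simp
    fix g assume g: "g \<in> carrier G"
    note r = repD(1)[OF *(1) g] repD(1)[OF *(2) g] repD(1)[OF **(2) g]
    have "P' * P * \<pi> g = P' * (\<pi>' g * P)" using *(3,7) **(3) g r by (simp add: assoc_mult_mat_dim)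
    also have "\<dots> = P' * \<pi>' g * P" using *(3) **(3) r by (simp add: assoc_mult_mat_dim)
    also have "\<dots> = \<pi>'' g * P' * P" using **(7)[OF g] by simp
    finally show "P' * P * \<pi> g = \<pi>'' g * (P' * P)" using *(3) **(3) r by (simp add: assoc_mult_mat_dim)
  qed (use * ** in auto)
qed

lemma rep_equiv_mtrace:
  assumes "rep_equiv G \<pi> \<pi>'" and g: "g \<in> carrier G"
  shows "mtrace (\<pi> g) = mtrace (\<pi>' g)"
  using assms(1)
proof (elim rep_equivE)
  fix n P Q assume *: "\<pi> \<in> hom G (GL n)" "\<pi>' \<in> hom G (GL n)" "P \<in> carrier_mat n n" "Q \<in> carrier_mat n n"
    "P * Q = 1\<^sub>m n" "Q * P = 1\<^sub>m n" "\<And>g. g \<in> carrier G \<Longrightarrow> P * \<pi> g = \<pi>' g * P"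
  note r = repD(1)[OF *(1) g] repD(1)[OF *(2) g]
  have "mtrace (\<pi> g) = mtrace (Q * (P * \<pi> g))"
    using r * by (simp flip: assoc_mult_mat_dim)
  also have "\<dots> = mtrace (P * \<pi> g * Q)" using r * by (intro mtrace_mult_commute) auto
  also have "P * \<pi> g * Q = \<pi>' g" unfolding *(7)[OF g] using r * by (simp add: assoc_mult_mat_dim)
  finally show ?thesis .
qed

subsection \<open>Schur's lemma\<close>

lemma irrep_dim:
  assumes "irreducible_rep G \<pi>" "\<pi> \<in> hom G (GL n)"
  shows "n > 0"
    and "\<lbrakk>vec_subspace W n;
      \<And>g v. g \<in> carrier G \<Longrightarrow> v \<in> W \<Longrightarrow> \<pi> g *\<^sub>v v \<in> W\<rbrakk> \<Longrightarrow> W = {0\<^sub>v n} \<or> W = carrier_vec n"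
proof -
  from assms(1) obtain m where m: "m > 0" "\<pi> \<in> hom G (GL m)"
    and sub: "\<forall>W. vec_subspace W m \<longrightarrow>
             (\<forall>g \<in> carrier G. \<forall>v \<in> W. \<pi> g *\<^sub>v v \<in> W) \<longrightarrow>
             W = {0\<^sub>v m} \<or> W = carrier_vec m"
    unfolding irreducible_rep_def by (elim exE conjE)
  have "m = n" using m(2) assms(2) by (rule rep_dim_unique)
  with m show "n > 0" by simp
  show "W = {0\<^sub>v n} \<or> W = carrier_vec n"
    if "vec_subspace W n"
      "\<And>g v. g \<in> carrier G \<Longrightarrow> v \<in> W \<Longrightarrow> \<pi> g *\<^sub>v v \<in> W"
    using sub[rule_format, of W] that unfolding \<open>m = n\<close> by simp
qed

text \<open>Kernel and range of an intertwiner are invariant subspaces. The degrees \<open>n\<close>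
  and \<open>n'\<close> stay independent here; their equality is drawn from the conclusion by
  \<open>inj_surj_mat\<close>.\<close>

lemma schur:
  assumes irr: "irreducible_rep G \<sigma>" "irreducible_rep G \<sigma>'"
    and \<sigma>: "\<sigma> \<in> hom G (GL n)" and \<sigma>': "\<sigma>' \<in> hom G (GL n')"
    and T: "T \<in> carrier_mat n' n"
    and eq: "\<And>g. g \<in> carrier G \<Longrightarrow> T * \<sigma> g = \<sigma>' g * T"
    and nz: "T \<noteq> 0\<^sub>m n' n"
  shows "inj_mat T" and "mat_range T = carrier_vec n'"
proof -
  define K where "K = {v \<in> carrier_vec n. T *\<^sub>v v = 0\<^sub>v n'}"
  have sub: "vec_subspace K n"
    using T by (intro subspace_vecI) (auto simp: K_def mult_add_distrib_mat_vec mult_mat_vec)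
  have "\<sigma> g *\<^sub>v v \<in> K" if "g \<in> carrier G" "v \<in> K" for g v
  proof -
    have v: "v \<in> carrier_vec n" "T *\<^sub>v v = 0\<^sub>v n'" using that by (auto simp: K_def)
    note r = repD(1)[OF \<sigma> that(1)] repD(1)[OF \<sigma>' that(1)]
    have "T *\<^sub>v (\<sigma> g *\<^sub>v v) = \<sigma>' g *\<^sub>v (T *\<^sub>v v)"
      using assoc_mult_mat_vec[OF T r(1) v(1)] assoc_mult_mat_vec[OF r(2) T v(1)] eq[OF that(1)] by simp
    also have "\<dots> = 0\<^sub>v n'" using r v(2) by auto
    finally show ?thesis using r v unfolding K_def by auto
  qed
  then have "K = {0\<^sub>v n} \<or> K = carrier_vec n" by (intro irrep_dim(2)[OF irr(1) \<sigma> sub])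
  moreover have "K \<noteq> carrier_vec n"
  proof
    assume K: "K = carrier_vec n"
    have "T = 0\<^sub>m n' n"
    proof (rule mat_eqI_vec[OF T])
      fix v :: "complex vec" assume "v \<in> carrier_vec n"
      then have "v \<in> K" using K by simp
      then show "T *\<^sub>v v = 0\<^sub>m n' n *\<^sub>v v" unfolding K_def by auto
    qed auto
    then show False using nz by simp
  qed
  ultimately show "inj_mat T" using T unfolding inj_mat_def K_def by auto
  define W where "W = mat_range T"
  have sub: "vec_subspace W n'"
  proof (rule subspace_vecI)
    show "0\<^sub>v n' \<in> W" using T unfolding W_def mat_range_def by (intro image_eqI[of _ _ "0\<^sub>v n"]) auto
    show "v + w \<in> W" if "v \<in> W" "w \<in> W" for v w
      using that T unfolding W_def mat_range_def
      by (auto simp flip: mult_add_distrib_mat_vec)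
    show "c \<cdot>\<^sub>v v \<in> W" if "v \<in> W" for c v
      using that T unfolding W_def mat_range_def
      by (auto simp flip: mult_mat_vec)
  qed (use T in \<open>auto simp: W_def mat_range_def\<close>)
  have "\<sigma>' g *\<^sub>v w \<in> W" if g: "g \<in> carrier G" and w: "w \<in> W" for g w
  proof -
    obtain v where v: "v \<in> carrier_vec n" "w = T *\<^sub>v v" using w T by (auto simp: W_def mat_range_def)
    note r = repD(1)[OF \<sigma> g] repD(1)[OF \<sigma>' g]
    have "\<sigma>' g *\<^sub>v w = T *\<^sub>v (\<sigma> g *\<^sub>v v)"
      using assoc_mult_mat_vec[OF T r(1) v(1)] assoc_mult_mat_vec[OF r(2) T v(1)] eq[OF g] v by simp
    then show ?thesis using r v T unfolding W_def mat_range_def by auto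
  qed
  then have "W = {0\<^sub>v n'} \<or> W = carrier_vec n'" by (intro irrep_dim(2)[OF irr(2) \<sigma>' sub])
  moreover have "W \<noteq> {0\<^sub>v n'}"
  proof
    assume W: "W = {0\<^sub>v n'}"
    have "T = 0\<^sub>m n' n"
    proof (rule mat_eqI_vec[OF T])
      fix v :: "complex vec" assume v: "v \<in> carrier_vec n"
      then have "T *\<^sub>v v \<in> W" using T by (auto simp: W_def mat_range_def)
      then show "T *\<^sub>v v = 0\<^sub>m n' n *\<^sub>v v" using W v by auto
    qed auto
    then show False using nz by simp
  qed
  ultimately show "mat_range T = carrier_vec n'" by (simp add: W_def)
qed

lemma schur_inequivalent:
  assumes irr: "irreducible_rep G \<sigma>" "irreducible_rep G \<sigma>'"
    and \<sigma>: "\<sigma> \<in> hom G (GL n)" and \<sigma>': "\<sigma>' \<in> hom G (GL n')"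
    and T: "T \<in> carrier_mat n' n"
    and eq: "\<And>g. g \<in> carrier G \<Longrightarrow> T * \<sigma> g = \<sigma>' g * T"
    and ne: "\<not> rep_equiv G \<sigma> \<sigma>'"
  shows "T = 0\<^sub>m n' n"
proof (rule ccontr)
  assume "T \<noteq> 0\<^sub>m n' n"
  note s = schur[OF irr \<sigma> \<sigma>' T eq this]
  note i = inj_surj_mat[OF T s]
  from i obtain S where "S \<in> carrier_mat n n" "T * S = 1\<^sub>m n" "S * T = 1\<^sub>m n" by auto
  then have "rep_equiv G \<sigma> \<sigma>'"
    using \<sigma> \<sigma>' T eq i(1) by (intro rep_equivI[of _ n _ T S]) auto
  then show False using ne by simp
qed

text \<open>The characteristic polynomial has a complex root; subtracting that eigenvalue leaves an
  intertwiner with a nontrivial kernel, which \<open>schur\<close> forces to be 0.\<close>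

lemma schur_scalar:
  assumes irr: "irreducible_rep G \<sigma>" and \<sigma>: "\<sigma> \<in> hom G (GL n)" and T: "T \<in> carrier_mat n n"
    and eq: "\<And>g. g \<in> carrier G \<Longrightarrow> T * \<sigma> g = \<sigma> g * T"
  obtains c where "T = c \<cdot>\<^sub>m 1\<^sub>m n"
proof -
  have n: "n > 0" using irrep_dim(1)[OF irr \<sigma>] .
  have "Polynomial.degree (char_poly T) = n" using degree_monic_char_poly[OF T] by simp
  then have "\<not> Fundamental_Theorem_Algebra.constant (poly (char_poly T))" using n by (simp add: constant_degree)
  then obtain c where "poly (char_poly T) c = 0" using fundamental_theorem_of_algebra by blast
  then have "eigenvalue T c" using eigenvalue_root_char_poly[OF T] by simp
  then obtain v where v: "v \<in> carrier_vec n" "v \<noteq> 0\<^sub>v n" "T *\<^sub>v v = c \<cdot>\<^sub>v v"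
    using T unfolding eigenvalue_def eigenvector_def by auto
  define U where "U = T - c \<cdot>\<^sub>m 1\<^sub>m n"
  have U: "U \<in> carrier_mat n n" unfolding U_def by (intro minus_carrier_mat) auto
  have "U = 0\<^sub>m n n"
  proof (rule ccontr)
    assume nz: "U \<noteq> 0\<^sub>m n n"
    have "U * \<sigma> g = \<sigma> g * U" if g: "g \<in> carrier G" for g
    proof -
      have r: "\<sigma> g \<in> carrier_mat n n" using repD(1)[OF \<sigma> g] .
      show ?thesis unfolding U_def
        using T r eq[OF g]
        by (simp add: minus_mult_distrib_mat[OF T _ r] mult_minus_distrib_mat[OF r T]
            mult_smult_assoc_mat[OF one_carrier_mat r] mult_smult_distrib[OF r one_carrier_mat])
    qed
    from schur(1)[OF irr irr \<sigma> \<sigma> U this nz] have "inj_mat U" .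
    moreover have "U *\<^sub>v v = 0\<^sub>v n"
    proof -
      have "U *\<^sub>v v = T *\<^sub>v v - (c \<cdot>\<^sub>m 1\<^sub>m n) *\<^sub>v v"
        unfolding U_def using T v by (intro minus_mult_distrib_mat_vec) auto
      also have "(c \<cdot>\<^sub>m 1\<^sub>m n) *\<^sub>v v = c \<cdot>\<^sub>v v"
        using v(1) by (rule smult_one_mult_vec)
      also have "T *\<^sub>v v - c \<cdot>\<^sub>v v = 0\<^sub>v n" using v by auto
      finally show ?thesis .
    qed
    ultimately show False using v U unfolding inj_mat_def by auto
  qed
  moreover have "T = U + c \<cdot>\<^sub>m 1\<^sub>m n" using T unfolding U_def by (intro eq_matI) auto
  ultimately have "T = c \<cdot>\<^sub>m 1\<^sub>m n" using T by (metis left_add_zero_mat one_carrier_mat smult_carrier_mat)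
  then show ?thesis by (rule that)
qed

end

context finite_group
begin

subsection \<open>Orthogonality of characters\<close>

lemma sum_translate:
  assumes h: "h \<in> carrier G"
  shows "(\<Sum>g\<in>carrier G. F (h \<otimes> g)) = (\<Sum>g\<in>carrier G. F g)"
  using h by (intro sum.reindex_bij_witness[of _ "\<lambda>g. inv h \<otimes> g" "\<lambda>g. h \<otimes> g"])
    (auto simp: m_assoc[symmetric])

lemma msum_translate:
  assumes h: "h \<in> carrier G"
  shows "msum n m (\<lambda>g. f (h \<otimes> g)) (carrier G) = msum n m f (carrier G)"
  using sum_translate[OF h, of "\<lambda>g. f g $$ _"] by (simp add: msum_def)

text \<open>Translating the summation variable by \<open>h\<close> brings \<open>\<sigma>' h\<close>
  out on the left and leaves \<open>\<sigma> (inv h)\<close> on the right, where it cancels against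
  \<open>\<sigma> h\<close>.\<close>

lemma average_intertwines:
  assumes \<sigma>: "\<sigma> \<in> hom G (GL n)" and \<sigma>': "\<sigma>' \<in> hom G (GL n')" and M: "M \<in> carrier_mat n' n"
    and h: "h \<in> carrier G"
  defines "T \<equiv> msum n' n (\<lambda>g. \<sigma>' g * M * \<sigma> (inv g)) (carrier G)"
  shows "T * \<sigma> h = \<sigma>' h * T"
proof -
  note rh = repD(1)[OF \<sigma> h] repD(1)[OF \<sigma>' h] repD(5)[OF \<sigma> h]
  have c: "\<sigma>' g * M * \<sigma> (inv g) \<in> carrier_mat n' n" if "g \<in> carrier G" for g
    using that repD(1)[OF \<sigma>, of "inv g"] repD(1)[OF \<sigma>', of g] M by auto
  have "T * \<sigma> h = msum n' n (\<lambda>g. \<sigma>' g * M * \<sigma> (inv g)) (carrier G) * \<sigma> h" by (simp add: T_def)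
  also have "\<dots> = msum n' n (\<lambda>g. \<sigma>' g * M * \<sigma> (inv g) * \<sigma> h) (carrier G)"
    using rh(1) c by (rule msum_mult)
  also have "\<dots> = msum n' n (\<lambda>g. \<sigma>' (h \<otimes> g) * M * \<sigma> (inv (h \<otimes> g)) * \<sigma> h) (carrier G)"
    by (rule msum_translate[OF h, symmetric])
  also have "\<dots> = msum n' n (\<lambda>g. \<sigma>' h * (\<sigma>' g * M * \<sigma> (inv g))) (carrier G)"
  proof (rule msum_cong)
    fix g assume g: "g \<in> carrier G"
    note r = repD(1)[OF \<sigma>', of g] repD(1)[OF \<sigma>, of "inv g"] repD(1)[OF \<sigma>, of "inv h"]
    have "\<sigma>' (h \<otimes> g) * M * \<sigma> (inv (h \<otimes> g)) * \<sigma> h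
        = \<sigma>' h * \<sigma>' g * M * (\<sigma> (inv g) * \<sigma> (inv h)) * \<sigma> h"
      using g h by (simp add: inv_mult_group repD(2)[OF \<sigma>] repD(2)[OF \<sigma>'])
    also have "\<dots> = \<sigma>' h * (\<sigma>' g * M * (\<sigma> (inv g) * (\<sigma> (inv h) * \<sigma> h)))"
      using g h r rh(1,2) M by (simp add: assoc_mult_mat_dim)
    finally show "\<sigma>' (h \<otimes> g) * M * \<sigma> (inv (h \<otimes> g)) * \<sigma> h = \<sigma>' h * (\<sigma>' g * M * \<sigma> (inv g))"
      using g h r rh M by simp
  qed
  also have "\<dots> = \<sigma>' h * T"
    unfolding T_def using rh(2) c by (rule mult_msum[symmetric])
  finally show ?thesis .
qed

text \<open>Evaluation at the inverse replaces complex conjugation. For unitary representations both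
  agree on characters, and this form needs no invariant inner product.\<close>

definition cip :: "('g \<Rightarrow> complex) \<Rightarrow> ('g \<Rightarrow> complex) \<Rightarrow> complex" where
  "cip f h = (\<Sum>g\<in>carrier G. f g * h (inv g)) / of_nat (card (carrier G))"

abbreviation chr :: "('g \<Rightarrow> complex mat) \<Rightarrow> 'g \<Rightarrow> complex" where
  "chr \<pi> g \<equiv> mtrace (\<pi> g)"

lemma card_pos: "card (carrier G) > 0"
  using fin by (auto simp: card_gt_0_iff)

lemma mult_unit_mat_mult:
  assumes A: "A \<in> carrier_mat n' n'" and B: "B \<in> carrier_mat n n"
    and ij: "i < n'" "j < n" and ab: "a < n'" "b < n"
  shows "(A * Matrix.mat n' n (\<lambda>p. if p = (i, j) then 1 else 0) * B) $$ (a, b)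
      = A $$ (a, i) * (B $$ (j, b) :: complex)"
proof -
  define E :: "complex mat" where "E = Matrix.mat n' n (\<lambda>p. if p = (i, j) then 1 else 0)"
  have E: "E \<in> carrier_mat n' n" by (simp add: E_def)
  have AE: "(A * E) $$ (a, l) = (if l = j then A $$ (a, i) else 0)" if "l < n" for l
  proof -
    have "(A * E) $$ (a, l) = (\<Sum>p<n'. A $$ (a, p) * (if p = i \<and> l = j then 1 else 0))"
      using that mult_mat_entry[OF A E ab(1) that] by (simp add: E_def)
    also have "\<dots> = (if l = j then A $$ (a, i) else 0)"
      using ij by (auto simp: if_distrib[of "\<lambda>x. _ * x"] cong: if_cong)
    finally show ?thesis .
  qed
  have "(A * E * B) $$ (a, b) = (\<Sum>l<n. (if l = j then A $$ (a, i) else 0) * B $$ (l, b))"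
    using mult_mat_entry[OF mult_carrier_mat[OF A E] B ab] by (simp add: AE del: index_mult_mat)
  also have "\<dots> = A $$ (a, i) * B $$ (j, b)"
    using ij by (simp add: if_distrib[of "\<lambda>x. x * _"] cong: if_cong)
  finally show ?thesis by (simp add: E_def)
qed

text \<open>The averaged matrix unit at \<open>(i, j)\<close> has as its own \<open>(i, j)\<close>
  entry the sum of products of the diagonal entries i and j. Adding over all positions reassembles
  the characters, so Schur's lemma applies to the product.\<close>

lemma sum_chr_unit_mat:
  assumes \<sigma>: "\<sigma> \<in> hom G (GL n)" and \<sigma>': "\<sigma>' \<in> hom G (GL n')"
  shows "(\<Sum>g\<in>carrier G. chr \<sigma>' g * chr \<sigma> (inv g)) =
    (\<Sum>i<n'. \<Sum>j<n. msum n' n (\<lambda>g. \<sigma>' g * Matrix.mat n' n (\<lambda>p. if p = (i, j) then 1 else 0) * \<sigma> (inv g))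
       (carrier G) $$ (i, j))"
proof -
  have "(\<Sum>g\<in>carrier G. chr \<sigma>' g * chr \<sigma> (inv g)) =
      (\<Sum>g\<in>carrier G. \<Sum>i<n'. \<Sum>j<n. \<sigma>' g $$ (i, i) * \<sigma> (inv g) $$ (j, j))"
  proof (intro sum.cong refl)
    fix g assume "g \<in> carrier G"
    then have "dim_row (\<sigma>' g) = n'" "dim_row (\<sigma> (inv g)) = n"
      using repD(1)[OF \<sigma>, of "inv g"] repD(1)[OF \<sigma>', of g] by auto
    then show "chr \<sigma>' g * chr \<sigma> (inv g) = (\<Sum>i<n'. \<Sum>j<n. \<sigma>' g $$ (i, i) * \<sigma> (inv g) $$ (j, j))"
      by (simp add: mtrace_def sum_product)
  qed
  also have "\<dots> = (\<Sum>i<n'. \<Sum>j<n. \<Sum>g\<in>carrier G. \<sigma>' g $$ (i, i) * \<sigma> (inv g) $$ (j, j))"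
    by (subst sum.swap) (intro sum.cong refl sum.swap)
  also have "\<dots> = (\<Sum>i<n'. \<Sum>j<n. msum n' n (\<lambda>g. \<sigma>' g * Matrix.mat n' n (\<lambda>p. if p = (i, j) then 1 else 0) * \<sigma> (inv g))
       (carrier G) $$ (i, j))"
  proof (intro sum.cong refl)
    fix i j assume ij: "i \<in> {..<n'}" "j \<in> {..<n}"
    show "(\<Sum>g\<in>carrier G. \<sigma>' g $$ (i, i) * \<sigma> (inv g) $$ (j, j)) =
      msum n' n (\<lambda>g. \<sigma>' g * Matrix.mat n' n (\<lambda>p. if p = (i, j) then 1 else 0) * \<sigma> (inv g)) (carrier G) $$ (i, j)"
      using ij repD(1)[OF \<sigma>] repD(1)[OF \<sigma>']
      by (simp add: msum_entry mult_unit_mat_mult del: index_mult_mat)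
  qed
  finally show ?thesis .
qed

lemma irrepD: "irreducible_rep G \<sigma> \<Longrightarrow> \<exists>n. \<sigma> \<in> hom G (GL n)"
  unfolding irreducible_rep_def by blast

lemma chr_orthogonal_inequivalent:
  assumes irr: "irreducible_rep G \<sigma>" "irreducible_rep G \<sigma>'" and ne: "\<not> rep_equiv G \<sigma> \<sigma>'"
  shows "cip (chr \<sigma>') (chr \<sigma>) = 0"
proof -
  obtain n n' where \<sigma>: "\<sigma> \<in> hom G (GL n)" and \<sigma>': "\<sigma>' \<in> hom G (GL n')"
    using irr irrepD by blast
  have "msum n' n (\<lambda>g. \<sigma>' g * Matrix.mat n' n (\<lambda>p. if p = (i, j) then 1 else 0) * \<sigma> (inv g)) (carrier G)
      = 0\<^sub>m n' n" for i j
    using average_intertwines[OF \<sigma> \<sigma>'] by (intro schur_inequivalent[OF irr \<sigma> \<sigma>' _ _ ne]) auto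
  then show ?thesis
    by (simp add: cip_def sum_chr_unit_mat[OF \<sigma> \<sigma>'])
qed

text \<open>Each averaged matrix unit is a scalar matrix. Its trace is the group order times the
  trace of the unit, so the scalar is the group order over \<open>n\<close> on the diagonal and 0
  off it; \<open>n\<close> diagonal positions add up to the group order.\<close>

lemma chr_orthonormal:
  assumes irr: "irreducible_rep G \<sigma>"
  shows "cip (chr \<sigma>) (chr \<sigma>) = 1"
proof -
  obtain n where \<sigma>: "\<sigma> \<in> hom G (GL n)" using irr irrepD by blast
  have n: "n > 0" using irrep_dim(1)[OF irr \<sigma>] .
  let ?N = "of_nat (card (carrier G)) :: complex"
  let ?E = "\<lambda>i j. Matrix.mat n n (\<lambda>p. if p = (i, j) then 1 else 0 :: complex)"
  have T: "msum n n (\<lambda>g. \<sigma> g * ?E i j * \<sigma> (inv g)) (carrier G) $$ (i, j) = (if i = j then ?N / of_nat n else 0)"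
    if ij: "i < n" "j < n" for i j
  proof -
    let ?T = "msum n n (\<lambda>g. \<sigma> g * ?E i j * \<sigma> (inv g)) (carrier G)"
    obtain c where c: "?T = c \<cdot>\<^sub>m 1\<^sub>m n"
      using average_intertwines[OF \<sigma> \<sigma>, of "?E i j"] by (auto intro: schur_scalar[OF irr \<sigma>, of ?T])
    have "mtrace ?T = (\<Sum>g\<in>carrier G. mtrace (\<sigma> g * ?E i j * \<sigma> (inv g)))"
      using repD(1)[OF \<sigma>] by (intro mtrace_msum) (auto intro!: mult_carrier_mat[of _ n n])
    also have "\<dots> = (\<Sum>g\<in>carrier G. mtrace (?E i j))"
    proof (intro sum.cong refl)
      fix g assume g: "g \<in> carrier G"
      note r = repD(1)[OF \<sigma> g] repD(1)[OF \<sigma> inv_closed[OF g]]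
      have "mtrace (\<sigma> g * ?E i j * \<sigma> (inv g)) = mtrace (\<sigma> (inv g) * (\<sigma> g * ?E i j))"
        using r by (intro mtrace_mult_commute) auto
      also have "\<sigma> (inv g) * (\<sigma> g * ?E i j) = ?E i j"
        using r repD(5)[OF \<sigma> g] by (simp flip: assoc_mult_mat_dim)
      finally show "mtrace (\<sigma> g * ?E i j * \<sigma> (inv g)) = mtrace (?E i j)" .
    qed
    also have "mtrace (?E i j) = (if i = j then 1 else 0)"
      using ij by (auto simp: mtrace_def if_distrib cong: if_cong)
    finally have "c * of_nat n = (if i = j then ?N else 0)"
      unfolding c by (simp add: mtrace_def mult.commute)
    then have "c = (if i = j then ?N / of_nat n else 0)"
      using n by (auto simp: field_simps)
    then show ?thesis unfolding c using ij by auto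
  qed
  have "(\<Sum>g\<in>carrier G. chr \<sigma> g * chr \<sigma> (inv g)) = (\<Sum>i<n. \<Sum>j<n. if i = j then ?N / of_nat n else 0)"
    unfolding sum_chr_unit_mat[OF \<sigma> \<sigma>] using T by (intro sum.cong refl) auto
  also have "\<dots> = ?N" using n by simp
  finally show ?thesis using card_pos by (simp add: cip_def)
qed

lemma cip_cong:
  "(\<And>g. g \<in> carrier G \<Longrightarrow> f g = f' g) \<Longrightarrow> (\<And>g. g \<in> carrier G \<Longrightarrow> h g = h' g) \<Longrightarrow> cip f h = cip f' h'"
  by (simp add: cip_def cong: sum.cong)

lemma chr_orthogonality:
  assumes irr: "irreducible_rep G \<sigma>" "irreducible_rep G \<sigma>'"
  shows "cip (chr \<sigma>') (chr \<sigma>) = (if rep_equiv G \<sigma> \<sigma>' then 1 else 0)"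
proof (cases "rep_equiv G \<sigma> \<sigma>'")
  case True
  then have "cip (chr \<sigma>') (chr \<sigma>) = cip (chr \<sigma>) (chr \<sigma>)"
    using rep_equiv_mtrace[OF True] by (intro cip_cong) auto
  with True chr_orthonormal[OF irr(1)] show ?thesis by simp
qed (use chr_orthogonal_inequivalent[OF irr] in simp)

end

subsection \<open>Complete reducibility\<close>

text \<open>Extension to a basis of \<open>W\<close>, with bases encoded as injective matrices: as
  long as the range is too small, a vector of \<open>W\<close> outside it is appended as a new
  column. The number of columns is bounded by \<open>inj_mat_dim_le\<close>.\<close>

lemma extend_inj_mat:
  fixes P :: "complex mat"
  assumes "P \<in> carrier_mat n r" "inj_mat P" "mat_range P \<subseteq> W"
    and W: "vec_subspace W n"
  shows "\<exists>r' P'. r \<le> r' \<and> P' \<in> carrier_mat n r' \<and> inj_mat P' \<and> mat_range P' = W \<and>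
           (\<forall>i<n. \<forall>j<r. P' $$ (i, j) = P $$ (i, j))"
  using assms(1-3)
proof (induction "n - r" arbitrary: r P rule: less_induct)
  case less
  note W' = subspace_vecD[OF W]
  show ?case
  proof (cases "mat_range P = W")
    case True
    with less.prems show ?thesis by blast
  next
    case False
    then obtain w where w: "w \<in> W" "w \<notin> mat_range P" using less.prems by blast
    have wn: "w \<in> carrier_vec n" using w W' by auto
    define Q where "Q = Matrix.mat n (Suc r) (\<lambda>(i, j). if j < r then P $$ (i, j) else w $ i)"
    have Q: "Q \<in> carrier_mat n (Suc r)" by (simp add: Q_def)
    note P = less.prems(1)
    have Qx: "Q *\<^sub>v x = P *\<^sub>v vec_first x r + x $ r \<cdot>\<^sub>v w" if x: "x \<in> carrier_vec (Suc r)" for x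
    proof (rule eq_vecI)
      fix i assume "i < dim_vec (P *\<^sub>v vec_first x r + x $ r \<cdot>\<^sub>v w)"
      then have i: "i < n" using P wn by auto
      have "(Q *\<^sub>v x) $ i = (\<Sum>l<r. P $$ (i, l) * x $ l) + w $ i * x $ r"
        using mult_mat_vec_entry[OF Q x i] i by (simp add: Q_def)
      also have "(\<Sum>l<r. P $$ (i, l) * x $ l) = (P *\<^sub>v vec_first x r) $ i"
        using mult_mat_vec_entry[OF P vec_first_carrier i, of x] by (simp add: vec_first_def)
      finally show "(Q *\<^sub>v x) $ i = (P *\<^sub>v vec_first x r + x $ r \<cdot>\<^sub>v w) $ i"
        using i P wn by (simp add: mult.commute del: index_mult_mat_vec)
    qed (use Q P wn in auto)
    have inj: "inj_mat Q"
      unfolding inj_mat_def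
    proof (intro ballI impI)
      fix x assume "x \<in> carrier_vec (dim_col Q)" "Q *\<^sub>v x = 0\<^sub>v (dim_row Q)"
      then have x: "x \<in> carrier_vec (Suc r)" and "Q *\<^sub>v x = 0\<^sub>v n" using Q by auto
      then have 0: "P *\<^sub>v vec_first x r + x $ r \<cdot>\<^sub>v w = 0\<^sub>v n" using Qx by simp
      have x0: "x $ r = 0"
      proof (rule ccontr)
        assume nz: "x $ r \<noteq> 0"
        have "w = P *\<^sub>v ((- 1 / x $ r) \<cdot>\<^sub>v vec_first x r)"
        proof (rule eq_vecI)
          fix i assume "i < dim_vec (P *\<^sub>v ((- 1 / x $ r) \<cdot>\<^sub>v vec_first x r))"
          then have i: "i < n" using P by auto
          have "(P *\<^sub>v vec_first x r) $ i + x $ r * w $ i = 0"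
            using arg_cong[OF 0, of "\<lambda>v. v $ i"] i wn P by (simp del: index_mult_mat_vec)
          then have "w $ i = (- 1 / x $ r) * (P *\<^sub>v vec_first x r) $ i"
            using nz by (simp add: field_simps add_eq_0_iff del: index_mult_mat_vec)
          also have "\<dots> = (P *\<^sub>v ((- 1 / x $ r) \<cdot>\<^sub>v vec_first x r)) $ i"
            unfolding mult_mat_vec[OF P vec_first_carrier] using i P by (simp del: index_mult_mat_vec)
          finally show "w $ i = (P *\<^sub>v ((- 1 / x $ r) \<cdot>\<^sub>v vec_first x r)) $ i" .
        qed (use P wn in auto)
        then have "w \<in> mat_range P" unfolding mat_range_def using P
          by (intro image_eqI[of _ _ "(- 1 / x $ r) \<cdot>\<^sub>v vec_first x r"]) auto
        with w show False by simp
      qed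
      have "(P *\<^sub>v vec_first x r) $ i = 0" if "i < n" for i
        using arg_cong[OF 0, of "\<lambda>v. v $ i"] that x0 wn P by (simp del: index_mult_mat_vec)
      then have "P *\<^sub>v vec_first x r = 0\<^sub>v n"
        using P by (intro eq_vecI) (auto simp del: index_mult_mat_vec)
      then have z: "vec_first x r = 0\<^sub>v r" using less.prems(2) P by (auto simp: inj_mat_def)
      have "x $ i = 0" if "i < Suc r" for i
      proof (cases "i < r")
        case True
        then show ?thesis using arg_cong[OF z, of "\<lambda>v. v $ i"] by (simp add: vec_first_def)
      next
        case False
        then have "i = r" using that by simp
        then show ?thesis using x0 by simp
      qed
      then show "x = 0\<^sub>v (dim_col Q)" using x Q by (intro eq_vecI) auto
    qed
    have range: "mat_range Q \<subseteq> W"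
    proof
      fix y assume "y \<in> mat_range Q"
      then obtain x where x: "x \<in> carrier_vec (Suc r)" "y = Q *\<^sub>v x" using Q by (auto simp: mat_range_def)
      have "P *\<^sub>v vec_first x r \<in> W" using less.prems(3) P by (auto simp: mat_range_def)
      then show "y \<in> W" unfolding x(2) Qx[OF x(1)] using W' w by auto
    qed
    have "Suc r \<le> n" using inj_mat_dim_le[OF Q inj] .
    then have lt: "n - Suc r < n - r" by simp
    from less.hyps[OF lt Q inj range]
    obtain r' P' where "Suc r \<le> r'" "P' \<in> carrier_mat n r'" "inj_mat P'" "mat_range P' = W"
      "\<forall>i<n. \<forall>j<Suc r. P' $$ (i, j) = Q $$ (i, j)"
      by blast
    then show ?thesis by (intro exI[of _ r'] exI[of _ P']) (auto simp: Q_def)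
  qed
qed

text \<open>The rearrangement that solves the averaged cocycle relation in
  \<open>block_triangular_splits\<close>, where \<open>N\<close> is the group order.\<close>

lemma smult_cancel_add:
  assumes "K \<in> carrier_mat r s" "B \<in> carrier_mat r s" "(N :: 'a::field) \<noteq> 0"
  shows "(- 1 / N) \<cdot>\<^sub>m K = B + (- 1 / N) \<cdot>\<^sub>m (K + N \<cdot>\<^sub>m B)"
  using assms by (intro eq_matI) (auto simp: field_simps)

lemma block_unipotent_mult:
  assumes "y \<in> carrier_mat r s" "z \<in> carrier_mat r s"
  shows "four_block_mat (1\<^sub>m r) y (0\<^sub>m s r) (1\<^sub>m s) * four_block_mat (1\<^sub>m r) z (0\<^sub>m s r) (1\<^sub>m s)
    = four_block_mat (1\<^sub>m r) (z + y) (0\<^sub>m s r) (1\<^sub>m s :: complex mat)"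
  using assms by (subst mult_four_block_mat[of _ r r _ s _ s _ _ r _ s]) auto

text \<open>Spelled exactly as \<open>diag_block_mat\<close> unfolds, so that direct sums over
  appended lists split into two blocks.\<close>

abbreviation block_diag :: "complex mat \<Rightarrow> complex mat \<Rightarrow> complex mat" where
  "block_diag A D \<equiv> four_block_mat A (0\<^sub>m (dim_row A) (dim_col D)) (0\<^sub>m (dim_row D) (dim_col A)) D"

lemma block_diag_mult:
  assumes "A \<in> carrier_mat r r" "A' \<in> carrier_mat r r" "D \<in> carrier_mat s s" "D' \<in> carrier_mat s s"
  shows "block_diag A D * block_diag A' D' = block_diag (A * A') (D * D')"
  using assms by (subst mult_four_block_mat[of _ r r _ s _ s _ _ r _ s]) auto

lemma block_diag_one: "block_diag (1\<^sub>m r) (1\<^sub>m s) = 1\<^sub>m (r + s)"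
  by (rule eq_matI) (auto simp: four_block_mat_def Let_def)

lemma block_diag_carrier:
  "A \<in> carrier_mat r r \<Longrightarrow> D \<in> carrier_mat s s \<Longrightarrow> block_diag A D \<in> carrier_mat (r + s) (r + s)"
  by auto

lemma sum_lessThan_add:
  fixes f :: "nat \<Rightarrow> 'a::comm_monoid_add"
  shows "(\<Sum>l<r + s. f l) = (\<Sum>l<r. f l) + (\<Sum>l<s. f (r + l))"
  by (induction s) (auto simp: ac_simps)

context finite_group
begin

lemma rep_block_diag:
  assumes \<alpha>: "\<alpha> \<in> hom G (GL r)" and \<delta>: "\<delta> \<in> hom G (GL s)"
  shows "(\<lambda>g. block_diag (\<alpha> g) (\<delta> g)) \<in> hom G (GL (r + s))"
proof (rule repI)
  fix g h assume gh: "g \<in> carrier G" "h \<in> carrier G"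
  show "block_diag (\<alpha> (g \<otimes> h)) (\<delta> (g \<otimes> h)) = block_diag (\<alpha> g) (\<delta> g) * block_diag (\<alpha> h) (\<delta> h)"
    using gh repD(1)[OF \<alpha>] repD(1)[OF \<delta>]
    by (subst block_diag_mult[of _ r _ _ s]) (auto simp: repD(2)[OF \<alpha>] repD(2)[OF \<delta>])
qed (use repD(1,3)[OF \<alpha>] repD(1,3)[OF \<delta>] block_diag_one in auto)

lemma rep_equiv_block_diag:
  assumes "rep_equiv G \<alpha> \<alpha>'" "rep_equiv G \<delta> \<delta>'"
  shows "rep_equiv G (\<lambda>g. block_diag (\<alpha> g) (\<delta> g)) (\<lambda>g. block_diag (\<alpha>' g) (\<delta>' g))"
  using assms
proof (elim rep_equivE)
  fix n P Q m P' Q'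
  assume *: "\<alpha> \<in> hom G (GL n)" "\<alpha>' \<in> hom G (GL n)" "P \<in> carrier_mat n n" "Q \<in> carrier_mat n n"
    "P * Q = 1\<^sub>m n" "Q * P = 1\<^sub>m n" "\<And>g. g \<in> carrier G \<Longrightarrow> P * \<alpha> g = \<alpha>' g * P"
    and **: "\<delta> \<in> hom G (GL m)" "\<delta>' \<in> hom G (GL m)" "P' \<in> carrier_mat m m" "Q' \<in> carrier_mat m m"
    "P' * Q' = 1\<^sub>m m" "Q' * P' = 1\<^sub>m m" "\<And>g. g \<in> carrier G \<Longrightarrow> P' * \<delta> g = \<delta>' g * P'"
  show ?thesis
  proof (rule rep_equivI[OF rep_block_diag[OF *(1) **(1)] rep_block_diag[OF *(2) **(2)]
        block_diag_carrier[OF *(3) **(3)] block_diag_carrier[OF *(4) **(4)]])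
    show "block_diag P P' * block_diag Q Q' = 1\<^sub>m (n + m)"
      by (simp only: block_diag_mult[OF *(3,4) **(3,4)] *(5) **(5) block_diag_one)
    show "block_diag Q Q' * block_diag P P' = 1\<^sub>m (n + m)"
      by (simp only: block_diag_mult[OF *(4,3) **(4,3)] *(6) **(6) block_diag_one)
    fix g assume g: "g \<in> carrier G"
    show "block_diag P P' * block_diag (\<alpha> g) (\<delta> g) = block_diag (\<alpha>' g) (\<delta>' g) * block_diag P P'"
      by (simp only: block_diag_mult[OF *(3) repD(1)[OF *(1) g] **(3) repD(1)[OF **(1) g]]
          block_diag_mult[OF repD(1)[OF *(2) g] *(3) repD(1)[OF **(2) g] **(3)] *(7)[OF g] **(7)[OF g])
  qed
qed

text \<open>The first \<open>r\<close> columns of \<open>P\<close> are a basis of \<open>W\<close>.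
  Invariance keeps their images in \<open>W\<close>, so in the new coordinates these have zeros from
  row \<open>r\<close> on.\<close>

lemma adapted_basis:
  assumes \<pi>: "\<pi> \<in> hom G (GL n)"
    and W: "vec_subspace W n"
    and inv: "\<And>g v. g \<in> carrier G \<Longrightarrow> v \<in> W \<Longrightarrow> \<pi> g *\<^sub>v v \<in> W"
    and ne: "W \<noteq> {0\<^sub>v n}" "W \<noteq> carrier_vec n"
  obtains r P Q where "0 < r" "r < n" "P \<in> carrier_mat n n" "Q \<in> carrier_mat n n" "P * Q = 1\<^sub>m n" "Q * P = 1\<^sub>m n"
    "\<And>g i j. g \<in> carrier G \<Longrightarrow> r \<le> i \<Longrightarrow> i < n \<Longrightarrow> j < r \<Longrightarrow> (Q * \<pi> g * P) $$ (i, j) = 0"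
proof -
  note W' = subspace_vecD[OF W]
  have "\<exists>r' P'. 0 \<le> r' \<and> P' \<in> carrier_mat n r' \<and> inj_mat P' \<and> mat_range P' = W \<and>
           (\<forall>i<n. \<forall>j<0. P' $$ (i, j) = (0\<^sub>m n 0 :: complex mat) $$ (i, j))"
  proof (rule extend_inj_mat[OF _ _ _ W])
    show "inj_mat (0\<^sub>m n 0 :: complex mat)" by (auto simp: inj_mat_def)
    have "(0\<^sub>m n 0 :: complex mat) *\<^sub>v v = 0\<^sub>v n" if "v \<in> carrier_vec 0" for v
      using that by (intro eq_vecI) (auto simp: scalar_prod_def)
    then show "mat_range (0\<^sub>m n 0 :: complex mat) \<subseteq> W" using W' by (auto simp: mat_range_def)
  qed auto
  then obtain r P1 where P1: "P1 \<in> carrier_mat n r" "inj_mat P1" "mat_range P1 = W" by blast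
  have "vec_subspace (carrier_vec n) n"
    by (intro subspace_vecI) auto
  \<comment> \<open>The second extension starts from the basis of \<open>W\<close>, itself obtained
    from the matrix without columns, and runs up to the whole space; the old columns stay in
    front.\<close>
  from extend_inj_mat[OF P1(1,2) _ this] P1(3) W'(1) obtain m P where
    P: "r \<le> m" "P \<in> carrier_mat n m" "inj_mat P" "mat_range P = carrier_vec n"
      "\<forall>i<n. \<forall>j<r. P $$ (i, j) = P1 $$ (i, j)" by blast
  have m: "m = n" using inj_surj_mat(1)[OF P(2-4)] by simp
  from inj_surj_mat(2)[OF P(2-4)] obtain Q where Q: "Q \<in> carrier_mat n n" "P * Q = 1\<^sub>m n" "Q * P = 1\<^sub>m n"
    unfolding m by blast
  have P': "P \<in> carrier_mat n n" using P m by simp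
  have PP1: "P1 *\<^sub>v x = P *\<^sub>v vec n (\<lambda>i. if i < r then x $ i else 0)" if x: "x \<in> carrier_vec r" for x
  proof (rule eq_vecI)
    fix i assume "i < dim_vec (P *\<^sub>v vec n (\<lambda>i. if i < r then x $ i else 0))"
    then have i: "i < n" using P' by simp
    have "(P *\<^sub>v vec n (\<lambda>i. if i < r then x $ i else 0)) $ i = (\<Sum>l<n. P $$ (i, l) * (if l < r then x $ l else 0))"
      by (subst mult_mat_vec_entry[OF P' _ i]) auto
    also have "\<dots> = (\<Sum>l<r. P1 $$ (i, l) * x $ l)"
      using P(1,5) m i by (intro sum.mono_neutral_cong_right) auto
    finally show "(P1 *\<^sub>v x) $ i = (P *\<^sub>v vec n (\<lambda>i. if i < r then x $ i else 0)) $ i"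
      using mult_mat_vec_entry[OF P1(1) x i] by simp
  qed (use P' P1 in auto)
  have "r \<noteq> 0"
  proof
    assume "r = 0"
    then have "P1 *\<^sub>v v = 0\<^sub>v n" if "v \<in> carrier_vec r" for v
      using that P1(1) by (intro eq_vecI) (auto simp: mult_mat_vec_entry[OF P1(1) that] simp del: index_mult_mat_vec)
    then have "W \<subseteq> {0\<^sub>v n}" using P1 by (auto simp: mat_range_def)
    then show False using ne W' by auto
  qed
  have "r \<noteq> n"
  proof
    assume "r = n"
    then have "P1 = P" using P1(1) P' P(5) by (intro eq_matI) auto
    then show False using ne P1 P by simp
  qed
  have "(Q * \<pi> g * P) $$ (i, j) = 0" if g: "g \<in> carrier G" and ij: "r \<le> i" "i < n" "j < r" for g i j
  proof -
    have \<pi>g: "\<pi> g \<in> carrier_mat n n" using repD(1)[OF \<pi> g] .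
    have "P1 *\<^sub>v unit_vec r j \<in> W" using P1 by (auto simp: mat_range_def)
    then have "\<pi> g *\<^sub>v (P1 *\<^sub>v unit_vec r j) \<in> W" by (rule inv[OF g])
    then obtain x where x: "x \<in> carrier_vec r" "\<pi> g *\<^sub>v (P1 *\<^sub>v unit_vec r j) = P1 *\<^sub>v x"
      using P1 by (auto simp: mat_range_def)
    have u: "vec n (\<lambda>i. if i < r then unit_vec r j $ i else 0) = (unit_vec n j :: complex vec)"
      using ij by (intro eq_vecI) auto
    let ?x = "vec n (\<lambda>i. if i < r then x $ i else 0)"
    have "(Q * \<pi> g * P) *\<^sub>v unit_vec n j = Q *\<^sub>v (\<pi> g *\<^sub>v (P *\<^sub>v unit_vec n j))"
      using Q(1) \<pi>g P' by (simp add: assoc_mult_mat_vec[of _ n n _ n])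
    also have "\<dots> = Q *\<^sub>v (P *\<^sub>v ?x)"
      using x PP1[OF x(1)] PP1[of "unit_vec r j"] unfolding u by simp
    also have "\<dots> = ?x" using Q P' by (simp flip: assoc_mult_mat_vec[of Q n n P n])
    finally have "((Q * \<pi> g * P) *\<^sub>v unit_vec n j) $ i = 0" using ij by simp
    moreover have "Q * \<pi> g * P \<in> carrier_mat n n" using Q P' \<pi>g by auto
    ultimately show ?thesis using ij mult_unit_vec_entry[of "Q * \<pi> g * P" n n i j] by simp
  qed
  then show ?thesis using \<open>r \<noteq> 0\<close> \<open>r \<noteq> n\<close> P(1) m P' Q by (intro that[of r P Q]) auto
qed

text \<open>Maschke's theorem for matrices. The corner \<open>B\<close> is a cocycle by
  \<open>Bmult\<close>; averaging \<open>B h * D (inv h)\<close> exhibits it as a coboundary,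
  \<open>A g * y = B g + y * D g\<close>, and conjugation by the unipotent block matrix with corner
  \<open>y\<close> removes it.\<close>

lemma block_triangular_splits:
  assumes \<tau>: "\<tau> \<in> hom G (GL (r + s))"
    and zero: "\<And>g i j. g \<in> carrier G \<Longrightarrow> r \<le> i \<Longrightarrow> i < r + s \<Longrightarrow> j < r \<Longrightarrow> \<tau> g $$ (i, j) = 0"
  obtains \<alpha> \<delta> where "\<alpha> \<in> hom G (GL r)" "\<delta> \<in> hom G (GL s)" "rep_equiv G \<tau> (\<lambda>g. block_diag (\<alpha> g) (\<delta> g))"
proof -
  define A where "A g = Matrix.mat r r (\<lambda>(i, j). \<tau> g $$ (i, j))" for g
  define B where "B g = Matrix.mat r s (\<lambda>(i, j). \<tau> g $$ (i, r + j))" for g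
  define D where "D g = Matrix.mat s s (\<lambda>(i, j). \<tau> g $$ (r + i, r + j))" for g
  have carr: "A g \<in> carrier_mat r r" "B g \<in> carrier_mat r s" "D g \<in> carrier_mat s s" for g
    by (simp_all add: A_def B_def D_def)
  have entry: "\<tau> (g \<otimes> h) $$ (i, j) = (\<Sum>l<r. \<tau> g $$ (i, l) * \<tau> h $$ (l, j)) + (\<Sum>l<s. \<tau> g $$ (i, r + l) * \<tau> h $$ (r + l, j))"
    if "g \<in> carrier G" "h \<in> carrier G" "i < r + s" "j < r + s" for g h i j
    using mult_mat_entry[OF repD(1)[OF \<tau> that(1)] repD(1)[OF \<tau> that(2)] that(3,4)]
    by (simp add: repD(2)[OF \<tau> that(1,2)] sum_lessThan_add)
  have A: "A \<in> hom G (GL r)"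
  proof (rule repI)
    fix g h assume gh: "g \<in> carrier G" "h \<in> carrier G"
    show "A (g \<otimes> h) = A g * A h"
    proof (rule eq_matI)
      fix i j assume "i < dim_row (A g * A h)" "j < dim_col (A g * A h)"
      then have ij: "i < r" "j < r" by (auto simp: A_def)
      have "A (g \<otimes> h) $$ (i, j) = (\<Sum>l<r. \<tau> g $$ (i, l) * \<tau> h $$ (l, j))"
        using ij entry[OF gh, of i j] zero[OF gh(2)] by (simp add: A_def)
      then show "A (g \<otimes> h) $$ (i, j) = (A g * A h) $$ (i, j)"
        using mult_mat_entry[OF carr(1) carr(1) ij, of g h] ij by (simp add: A_def)
    qed (auto simp: A_def)
  qed (auto simp: A_def repD(3)[OF \<tau>])
  have D: "D \<in> hom G (GL s)"
  proof (rule repI)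
    fix g h assume gh: "g \<in> carrier G" "h \<in> carrier G"
    show "D (g \<otimes> h) = D g * D h"
    proof (rule eq_matI)
      fix i j assume "i < dim_row (D g * D h)" "j < dim_col (D g * D h)"
      then have ij: "i < s" "j < s" by (auto simp: D_def)
      have "D (g \<otimes> h) $$ (i, j) = (\<Sum>l<s. \<tau> g $$ (r + i, r + l) * \<tau> h $$ (r + l, r + j))"
        using ij entry[OF gh, of "r + i" "r + j"] zero[OF gh(1)] by (simp add: D_def)
      then show "D (g \<otimes> h) $$ (i, j) = (D g * D h) $$ (i, j)"
        using mult_mat_entry[OF carr(3) carr(3) ij, of g h] ij by (simp add: D_def)
    qed (auto simp: D_def)
  qed (auto simp: D_def repD(3)[OF \<tau>])
  have Bmult: "B (g \<otimes> h) = A g * B h + B g * D h" if gh: "g \<in> carrier G" "h \<in> carrier G" for g h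
  proof (rule eq_matI)
    fix i j assume "i < dim_row (A g * B h + B g * D h)" "j < dim_col (A g * B h + B g * D h)"
    then have ij: "i < r" "j < s" by (auto simp: A_def B_def D_def)
    have "(A g * B h + B g * D h) $$ (i, j) = (A g * B h) $$ (i, j) + (B g * D h) $$ (i, j)"
      using ij carr(2)[of g] carr(3)[of h] by (intro index_add_mat) auto
    also have "\<dots> = B (g \<otimes> h) $$ (i, j)"
      using ij entry[OF gh, of i "r + j"] mult_mat_entry[OF carr(1) carr(2) ij, of g h]
        mult_mat_entry[OF carr(2) carr(3) ij, of g h] by (simp add: A_def B_def D_def)
    finally show "B (g \<otimes> h) $$ (i, j) = (A g * B h + B g * D h) $$ (i, j)" ..
  qed (auto simp: A_def B_def D_def)
  let ?N = "of_nat (card (carrier G)) :: complex"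
  define M where "M = msum r s (\<lambda>h. B h * D (inv h)) (carrier G)"
  have M: "M \<in> carrier_mat r s" by (simp add: M_def)
  \<comment> \<open>In \<open>AM\<close> the corner \<open>B g\<close> is collected once per group
    element, which accounts for the division by the group order; the sign moves it to the side of
    \<open>y * D g\<close>.\<close>
  define y where "y = (- 1 / ?N) \<cdot>\<^sub>m M"
  have y: "y \<in> carrier_mat r s" using M by (simp add: y_def)
  have AM: "M * D g = A g * M + ?N \<cdot>\<^sub>m B g" if g: "g \<in> carrier G" for g
  proof -
    have "M * D g = msum r s (\<lambda>h. B (g \<otimes> h) * D (inv (g \<otimes> h))) (carrier G) * D g"
      unfolding M_def by (subst msum_translate[OF g, of _ _ "\<lambda>h. B h * D (inv h)"]) simp
    also have "\<dots> = msum r s (\<lambda>h. B (g \<otimes> h) * D (inv (g \<otimes> h)) * D g) (carrier G)"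
      using carr by (intro msum_mult) (auto intro!: mult_carrier_mat)
    also have "\<dots> = msum r s (\<lambda>h. A g * (B h * D (inv h)) + B g) (carrier G)"
    proof (rule msum_cong)
      fix h assume h: "h \<in> carrier G"
      have "D (inv (g \<otimes> h)) * D g = D (inv h)"
        using g h by (simp add: inv_mult_group m_assoc flip: repD(2)[OF D])
      then have "B (g \<otimes> h) * D (inv (g \<otimes> h)) * D g = (A g * B h + B g * D h) * D (inv h)"
        using assoc_mult_mat[OF add_carrier_mat[OF mult_carrier_mat[OF carr(2) carr(3)]] carr(3) carr(3)]
        by (simp add: Bmult[OF g h])
      also have "\<dots> = A g * B h * D (inv h) + B g * D h * D (inv h)"
        by (rule add_mult_distrib_mat[OF mult_carrier_mat[OF carr(1,2)] mult_carrier_mat[OF carr(2,3)] carr(3)])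
      also have "B g * D h * D (inv h) = B g"
        using assoc_mult_mat[OF carr(2) carr(3) carr(3)] right_mult_one_mat[OF carr(2)]
        by (simp add: repD(4)[OF D h])
      also have "A g * B h * D (inv h) = A g * (B h * D (inv h))"
        using carr by (intro assoc_mult_mat)
      finally show "B (g \<otimes> h) * D (inv (g \<otimes> h)) * D g = A g * (B h * D (inv h)) + B g" .
    qed
    also have "\<dots> = msum r s (\<lambda>h. A g * (B h * D (inv h))) (carrier G) + msum r s (\<lambda>h. B g) (carrier G)"
      using carr by (intro msum_add) (auto intro!: mult_carrier_mat)
    also have "msum r s (\<lambda>h. A g * (B h * D (inv h))) (carrier G) = A g * M"
      unfolding M_def using carr by (intro mult_msum[symmetric]) (auto intro!: mult_carrier_mat)
    also have "msum r s (\<lambda>h. B g) (carrier G) = ?N \<cdot>\<^sub>m B g" using carr by (intro msum_const)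
    finally show ?thesis .
  qed
  have Ay: "A g * y = B g + y * D g" if g: "g \<in> carrier G" for g
  proof -
    have AMc: "A g * M \<in> carrier_mat r s" using carr M by (intro mult_carrier_mat)
    have "y * D g = (- 1 / ?N) \<cdot>\<^sub>m (A g * M + ?N \<cdot>\<^sub>m B g)"
      unfolding y_def AM[OF g, symmetric] using carr(3) M by (intro mult_smult_assoc_mat)
    moreover have "A g * y = (- 1 / ?N) \<cdot>\<^sub>m (A g * M)"
      unfolding y_def using carr(1) M by (intro mult_smult_distrib)
    ultimately show ?thesis
      using smult_cancel_add[OF AMc carr(2), of ?N g] card_pos by simp
  qed
  let ?Y = "four_block_mat (1\<^sub>m r) y (0\<^sub>m s r) (1\<^sub>m s)"
  let ?Z = "four_block_mat (1\<^sub>m r) (- y) (0\<^sub>m s r) (1\<^sub>m s)"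
  have one: "four_block_mat (1\<^sub>m r) (0\<^sub>m r s) (0\<^sub>m s r) (1\<^sub>m s) = (1\<^sub>m (r + s) :: complex mat)"
    by (rule eq_matI) (auto simp: four_block_mat_def Let_def)
  have YZ: "?Y * ?Z = 1\<^sub>m (r + s)" "?Z * ?Y = 1\<^sub>m (r + s)"
    using y block_unipotent_mult[of y r s "- y"] block_unipotent_mult[of "- y" r s y] one
      uminus_l_inv_mat[OF y] add_uminus_minus_mat[OF y y] by auto
  have Y: "?Y \<in> carrier_mat (r + s) (r + s)" "?Z \<in> carrier_mat (r + s) (r + s)"
    using y by auto
  have \<tau>_block: "\<tau> g = four_block_mat (A g) (B g) (0\<^sub>m s r) (D g)" if g: "g \<in> carrier G" for g
    using repD(1)[OF \<tau> g] zero[OF g]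
    by (intro eq_matI) (auto simp: four_block_mat_def Let_def A_def B_def D_def)
  have "rep_equiv G \<tau> (\<lambda>g. block_diag (A g) (D g))"
  proof (rule rep_equivI[OF \<tau> rep_block_diag[OF A D] Y YZ])
    fix g assume g: "g \<in> carrier G"
    have "?Y * \<tau> g = four_block_mat (A g) (B g + y * D g) (0\<^sub>m s r) (D g)"
      unfolding \<tau>_block[OF g] using carr[of g] y
      by (subst mult_four_block_mat[of _ r r _ s _ s _ _ r _ s]) auto
    also have "\<dots> = four_block_mat (A g) (A g * y) (0\<^sub>m s r) (D g)" unfolding Ay[OF g] ..
    also have "\<dots> = block_diag (A g) (D g) * ?Y"
      using carr[of g] y by (subst mult_four_block_mat[of _ r r _ s _ s _ _ r _ s]) auto
    finally show "?Y * \<tau> g = block_diag (A g) (D g) * ?Y" .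
  qed
  with A D that show ?thesis by blast
qed

lemma direct_sum_append:
  "direct_sum_rep (rs @ ss) g = block_diag (direct_sum_rep rs g) (direct_sum_rep ss g)"
  by (simp add: direct_sum_rep_def diag_block_mat_append Let_def)

theorem complete_reducibility:
  "\<pi> \<in> hom G (GL n) \<Longrightarrow>
     \<exists>rs. (\<forall>r\<in>set rs. irreducible_rep G r) \<and> rep_equiv G \<pi> (direct_sum_rep rs)"
proof (induction n arbitrary: \<pi> rule: less_induct)
  case (less n)
  consider "n = 0" | "irreducible_rep G \<pi>" | "n > 0" "\<not> irreducible_rep G \<pi>" by blast
  then show ?case
  proof cases
    \<comment> \<open>In degree 0 nothing counts as irreducible; such a representation is the empty
      direct sum, whose matrices are 0 by 0.\<close>
    case 1
    have "\<pi> g = direct_sum_rep [] g" if "g \<in> carrier G" for g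
      using repD(1)[OF less.prems that] 1 by (intro eq_matI) (auto simp: direct_sum_rep_def)
    moreover have "direct_sum_rep [] \<in> hom G (GL n)"
      unfolding 1 by (rule repI) (auto simp: direct_sum_rep_def intro!: eq_matI)
    ultimately have "rep_equiv G \<pi> (direct_sum_rep [])"
    proof (intro rep_equivI[of _ n _ "1\<^sub>m n" "1\<^sub>m n"])
      fix g assume g: "g \<in> carrier G" and eq: "\<And>g. g \<in> carrier G \<Longrightarrow> \<pi> g = direct_sum_rep [] g"
      show "1\<^sub>m n * \<pi> g = direct_sum_rep [] g * 1\<^sub>m n"
        using repD(1)[OF less.prems g] by (simp flip: eq[OF g])
    qed (use less.prems in auto)
    then show ?thesis by (intro exI[of _ "[]"]) auto
  next
    case 2
    have "direct_sum_rep [\<pi>] = \<pi>" by (rule ext) (simp add: direct_sum_rep_def del: diag_block_mat.simps)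
    then show ?thesis using 2 rep_equiv_refl[OF less.prems] by (intro exI[of _ "[\<pi>]"]) auto
  next
    case 3
    have "\<exists>W. vec_subspace W n \<and>
      (\<forall>g\<in>carrier G. \<forall>v\<in>W. \<pi> g *\<^sub>v v \<in> W) \<and> \<not> (W = {0\<^sub>v n} \<or> W = carrier_vec n)"
    proof (rule ccontr)
      assume no: "\<not> ?thesis"
      have "irreducible_rep G \<pi>"
        unfolding irreducible_rep_def
      proof (intro exI conjI allI impI)
        fix W assume W: "vec_subspace W n"
          "\<forall>g\<in>carrier G. \<forall>v\<in>W. \<pi> g *\<^sub>v v \<in> W"
        show "W = {0\<^sub>v n} \<or> W = carrier_vec n"
        proof (rule ccontr)
          assume ne: "\<not> (W = {0\<^sub>v n} \<or> W = carrier_vec n)"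
          show False by (rule no[THEN notE], rule exI[of _ W], intro conjI W ne)
        qed
      qed (use 3(1) less.prems in auto)
      with 3(2) show False ..
    qed
    then obtain W where W: "vec_subspace W n"
      "\<forall>g\<in>carrier G. \<forall>v\<in>W. \<pi> g *\<^sub>v v \<in> W" "W \<noteq> {0\<^sub>v n}" "W \<noteq> carrier_vec n"
      by (elim exE conjE) simp
    obtain r P Q where r: "0 < r" "r < n" and P: "P \<in> carrier_mat n n" "Q \<in> carrier_mat n n"
      "P * Q = 1\<^sub>m n" "Q * P = 1\<^sub>m n"
      and z: "\<And>g i j. g \<in> carrier G \<Longrightarrow> r \<le> i \<Longrightarrow> i < n \<Longrightarrow> j < r \<Longrightarrow> (Q * \<pi> g * P) $$ (i, j) = 0"
      using adapted_basis[OF less.prems W(1) _ W(3,4)] W(2) by metis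
    define s where "s = n - r"
    have s: "n = r + s" "s < n" using r by (auto simp: s_def)
    have \<tau>: "(\<lambda>g. Q * \<pi> g * P) \<in> hom G (GL (r + s))"
      using rep_conj[OF less.prems P] s by simp
    have "\<And>g i j. g \<in> carrier G \<Longrightarrow> r \<le> i \<Longrightarrow> i < r + s \<Longrightarrow> j < r \<Longrightarrow> (Q * \<pi> g * P) $$ (i, j) = 0"
      using z s by simp
    from block_triangular_splits[OF \<tau> this]
    obtain \<alpha> \<delta> where \<alpha>: "\<alpha> \<in> hom G (GL r)" "\<delta> \<in> hom G (GL s)"
      and eq: "rep_equiv G (\<lambda>g. Q * \<pi> g * P) (\<lambda>g. block_diag (\<alpha> g) (\<delta> g))"
      by blast
    obtain rs where rs: "\<forall>r\<in>set rs. irreducible_rep G r" "rep_equiv G \<alpha> (direct_sum_rep rs)"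
      using less.IH[OF r(2) \<alpha>(1)] by blast
    obtain ss where ss: "\<forall>r\<in>set ss. irreducible_rep G r" "rep_equiv G \<delta> (direct_sum_rep ss)"
      using less.IH[OF s(2) \<alpha>(2)] by blast
    have "rep_equiv G \<pi> (\<lambda>g. block_diag (direct_sum_rep rs g) (direct_sum_rep ss g))"
      by (rule rep_equiv_trans[OF rep_equiv_conj[OF less.prems P]
            rep_equiv_trans[OF eq rep_equiv_block_diag[OF rs(2) ss(2)]]])
    then have "rep_equiv G \<pi> (direct_sum_rep (rs @ ss))"
      by (simp add: direct_sum_append[abs_def])
    then show ?thesis using rs ss by (intro exI[of _ "rs @ ss"]) auto
  qed
qed

end

section \<open>Adjoints, transposes and powers of matrices\<close>

lemma mat_adjoint_carrier: "A \<in> carrier_mat n m \<Longrightarrow> mat_adjoint A \<in> carrier_mat m n"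
  by (auto simp: mat_adjoint_def)

lemma mat_adjoint_entry:
  "A \<in> carrier_mat n m \<Longrightarrow> i < m \<Longrightarrow> j < n \<Longrightarrow> mat_adjoint A $$ (i, j) = conjugate (A $$ (j, i))"
  by (simp add: mat_adjoint_def mat_of_rows_def)

lemma pow_mat_Suc_left:
  "A \<in> carrier_mat n n \<Longrightarrow> A ^\<^sub>m Suc k = A * (A ^\<^sub>m k :: 'a::semiring_1 mat)"
proof (induction k)
  case (Suc k)
  have "A ^\<^sub>m Suc (Suc k) = A * A ^\<^sub>m k * A" using Suc by simp
  also have "\<dots> = A * (A ^\<^sub>m k * A)" using Suc.prems by (intro assoc_mult_mat[of _ n n _ n _ n]) auto
  finally show ?case by simp
qed simp

lemma pow_mat_transpose:
  "A \<in> carrier_mat n n \<Longrightarrow> transpose_mat A ^\<^sub>m k = transpose_mat (A ^\<^sub>m k :: 'a::comm_semiring_1 mat)"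
proof (induction k)
  case (Suc k)
  have "transpose_mat A ^\<^sub>m Suc k = transpose_mat (A ^\<^sub>m k) * transpose_mat A" using Suc by simp
  also have "\<dots> = transpose_mat (A * A ^\<^sub>m k)" using Suc.prems by (intro transpose_mult[symmetric]) auto
  finally show ?case using pow_mat_Suc_left[OF Suc.prems] by simp
qed simp

context finite_group
begin

subsection \<open>Multiplicities\<close>

lemma direct_sum_chr:
  assumes "\<forall>r\<in>set rs. irreducible_rep G r" and g: "g \<in> carrier G"
  shows "\<exists>n. direct_sum_rep rs g \<in> carrier_mat n n \<and> chr (direct_sum_rep rs) g = (\<Sum>r\<leftarrow>rs. chr r g)"
  using assms(1)
proof (induction rs)
  case Nil
  then show ?case by (intro exI[of _ 0]) (simp add: direct_sum_rep_def mtrace_def)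
next
  case (Cons r rs)
  then obtain n where n: "direct_sum_rep rs g \<in> carrier_mat n n"
    "chr (direct_sum_rep rs) g = (\<Sum>r\<leftarrow>rs. chr r g)" by auto
  obtain k where "r \<in> hom G (GL k)" using irrepD[of r] Cons.prems by auto
  then have k: "r g \<in> carrier_mat k k" using repD(1) g by blast
  have "direct_sum_rep (r # rs) g = block_diag (r g) (direct_sum_rep rs g)"
    by (simp add: direct_sum_rep_def Let_def)
  then show ?case
    using block_diag_carrier[OF k n(1)] mtrace_four_block[OF k n(1)] n(2)
    by (intro exI[of _ "k + n"]) simp
qed

lemma cip_add_left: "cip (\<lambda>g. f g + f' g) h = cip f h + cip f' h"
  by (simp add: cip_def distrib_right sum.distrib add_divide_distrib)

lemma cip_zero_left: "cip (\<lambda>g. 0) h = 0"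
  by (simp add: cip_def)

text \<open>By orthogonality each summand contributes 1 or 0. The right side depends on
  \<open>\<pi>\<close> alone, so the count is the same in every decomposition.\<close>

lemma count_summands:
  assumes irr: "irreducible_rep G \<sigma>" and rs: "\<forall>r\<in>set rs. irreducible_rep G r"
    and eq: "rep_equiv G \<pi> (direct_sum_rep rs)"
  shows "of_nat (length (filter (rep_equiv G \<sigma>) rs)) = cip (chr \<pi>) (chr \<sigma>)"
proof -
  have "cip (chr \<pi>) (chr \<sigma>) = cip (\<lambda>g. \<Sum>r\<leftarrow>rs. chr r g) (chr \<sigma>)"
    using direct_sum_chr[OF rs] rep_equiv_mtrace[OF eq] by (intro cip_cong) auto
  also have "\<dots> = of_nat (length (filter (rep_equiv G \<sigma>) rs))"
    using rs by (induction rs) (auto simp: cip_zero_left cip_add_left chr_orthogonality[OF irr])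
  finally show ?thesis ..
qed

text \<open>Shows that the definite description in \<open>multiplicity_rep\<close> denotes, and lets
  it be evaluated in whichever decomposition is at hand.\<close>

lemma multiplicity_rep_eq:
  assumes irr: "irreducible_rep G \<sigma>" and rs: "\<forall>r\<in>set rs. irreducible_rep G r"
    and eq: "rep_equiv G \<pi> (direct_sum_rep rs)"
  shows "multiplicity_rep G \<sigma> \<pi> = length (filter (rep_equiv G \<sigma>) rs)"
  unfolding multiplicity_rep_def
proof (rule the_equality)
  show "\<exists>rs'. (\<forall>r\<in>set rs'. irreducible_rep G r) \<and> rep_equiv G \<pi> (direct_sum_rep rs') \<and>
      length (filter (rep_equiv G \<sigma>) rs) = length (filter (rep_equiv G \<sigma>) rs')"
    using rs eq by blast
next
  fix k assume "\<exists>rs'. (\<forall>r\<in>set rs'. irreducible_rep G r) \<and> rep_equiv G \<pi> (direct_sum_rep rs') \<and>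
      k = length (filter (rep_equiv G \<sigma>) rs')"
  then obtain rs' where rs': "\<forall>r\<in>set rs'. irreducible_rep G r" "rep_equiv G \<pi> (direct_sum_rep rs')"
    and k: "k = length (filter (rep_equiv G \<sigma>) rs')" by blast
  have "(of_nat k :: complex) = of_nat (length (filter (rep_equiv G \<sigma>) rs))"
    unfolding k count_summands[OF irr rs eq] count_summands[OF irr rs'] ..
  then show "k = length (filter (rep_equiv G \<sigma>) rs)" by simp
qed

subsection \<open>The list of irreducible representations\<close>

text \<open>Every irreducible representation occurs in the regular one, so the summands of the latter
  contain a complete list.\<close>

definition regular_rep :: "'g list \<Rightarrow> 'g \<Rightarrow> complex mat" where
  "regular_rep es g = Matrix.mat (length es) (length es) (\<lambda>(i, j). if es ! i = g \<otimes> es ! j then 1 else 0)"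

lemma regular_rep_hom:
  assumes es: "set es = carrier G" "distinct es"
  shows "regular_rep es \<in> hom G (GL (length es))"
proof (rule repI)
  have nth: "es ! i \<in> carrier G" if "i < length es" for i
    using nth_mem[OF that] es(1) by simp
  show "regular_rep es \<one> = 1\<^sub>m (length es)"
    using nth es(2) by (intro eq_matI) (auto simp: regular_rep_def nth_eq_iff_index_eq)
  fix g h assume gh: "g \<in> carrier G" "h \<in> carrier G"
  show "regular_rep es (g \<otimes> h) = regular_rep es g * regular_rep es h"
  proof (rule eq_matI)
    fix i j assume "i < dim_row (regular_rep es g * regular_rep es h)"
      "j < dim_col (regular_rep es g * regular_rep es h)"
    then have ij: "i < length es" "j < length es" by (auto simp: regular_rep_def)
    have "h \<otimes> es ! j \<in> set es" using es gh nth[OF ij(2)] by simp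
    then obtain k where k: "k < length es" "es ! k = h \<otimes> es ! j" by (auto simp: in_set_conv_nth)
    have u: "es ! l = h \<otimes> es ! j \<longleftrightarrow> l = k" if "l < length es" for l
      using k es(2) that by (auto simp: nth_eq_iff_index_eq simp flip: k(2))
    have "(regular_rep es g * regular_rep es h) $$ (i, j) =
        (\<Sum>l<length es. regular_rep es g $$ (i, l) * regular_rep es h $$ (l, j))"
      using ij by (intro mult_mat_entry) (auto simp: regular_rep_def)
    also have "\<dots> = (\<Sum>l<length es. if l = k then regular_rep es g $$ (i, l) else 0)"
      using ij u by (intro sum.cong) (auto simp: regular_rep_def)
    also have "\<dots> = regular_rep es (g \<otimes> h) $$ (i, j)"
      using ij k gh nth by (simp add: regular_rep_def m_assoc)
    finally show "regular_rep es (g \<otimes> h) $$ (i, j) = (regular_rep es g * regular_rep es h) $$ (i, j)" ..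
  qed (auto simp: regular_rep_def)
qed (auto simp: regular_rep_def)

lemma regular_rep_chr:
  assumes es: "set es = carrier G" "distinct es" and g: "g \<in> carrier G"
  shows "chr (regular_rep es) g = (if g = \<one> then of_nat (card (carrier G)) else 0)"
proof -
  have "es ! i = g \<otimes> es ! i \<longleftrightarrow> g = \<one>" if "i < length es" for i
    using g es(1) nth_mem[OF that] by (metis r_cancel_one')
  then show ?thesis
    using distinct_card[OF es(2)] es(1) by (auto simp: mtrace_def regular_rep_def)
qed

lemma irreps_in_regular:
  obtains rs where "\<forall>r\<in>set rs. irreducible_rep G r"
    "\<And>\<sigma>. irreducible_rep G \<sigma> \<Longrightarrow> \<exists>r\<in>set rs. rep_equiv G \<sigma> r"
proof -
  obtain es where es: "set es = carrier G" "distinct es" using finite_distinct_list[OF fin] by blast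
  obtain rs where rs: "\<forall>r\<in>set rs. irreducible_rep G r" "rep_equiv G (regular_rep es) (direct_sum_rep rs)"
    using complete_reducibility[OF regular_rep_hom[OF es]] by blast
  have "\<exists>r\<in>set rs. rep_equiv G \<sigma> r" if irr: "irreducible_rep G \<sigma>" for \<sigma>
  proof -
    obtain n where n: "\<sigma> \<in> hom G (GL n)" using irrepD[OF irr] by blast
    \<comment> \<open>Only the unit survives, so the multiplicity of \<open>\<sigma>\<close> in the
      regular representation is its degree, which is positive.\<close>
    have "cip (chr (regular_rep es)) (chr \<sigma>) =
        (\<Sum>g\<in>carrier G. if g = \<one> then of_nat (card (carrier G)) * chr \<sigma> (inv g) else 0) / of_nat (card (carrier G))"
      unfolding cip_def using regular_rep_chr[OF es] by (intro arg_cong2[of _ _ _ _ "(/)"] sum.cong) auto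
    also have "\<dots> = of_nat n"
      using card_pos fin repD(3)[OF n] one_closed by (simp add: mtrace_one) blast
    finally have "length (filter (rep_equiv G \<sigma>) rs) = n"
      using count_summands[OF irr rs] by (metis of_nat_eq_iff)
    then have "filter (rep_equiv G \<sigma>) rs \<noteq> []" using irrep_dim(1)[OF irr n] by auto
    then show ?thesis by (auto simp: filter_empty_conv)
  qed
  with rs(1) that show ?thesis by blast
qed

lemma trivial_rep_hom: "trivial_rep \<in> hom G (GL 1)"
  by (rule repI) (auto simp: trivial_rep_def)

lemma trivial_rep_irreducible: "irreducible_rep G trivial_rep"
  unfolding irreducible_rep_def
proof (intro exI[of _ 1] conjI allI impI)
  fix W assume "vec_subspace W 1"
  note W = subspace_vecD[OF this]
  show "W = {0\<^sub>v 1} \<or> W = carrier_vec 1"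
  proof (cases "\<exists>w\<in>W. w $ 0 \<noteq> 0")
    case True
    then obtain w where w: "w \<in> W" "w $ 0 \<noteq> 0" by blast
    have "v \<in> W" if v: "v \<in> carrier_vec 1" for v
    proof -
      have "v = (v $ 0 / w $ 0) \<cdot>\<^sub>v w"
        using v w W(1) by (intro eq_vecI) auto
      then show ?thesis using W(4)[OF w(1)] by metis
    qed
    then show ?thesis using W(1) by blast
  next
    case False
    have "w = 0\<^sub>v 1" if "w \<in> W" for w
      using that False W(1) by (intro eq_vecI) auto
    then show ?thesis using W(2) by blast
  qed
qed (use trivial_rep_hom in auto)

text \<open>The head is always kept, so a list beginning with \<open>trivial_rep\<close> retains it
  at position 0, as \<open>irrep_list\<close> demands.\<close>

fun reduce_list :: "('g \<Rightarrow> complex mat) list \<Rightarrow> ('g \<Rightarrow> complex mat) list" where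
  "reduce_list [] = []"
| "reduce_list (r # rs) = r # filter (\<lambda>s. \<not> rep_equiv G r s) (reduce_list rs)"

text \<open>\<open>sorted_wrt\<close> compares each entry with all later ones; by symmetry of
  equivalence this is pairwise inequivalence.\<close>

lemma reduce_list:
  assumes "\<forall>r\<in>set rs. irreducible_rep G r"
  shows "set (reduce_list rs) \<subseteq> set rs"
    and "sorted_wrt (\<lambda>r s. \<not> rep_equiv G r s) (reduce_list rs)"
    and "\<forall>r\<in>set rs. \<exists>s\<in>set (reduce_list rs). rep_equiv G r s"
  using assms
proof (induction rs)
  case (Cons r rs)
  {
    case 1 then show ?case using Cons.IH(1) by auto
  next
    case 2 then show ?case using Cons.IH(2) by (auto intro: sorted_wrt_filter)
  next
    case 3
    have refl: "rep_equiv G r r" using 3 irrepD rep_equiv_refl by (metis list.set_intros(1))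
    show ?case
    proof
      fix t assume t: "t \<in> set (r # rs)"
      show "\<exists>s\<in>set (reduce_list (r # rs)). rep_equiv G t s"
      proof (cases "t = r")
        case False
        then obtain s where s: "s \<in> set (reduce_list rs)" "rep_equiv G t s"
          using t 3 Cons.IH(3) by auto
        then show ?thesis
          using rep_equiv_sym[of r s] rep_equiv_trans[OF s(2), of r] by (cases "rep_equiv G r s") auto
      qed (use refl in auto)
    qed
  }
qed auto

text \<open>Guarantees that the choice operator in \<open>mckay_vertices\<close> returns a genuine
  list of irreducible representations.\<close>

lemma irrep_list_exists: "\<exists>\<sigma>s. irrep_list G \<sigma>s"
proof -
  obtain rs where rs: "\<forall>r\<in>set rs. irreducible_rep G r"
    "\<And>\<sigma>. irreducible_rep G \<sigma> \<Longrightarrow> \<exists>r\<in>set rs. rep_equiv G \<sigma> r"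
    by (rule irreps_in_regular) blast
  define \<sigma>s where "\<sigma>s = reduce_list (trivial_rep # rs)"
  have irr: "\<forall>r\<in>set (trivial_rep # rs). irreducible_rep G r" using rs(1) trivial_rep_irreducible by simp
  note red = reduce_list[OF irr, folded \<sigma>s_def]
  have "irrep_list G \<sigma>s"
    unfolding irrep_list_def
  proof (intro conjI allI impI)
    show "\<forall>\<sigma>\<in>set \<sigma>s. irreducible_rep G \<sigma>" using red(1) irr by blast
    show "rep_equiv G trivial_rep (\<sigma>s ! 0)"
      using rep_equiv_refl[OF trivial_rep_hom] by (simp add: \<sigma>s_def)
    fix \<pi> assume "irreducible_rep G \<pi>"
    then obtain r where r: "r \<in> set rs" "rep_equiv G \<pi> r" using rs(2) by blast
    then obtain s where s: "s \<in> set \<sigma>s" "rep_equiv G r s" using red(3) by auto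
    then obtain i where i: "i < length \<sigma>s" "\<sigma>s ! i = s" by (auto simp: in_set_conv_nth)
    show "\<exists>!i. i < length \<sigma>s \<and> rep_equiv G \<pi> (\<sigma>s ! i)"
    proof (rule ex1I[of _ i])
      show "i < length \<sigma>s \<and> rep_equiv G \<pi> (\<sigma>s ! i)" using i rep_equiv_trans[OF r(2) s(2)] by simp
      fix j assume j: "j < length \<sigma>s \<and> rep_equiv G \<pi> (\<sigma>s ! j)"
      then have "rep_equiv G (\<sigma>s ! i) (\<sigma>s ! j)" "rep_equiv G (\<sigma>s ! j) (\<sigma>s ! i)"
        using i rep_equiv_trans[OF r(2) s(2)] rep_equiv_trans rep_equiv_sym by blast+
      then show "j = i" using red(2) i j sorted_wrt_nth_less by (metis linorder_neqE_nat)
    qed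
  qed
  then show ?thesis ..
qed

subsection \<open>Moments of the McKay matrix\<close>

lemma tensor_rep_hom:
  assumes \<rho>: "\<rho> \<in> hom G (GL d)" and \<sigma>: "\<sigma> \<in> hom G (GL n)"
  shows "tensor_rep \<rho> \<sigma> \<in> hom G (GL (d * n))"
proof (rule repI)
  fix g h assume "g \<in> carrier G" "h \<in> carrier G"
  then show "tensor_rep \<rho> \<sigma> (g \<otimes> h) = tensor_rep \<rho> \<sigma> g * tensor_rep \<rho> \<sigma> h"
    using kronecker_mult[OF repD(1)[OF \<rho>] repD(1)[OF \<rho>] repD(1)[OF \<sigma>] repD(1)[OF \<sigma>], of g h g h]
    by (simp add: tensor_rep_def repD(2)[OF \<rho>] repD(2)[OF \<sigma>])
qed (simp_all add: tensor_rep_def kronecker_one repD(3)[OF \<rho>] repD(3)[OF \<sigma>]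
      kronecker_carrier[OF repD(1)[OF \<rho>] repD(1)[OF \<sigma>]])

lemma chr_direct_sum_by_class:
  assumes list: "irrep_list G \<sigma>s" and rs: "\<forall>r\<in>set rs. irreducible_rep G r" and g: "g \<in> carrier G"
  shows "(\<Sum>r\<leftarrow>rs. chr r g) =
    (\<Sum>j<length \<sigma>s. of_nat (length (filter (rep_equiv G (\<sigma>s ! j)) rs)) * chr (\<sigma>s ! j) g)"
  using rs
proof (induction rs)
  case (Cons r rs)
  have "\<exists>!i. i < length \<sigma>s \<and> rep_equiv G r (\<sigma>s ! i)"
    using list Cons.prems by (simp add: irrep_list_def)
  then obtain i where i: "i < length \<sigma>s" "rep_equiv G r (\<sigma>s ! i)"
    and u: "\<And>j. j < length \<sigma>s \<Longrightarrow> rep_equiv G r (\<sigma>s ! j) \<Longrightarrow> j = i" by blast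
  have iff: "rep_equiv G (\<sigma>s ! j) r \<longleftrightarrow> j = i" if "j < length \<sigma>s" for j
    using i u[OF that] rep_equiv_sym by blast
  have "(\<Sum>j<length \<sigma>s. of_nat (length (filter (rep_equiv G (\<sigma>s ! j)) (r # rs))) * chr (\<sigma>s ! j) g) =
      (\<Sum>j<length \<sigma>s. (if j = i then chr (\<sigma>s ! j) g else 0)
        + of_nat (length (filter (rep_equiv G (\<sigma>s ! j)) rs)) * chr (\<sigma>s ! j) g)"
    by (intro sum.cong) (auto simp: iff algebra_simps)
  also have "\<dots> = chr r g + (\<Sum>r\<leftarrow>rs. chr r g)"
    using Cons i rep_equiv_mtrace[OF i(2) g] by (simp add: sum.distrib)
  finally show ?case by simp
qed simp

text \<open>At each \<open>g\<close> the irreducible characters form an eigenvector of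
  \<open>\<Delta>\<close> with eigenvalue \<open>chr \<rho> g\<close>. Hence row 0 of a power of
  \<open>\<Delta>\<close> lists the coefficients of that power of \<open>chr \<rho>\<close> in
  irreducible characters, and orthonormality identifies the scalar product of two such rows with
  \<open>cip\<close>.\<close>

theorem mckay_moments:
  assumes list: "irrep_list G \<sigma>s" and \<rho>: "\<rho> \<in> hom G (GL d)"
  defines "k \<equiv> length \<sigma>s"
  defines "\<Delta> \<equiv> Matrix.mat k k (\<lambda>(i, j). of_nat (multiplicity_rep G (\<sigma>s ! j) (tensor_rep \<rho> (\<sigma>s ! i))) :: complex)"
  shows "k > 0"
    and "((\<Delta> ^\<^sub>m m) * (mat_adjoint \<Delta> ^\<^sub>m n)) $$ (0, 0) = cip (\<lambda>g. chr \<rho> g ^ m) (\<lambda>g. chr \<rho> g ^ n)"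
proof -
  have irr: "irreducible_rep G (\<sigma>s ! i)" if "i < k" for i
    using list that by (auto simp: irrep_list_def k_def)
  have triv: "rep_equiv G trivial_rep (\<sigma>s ! 0)"
    and ex: "\<exists>i. i < length \<sigma>s \<and> rep_equiv G trivial_rep (\<sigma>s ! i)"
    using list trivial_rep_irreducible by (auto simp: irrep_list_def)
  show k: "k > 0" using ex by (auto simp: k_def)
  have \<Delta>: "\<Delta> \<in> carrier_mat k k" by (simp add: \<Delta>_def)
  have step: "chr \<rho> g * chr (\<sigma>s ! i) g = (\<Sum>j<k. \<Delta> $$ (i, j) * chr (\<sigma>s ! j) g)"
    if i: "i < k" and g: "g \<in> carrier G" for i g
  proof -
    obtain e where e: "\<sigma>s ! i \<in> hom G (GL e)" using irrepD[OF irr[OF i]] by blast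
    obtain rs where rs: "\<forall>r\<in>set rs. irreducible_rep G r"
      "rep_equiv G (tensor_rep \<rho> (\<sigma>s ! i)) (direct_sum_rep rs)"
      using complete_reducibility[OF tensor_rep_hom[OF \<rho> e]] by blast
    have "chr \<rho> g * chr (\<sigma>s ! i) g = chr (tensor_rep \<rho> (\<sigma>s ! i)) g"
      using mtrace_kronecker[OF repD(1)[OF \<rho> g] repD(1)[OF e g]] by (simp add: tensor_rep_def)
    also have "\<dots> = (\<Sum>r\<leftarrow>rs. chr r g)"
      using rep_equiv_mtrace[OF rs(2) g] direct_sum_chr[OF rs(1) g] by auto
    also have "\<dots> = (\<Sum>j<k. \<Delta> $$ (i, j) * chr (\<sigma>s ! j) g)"
      unfolding chr_direct_sum_by_class[OF list rs(1) g] k_def[symmetric]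
      using i by (intro sum.cong) (auto simp: \<Delta>_def multiplicity_rep_eq[OF irr rs])
    finally show ?thesis .
  qed
  have power: "chr \<rho> g ^ m * chr (\<sigma>s ! i) g = (\<Sum>j<k. (\<Delta> ^\<^sub>m m) $$ (i, j) * chr (\<sigma>s ! j) g)"
    if i: "i < k" and g: "g \<in> carrier G" for i g m
  proof (induction m)
    case 0
    have "(\<Sum>j<k. (1\<^sub>m k) $$ (i, j) * chr (\<sigma>s ! j) g) = (\<Sum>j<k. if j = i then chr (\<sigma>s ! j) g else 0)"
      using i by (intro sum.cong) auto
    then show ?case using i \<Delta> by simp
  next
    case (Suc m)
    have \<Delta>m: "\<Delta> ^\<^sub>m m \<in> carrier_mat k k" using \<Delta> by auto
    have "chr \<rho> g ^ Suc m * chr (\<sigma>s ! i) g = chr \<rho> g * (\<Sum>j<k. (\<Delta> ^\<^sub>m m) $$ (i, j) * chr (\<sigma>s ! j) g)"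
      using Suc by simp
    also have "\<dots> = (\<Sum>j<k. (\<Delta> ^\<^sub>m m) $$ (i, j) * (chr \<rho> g * chr (\<sigma>s ! j) g))"
      by (simp add: sum_distrib_left mult_ac)
    also have "\<dots> = (\<Sum>j<k. \<Sum>l<k. (\<Delta> ^\<^sub>m m) $$ (i, j) * \<Delta> $$ (j, l) * chr (\<sigma>s ! l) g)"
      using step g by (intro sum.cong) (auto simp: sum_distrib_left mult_ac)
    also have "\<dots> = (\<Sum>l<k. (\<Delta> ^\<^sub>m Suc m) $$ (i, l) * chr (\<sigma>s ! l) g)"
      using i by (subst sum.swap) (intro sum.cong refl,
          simp add: mult_mat_entry[OF \<Delta>m \<Delta>] sum_distrib_right del: index_mult_mat)
    finally show ?case .
  qed
  have chr0: "chr (\<sigma>s ! 0) g = 1" if "g \<in> carrier G" for g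
    using rep_equiv_mtrace[OF triv that] by (simp add: trivial_rep_def mtrace_one)
  have expand: "chr \<rho> g ^ m = (\<Sum>j<k. (\<Delta> ^\<^sub>m m) $$ (0, j) * chr (\<sigma>s ! j) g)" if "g \<in> carrier G" for g m
    using power[OF k that, of m] chr0[OF that] by simp
  have orth: "(\<Sum>g\<in>carrier G. chr (\<sigma>s ! i) g * chr (\<sigma>s ! j) (inv g)) / of_nat (card (carrier G))
      = (if i = j then 1 else 0)" if ij: "i < k" "j < k" for i j
  proof -
    have "rep_equiv G (\<sigma>s ! j) (\<sigma>s ! i) \<longleftrightarrow> i = j"
    proof
      assume "rep_equiv G (\<sigma>s ! j) (\<sigma>s ! i)"
      moreover have "rep_equiv G (\<sigma>s ! j) (\<sigma>s ! j)" using irr[OF ij(2)] irrepD rep_equiv_refl by blast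
      ultimately show "i = j" using list irr[OF ij(2)] ij unfolding irrep_list_def k_def by blast
    qed (use irr[OF ij(2)] irrepD rep_equiv_refl in blast)
    then show ?thesis using chr_orthogonality[OF irr[OF ij(2)] irr[OF ij(1)]] by (simp add: cip_def)
  qed
  \<comment> \<open>Multiplicities are natural numbers, so conjugation does nothing.\<close>
  have adj: "mat_adjoint \<Delta> = transpose_mat \<Delta>"
    using mat_adjoint_carrier[OF \<Delta>] \<Delta>
    by (intro eq_matI) (auto simp: mat_adjoint_entry[OF \<Delta>], auto simp: \<Delta>_def)
  let ?N = "of_nat (card (carrier G)) :: complex"
  have "cip (\<lambda>g. chr \<rho> g ^ m) (\<lambda>g. chr \<rho> g ^ n) =
     (\<Sum>g\<in>carrier G. \<Sum>i<k. \<Sum>j<k. (\<Delta> ^\<^sub>m m) $$ (0, i) * (\<Delta> ^\<^sub>m n) $$ (0, j) * (chr (\<sigma>s ! i) g * chr (\<sigma>s ! j) (inv g))) / ?N"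
    unfolding cip_def by (intro arg_cong2[of _ _ _ _ "(/)"] sum.cong refl) (simp add: expand sum_product mult_ac)
  also have "\<dots> = (\<Sum>i<k. \<Sum>j<k. (\<Delta> ^\<^sub>m m) $$ (0, i) * (\<Delta> ^\<^sub>m n) $$ (0, j)
      * ((\<Sum>g\<in>carrier G. chr (\<sigma>s ! i) g * chr (\<sigma>s ! j) (inv g)) / ?N))"
    by (subst sum.swap, subst sum.swap) (simp add: sum_distrib_left sum_divide_distrib)
  also have "\<dots> = (\<Sum>i<k. \<Sum>j<k. if j = i then (\<Delta> ^\<^sub>m m) $$ (0, i) * (\<Delta> ^\<^sub>m n) $$ (0, j) else 0)"
    by (intro sum.cong refl) (auto simp: orth)
  also have "\<dots> = (\<Sum>i<k. (\<Delta> ^\<^sub>m m) $$ (0, i) * (\<Delta> ^\<^sub>m n) $$ (0, i))" by simp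
  also have "\<dots> = (\<Sum>i<k. (\<Delta> ^\<^sub>m m) $$ (0, i) * (mat_adjoint \<Delta> ^\<^sub>m n) $$ (i, 0))"
    unfolding adj pow_mat_transpose[OF \<Delta>] using \<Delta> k by (intro sum.cong) auto
  also have "\<dots> = ((\<Delta> ^\<^sub>m m) * (mat_adjoint \<Delta> ^\<^sub>m n)) $$ (0, 0)"
    using \<Delta> k mat_adjoint_carrier[OF \<Delta>] by (intro mult_mat_entry[symmetric]) auto
  finally show "((\<Delta> ^\<^sub>m m) * (mat_adjoint \<Delta> ^\<^sub>m n)) $$ (0, 0) = cip (\<lambda>g. chr \<rho> g ^ m) (\<lambda>g. chr \<rho> g ^ n)" ..
qed

end

section \<open>The alternating group of degree six\<close>

datatype point = P1 | P2 | P3 | P4 | P5 | P6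

datatype perm6 = Perm6 point point point point point point

fun app6 :: "perm6 \<Rightarrow> point \<Rightarrow> point" where
  "app6 (Perm6 a b c d e f) P1 = a"
| "app6 (Perm6 a b c d e f) P2 = b"
| "app6 (Perm6 a b c d e f) P3 = c"
| "app6 (Perm6 a b c d e f) P4 = d"
| "app6 (Perm6 a b c d e f) P5 = e"
| "app6 (Perm6 a b c d e f) P6 = f"

fun comp6 :: "perm6 \<Rightarrow> perm6 \<Rightarrow> perm6" where
  "comp6 p (Perm6 a b c d e f) = Perm6 (app6 p a) (app6 p b) (app6 p c) (app6 p d) (app6 p e) (app6 p f)"

definition id6 :: perm6 where "id6 = Perm6 P1 P2 P3 P4 P5 P6"

definition cyc_fun :: "point \<Rightarrow> point \<Rightarrow> point \<Rightarrow> point \<Rightarrow> point" where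
  "cyc_fun a b c x = (if x = a then b else if x = b then c else if x = c then a else x)"

definition cyc6 :: "point \<Rightarrow> point \<Rightarrow> point \<Rightarrow> perm6" where
  "cyc6 a b c = Perm6 (cyc_fun a b c P1) (cyc_fun a b c P2) (cyc_fun a b c P3)
     (cyc_fun a b c P4) (cyc_fun a b c P5) (cyc_fun a b c P6)"

definition mult_lists :: "perm6 list \<Rightarrow> perm6 list \<Rightarrow> perm6 list" where
  "mult_lists xs ys = concat (map (\<lambda>x. map (comp6 x) ys) xs)"

text \<open>Products of coset representatives along the stabiliser chain of 6, 5 and 4; the point images are
  a datatype so that the conjugacy classes can be computed by rewriting.\<close>

definition alt6 :: "perm6 list" where
  "alt6 = mult_lists [id6, cyc6 P6 P1 P2, cyc6 P6 P2 P1, cyc6 P6 P3 P1, cyc6 P6 P4 P1, cyc6 P6 P5 P1]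
    (mult_lists [id6, cyc6 P5 P1 P2, cyc6 P5 P2 P1, cyc6 P5 P3 P1, cyc6 P5 P4 P1]
    (mult_lists [id6, cyc6 P4 P1 P2, cyc6 P4 P2 P1, cyc6 P4 P3 P1] [id6, cyc6 P3 P1 P2, cyc6 P3 P2 P1]))"

definition alt6_2 :: "perm6 list" where
  "alt6_2 = filter (\<lambda>x. x \<noteq> id6 \<and> comp6 x x = id6) alt6"
definition alt6_3 :: "perm6 list" where
  "alt6_3 = filter (\<lambda>x. x \<noteq> id6 \<and> comp6 x (comp6 x x) = id6) alt6"
definition alt6_4 :: "perm6 list" where
  "alt6_4 = filter (\<lambda>x. comp6 x x \<noteq> id6 \<and> comp6 (comp6 x x) (comp6 x x) = id6) alt6"
definition alt6_5 :: "perm6 list" where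
  "alt6_5 = filter (\<lambda>x. x \<noteq> id6 \<and> comp6 x (comp6 (comp6 x x) (comp6 x x)) = id6) alt6"

lemma app6_comp6: "app6 (comp6 p q) x = app6 p (app6 q x)"
  by (cases q; cases x) simp_all

lemma comp6_assoc: "comp6 (comp6 p q) r = comp6 p (comp6 q r)"
  by (cases r) (simp add: app6_comp6)

lemma app6_id6: "app6 id6 x = x"
  by (cases x) (simp_all add: id6_def)

lemma comp6_id: "comp6 id6 p = p"
  by (cases p) (simp add: app6_id6)

text \<open>Since \<open>ys\<close> fixes \<open>a\<close>, a product maps \<open>a\<close> to where
  its left factor does; different left factors thus give disjoint cosets. Left cancellation within a
  coset holds because the cube of a left factor is the identity.\<close>

lemma distinct_mult_lists:
  assumes "distinct (map (\<lambda>x. app6 x a) xs)" "distinct ys"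
    and "list_all (\<lambda>y. app6 y a = a) ys" "list_all (\<lambda>x. comp6 x (comp6 x x) = id6) xs"
  shows "distinct (mult_lists xs ys)"
  using assms(1,4)
proof (induction xs)
  case (Cons x xs)
  have inj: "inj (comp6 x)"
    using Cons.prems comp6_assoc comp6_id by (intro injI) (simp, metis)
  have key: "app6 z a = app6 x a" if "z \<in> set (map (comp6 x) ys)" for z x
    using that assms(3) by (auto simp: list_all_iff app6_comp6)
  have "set (map (comp6 x) ys) \<inter> set (mult_lists xs ys) = {}"
  proof (intro equals0I, elim IntE)
    fix z assume z: "z \<in> set (map (comp6 x) ys)" "z \<in> set (mult_lists xs ys)"
    then obtain x' where x': "x' \<in> set xs" "z \<in> set (map (comp6 x') ys)" by (auto simp: mult_lists_def)
    have "app6 x a = app6 x' a" using key[OF z(1)] key[OF x'(2)] by simp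
    then show False using Cons.prems(1) x'(1) by auto
  qed
  with Cons inj assms(2) show ?case
    by (auto simp: mult_lists_def distinct_map intro: inj_on_subset)
qed (simp add: mult_lists_def)

lemma distinct_alt6: "distinct alt6"
  unfolding alt6_def
  apply (rule distinct_mult_lists[of P6], code_simp)
    apply (rule distinct_mult_lists[of P5], code_simp)
      apply (rule distinct_mult_lists[of P4]; code_simp)
  by code_simp+

text \<open>These are the 45 double transpositions, the 40 three-cycles with the 40 products of two
  disjoint ones, the 90 elements of cycle type 4 + 2, and the 144 five-cycles.\<close>

lemma length_alt6:
  "length alt6 = 360" "length alt6_2 = 45" "length alt6_3 = 80" "length alt6_4 = 90" "length alt6_5 = 144"
  by code_simp+

lemma alt6_cases:
  "list_all (\<lambda>x. x = id6 \<or> comp6 x x = id6 \<or> comp6 x (comp6 x x) = id6 \<or>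
     comp6 (comp6 x x) (comp6 x x) = id6 \<or> comp6 x (comp6 (comp6 x x) (comp6 x x)) = id6) alt6"
  by code_simp

text \<open>With b = x a x^-1 and c = x b x^-1 the equation reads a b = c, so the conjugates of
  \<open>a\<close> under \<open>x\<close> multiply as in a Klein four group. Inverses are avoided by
  x^-1 = x^2.\<close>

lemma alt6_3_conj:
  "list_all (\<lambda>x. list_ex (\<lambda>a. comp6 a (comp6 x (comp6 a (comp6 x x))) = comp6 (comp6 x x) (comp6 a x)) alt6_2) alt6_3"
  by code_simp

text \<open>For an involution \<open>y\<close>, that y x squares to the identity means y x y = x^-1:
  the element is inverted by an involution. The next lemma says the same for order 5.\<close>

lemma alt6_4_conj: "list_all (\<lambda>x. list_ex (\<lambda>y. comp6 (comp6 y x) (comp6 y x) = id6) alt6_2) alt6_4"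
  by code_simp

lemma alt6_5_conj: "list_all (\<lambda>x. list_ex (\<lambda>y. comp6 (comp6 y x) (comp6 y x) = id6) alt6_2) alt6_5"
  by code_simp

section \<open>Transfer from the computed list to \<open>alt_group 6\<close>\<close>

fun num6 :: "point \<Rightarrow> nat" where
  "num6 P1 = 1" | "num6 P2 = 2" | "num6 P3 = 3" | "num6 P4 = 4" | "num6 P5 = 5" | "num6 P6 = 6"

text \<open>The elements of \<open>alt_group 6\<close> are functions on all natural numbers moving
  only 1 to 6, hence the identity elsewhere.\<close>

definition to_perm :: "perm6 \<Rightarrow> nat \<Rightarrow> nat" where
  "to_perm p n = (if n = 1 then num6 (app6 p P1) else if n = 2 then num6 (app6 p P2)
     else if n = 3 then num6 (app6 p P3) else if n = 4 then num6 (app6 p P4)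
     else if n = 5 then num6 (app6 p P5) else if n = 6 then num6 (app6 p P6) else n)"

lemma to_perm_num6: "to_perm p (num6 x) = num6 (app6 p x)"
  by (cases x) (simp_all add: to_perm_def)

lemma num6_cases: "n \<in> {1..6} \<Longrightarrow> \<exists>x. n = num6 x"
proof -
  assume "n \<in> {1..6}"
  then have "n = num6 P1 \<or> n = num6 P2 \<or> n = num6 P3 \<or> n = num6 P4 \<or> n = num6 P5 \<or> n = num6 P6" by auto
  then show ?thesis by blast
qed

lemma num6_range: "num6 x \<in> {1..6}" by (cases x) auto

lemma num6_inject: "num6 x = num6 y \<longleftrightarrow> x = y" by (cases x; cases y) auto

lemma to_perm_outside: "n \<notin> {1..6} \<Longrightarrow> to_perm p n = n"
  by (auto simp: to_perm_def)

lemma to_perm_comp6: "to_perm (comp6 p q) = to_perm p \<circ> to_perm q"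
proof
  fix n show "to_perm (comp6 p q) n = (to_perm p \<circ> to_perm q) n"
  proof (cases "n \<in> {1..6}")
    case True
    then obtain x where "n = num6 x" using num6_cases by blast
    then show ?thesis by (simp add: to_perm_num6 app6_comp6)
  qed (simp add: to_perm_outside)
qed

lemma perm6_eqI: "(\<And>x. app6 p x = app6 q x) \<Longrightarrow> p = q"
  by (cases p; cases q) (metis app6.simps)

lemma to_perm_inject: "to_perm p = to_perm q \<longleftrightarrow> p = q"
proof
  assume "to_perm p = to_perm q"
  then have "num6 (app6 p x) = num6 (app6 q x)" for x by (simp flip: to_perm_num6)
  then show "p = q" by (intro perm6_eqI) (simp add: num6_inject)
qed simp

lemma to_perm_id6: "to_perm id6 = id"
  by (rule ext) (simp add: to_perm_def id6_def)

lemma to_perm_eq_id: "to_perm p = id \<longleftrightarrow> p = id6"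
  by (metis to_perm_id6 to_perm_inject)

lemma to_perm_cyc6:
  assumes "a \<noteq> b" "b \<noteq> c" "a \<noteq> c"
  shows "to_perm (cyc6 a b c) = Transposition.transpose (num6 a) (num6 b) \<circ> Transposition.transpose (num6 b) (num6 c)"
proof
  have app: "app6 (cyc6 a b c) x = cyc_fun a b c x" for x
    by (cases x) (simp_all add: cyc6_def)
  fix n show "to_perm (cyc6 a b c) n = (Transposition.transpose (num6 a) (num6 b) \<circ> Transposition.transpose (num6 b) (num6 c)) n"
  proof (cases "n \<in> {1..6}")
    case True
    then obtain x where "n = num6 x" using num6_cases by blast
    then show ?thesis using assms
      by (auto simp: to_perm_num6 app cyc_fun_def Transposition.transpose_def num6_inject)
  next
    case False
    then show ?thesis using num6_range[of a] num6_range[of b] num6_range[of c]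
      by (metis to_perm_outside comp_apply transpose_apply_other)
  qed
qed

lemma cyc6_in_alt:
  "a \<noteq> b \<Longrightarrow> b \<noteq> c \<Longrightarrow> a \<noteq> c \<Longrightarrow> to_perm (cyc6 a b c) \<in> carrier (alt_group 6)"
  unfolding alt_group_carrier to_perm_cyc6
  using num6_range[of a] num6_range[of b] num6_range[of c]
  by (auto simp: evenperm_comp permutation_swap_id evenperm_swap num6_inject
      intro!: permutes_compose permutes_swap_id)

lemma comp_in_alt: "p \<in> carrier (alt_group 6) \<Longrightarrow> q \<in> carrier (alt_group 6) \<Longrightarrow> p \<circ> q \<in> carrier (alt_group 6)"
  using group.is_monoid[OF alt_group_is_group[of 6], THEN monoid.m_closed] by (simp add: alt_group_mult)

lemma mult_lists_in_alt:
  "to_perm ` set xs \<subseteq> carrier (alt_group 6) \<Longrightarrow> to_perm ` set ys \<subseteq> carrier (alt_group 6) \<Longrightarrow>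
   to_perm ` set (mult_lists xs ys) \<subseteq> carrier (alt_group 6)"
  unfolding mult_lists_def by (force simp: to_perm_comp6 intro!: comp_in_alt)

text \<open>All factors of \<open>alt6\<close> are the identity or three-cycles, which gives one
  inclusion; the other follows by counting, as both sides have 360 elements.\<close>

lemma alt_group_6_carrier: "carrier (alt_group 6) = to_perm ` set alt6"
proof (rule card_subset_eq[symmetric])
  have id: "to_perm id6 \<in> carrier (alt_group 6)"
    using group.is_monoid[OF alt_group_is_group[of 6], THEN monoid.one_closed]
    by (simp add: to_perm_id6 alt_group_one)
  show "to_perm ` set alt6 \<subseteq> carrier (alt_group 6)"
    unfolding alt6_def by (intro mult_lists_in_alt) (simp_all add: id cyc6_in_alt)
  have "2 * card (carrier (alt_group 6)) = fact 6" by (rule alt_group_card_carrier) simp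
  then have 360: "card (carrier (alt_group 6)) = 360" by (simp add: fact_numeral)
  then show "finite (carrier (alt_group 6))" using card_gt_0_iff by force
  show "card (to_perm ` set alt6) = card (carrier (alt_group 6))"
    using distinct_card[OF distinct_alt6] length_alt6(1)
    by (simp add: 360 card_image inj_on_def to_perm_inject)
qed

abbreviation A6 :: "(nat \<Rightarrow> nat) set" where
  "A6 \<equiv> carrier (alt_group 6)"

definition A6_2 :: "(nat \<Rightarrow> nat) set" where "A6_2 = {x \<in> A6. x \<noteq> id \<and> x \<circ> x = id}"
definition A6_3 :: "(nat \<Rightarrow> nat) set" where "A6_3 = {x \<in> A6. x \<noteq> id \<and> x \<circ> (x \<circ> x) = id}"
definition A6_4 :: "(nat \<Rightarrow> nat) set" where "A6_4 = {x \<in> A6. x \<circ> x \<noteq> id \<and> (x \<circ> x) \<circ> (x \<circ> x) = id}"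
definition A6_5 :: "(nat \<Rightarrow> nat) set" where "A6_5 = {x \<in> A6. x \<noteq> id \<and> x \<circ> ((x \<circ> x) \<circ> (x \<circ> x)) = id}"

lemma A6_class_images:
  "A6_2 = to_perm ` set alt6_2" "A6_3 = to_perm ` set alt6_3"
  "A6_4 = to_perm ` set alt6_4" "A6_5 = to_perm ` set alt6_5"
  unfolding A6_2_def A6_3_def A6_4_def A6_5_def alt6_2_def alt6_3_def alt6_4_def alt6_5_def
    alt_group_6_carrier
  by (auto simp: to_perm_eq_id simp flip: to_perm_comp6)

lemma card_A6_classes: "card A6_2 = 45" "card A6_3 = 80" "card A6_4 = 90" "card A6_5 = 144"
proof -
  have "card (to_perm ` set xs) = length xs" if "distinct xs" for xs
    using distinct_card[OF that] by (simp add: card_image inj_on_def to_perm_inject)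
  moreover have "distinct alt6_2" "distinct alt6_3" "distinct alt6_4" "distinct alt6_5"
    by (simp_all add: alt6_2_def alt6_3_def alt6_4_def alt6_5_def distinct_alt6)
  ultimately show "card A6_2 = 45" "card A6_3 = 80" "card A6_4 = 90" "card A6_5 = 144"
    by (simp_all add: A6_class_images length_alt6)
qed

lemma A6_Un_classes: "A6 = {id} \<union> A6_2 \<union> A6_3 \<union> A6_4 \<union> A6_5"
proof
  show "A6 \<subseteq> {id} \<union> A6_2 \<union> A6_3 \<union> A6_4 \<union> A6_5"
  proof
    fix x assume x: "x \<in> A6"
    then obtain p where p: "x = to_perm p" "p \<in> set alt6" by (auto simp: alt_group_6_carrier)
    with alt6_cases have "x = id \<or> x \<circ> x = id \<or> x \<circ> (x \<circ> x) = id \<or> (x \<circ> x) \<circ> (x \<circ> x) = id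
        \<or> x \<circ> ((x \<circ> x) \<circ> (x \<circ> x)) = id"
      by (simp add: list_all_iff to_perm_eq_id flip: to_perm_comp6)
    with x show "x \<in> {id} \<union> A6_2 \<union> A6_3 \<union> A6_4 \<union> A6_5"
      unfolding A6_2_def A6_3_def A6_4_def A6_5_def by blast
  qed
  have "id \<in> A6" using group.is_monoid[OF alt_group_is_group[of 6], THEN monoid.one_closed]
    by (simp add: alt_group_one)
  then show "{id} \<union> A6_2 \<union> A6_3 \<union> A6_4 \<union> A6_5 \<subseteq> A6"
    unfolding A6_2_def A6_3_def A6_4_def A6_5_def by blast
qed

lemma A6_3_conj:
  "x \<in> A6_3 \<Longrightarrow> \<exists>a\<in>A6_2. a \<circ> (x \<circ> (a \<circ> (x \<circ> x))) = (x \<circ> x) \<circ> (a \<circ> x)"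
  using alt6_3_conj unfolding A6_class_images
  by (force simp: list_all_iff list_ex_iff to_perm_inject simp flip: to_perm_comp6)

lemma A6_4_conj: "x \<in> A6_4 \<Longrightarrow> \<exists>y\<in>A6_2. (y \<circ> x) \<circ> (y \<circ> x) = id"
  using alt6_4_conj unfolding A6_class_images
  by (force simp: list_all_iff list_ex_iff to_perm_eq_id simp flip: to_perm_comp6)

lemma A6_5_conj: "x \<in> A6_5 \<Longrightarrow> \<exists>y\<in>A6_2. (y \<circ> x) \<circ> (y \<circ> x) = id"
  using alt6_5_conj unfolding A6_class_images
  by (force simp: list_all_iff list_ex_iff to_perm_eq_id simp flip: to_perm_comp6)

section \<open>Traces in \<open>SU(3)\<close>\<close>

lemma lessThan_3: "{..<3::nat} = {0, 1, 2}" by auto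

lemma mtrace_3: "A \<in> carrier_mat 3 3 \<Longrightarrow> mtrace A = A $$ (0,0) + A $$ (1,1) + A $$ (2,2)"
  by (simp add: mtrace_def lessThan_3 add.assoc)

lemma mult_mat_entry_3:
  "A \<in> carrier_mat 3 3 \<Longrightarrow> B \<in> carrier_mat 3 3 \<Longrightarrow> i < 3 \<Longrightarrow> j < 3 \<Longrightarrow>
   (A * B) $$ (i, j) = A $$ (i,0) * B $$ (0,j) + A $$ (i,1) * B $$ (1,j) + A $$ (i,2) * B $$ (2,j)"
  by (subst mult_mat_entry[of _ 3 3 _ 3]) (auto simp: lessThan_3 add.assoc)

lemma det_mat_2:
  assumes A: "A \<in> carrier_mat 2 2"
  shows "Determinant.det A = A $$ (0,0) * A $$ (1,1) - A $$ (0,1) * A $$ (1,0)"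
proof -
  have "Determinant.det (mat_delete A 0 j) = A $$ (1, if j = 0 then 1 else 0)" if "j < 2" for j
  proof -
    have "mat_delete A 0 j \<in> carrier_mat 1 1" using A by (auto simp: mat_delete_def)
    then show ?thesis using A that by (subst det_single) (auto simp: mat_delete_def)
  qed
  then show ?thesis
    using laplace_expansion_row[OF A, of 0] A by (simp add: cofactor_def numeral_2_eq_2)
qed

text \<open>The conditionals name the two rows and the two columns that remain, in increasing
  order.\<close>

lemma minor_3:
  assumes A: "A \<in> carrier_mat 3 3" and ij: "i < 3" "j < 3"
  shows "Determinant.det (mat_delete A i j) =
    A $$ (if i = 0 then 1 else 0, if j = 0 then 1 else 0) * A $$ (if i = 2 then 1 else 2, if j = 2 then 1 else 2)
    - A $$ (if i = 0 then 1 else 0, if j = 2 then 1 else 2) * A $$ (if i = 2 then 1 else 2, if j = 0 then 1 else 0)"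
proof -
  have "mat_delete A i j \<in> carrier_mat 2 2" using A by (auto simp: mat_delete_def)
  then show ?thesis
    using A ij by (subst det_mat_2) (auto simp: mat_delete_def simp flip: numeral_2_eq_2)
qed

lemma adj_mat_entry_3:
  assumes A: "A \<in> carrier_mat 3 3" and ij: "i < 3" "j < 3"
  shows "adj_mat A $$ (i, j) = (- 1) ^ (j + i) *
    (A $$ (if j = 0 then 1 else 0, if i = 0 then 1 else 0) * A $$ (if j = 2 then 1 else 2, if i = 2 then 1 else 2)
    - A $$ (if j = 0 then 1 else 0, if i = 2 then 1 else 2) * A $$ (if j = 2 then 1 else 2, if i = 0 then 1 else 0))"
  using A ij by (simp add: adj_mat_def cofactor_def minor_3)

text \<open>Newton's identities for the three eigenvalues: the trace of the adjugate is their second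
  elementary symmetric function, and the trace of \<open>A * adj_mat A\<close> is three times the
  determinant. Both hold as polynomial identities in the nine entries.\<close>

lemma newton_3:
  fixes A :: "complex mat"
  assumes A: "A \<in> carrier_mat 3 3"
  shows "2 * mtrace (adj_mat A) = mtrace A ^ 2 - mtrace (A * A)"
    and "mtrace (A * A * A) = mtrace A * mtrace (A * A) - mtrace (adj_mat A) * mtrace A + mtrace (A * adj_mat A)"
proof -
  have c: "A * A \<in> carrier_mat 3 3" "adj_mat A \<in> carrier_mat 3 3" "A * A * A \<in> carrier_mat 3 3"
    "A * adj_mat A \<in> carrier_mat 3 3"
    using A adj_mat(1)[OF A] by auto
  note e = mtrace_3[OF A] mtrace_3[OF c(1)] mtrace_3[OF c(2)] mtrace_3[OF c(3)] mtrace_3[OF c(4)]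
    mult_mat_entry_3[OF A A] mult_mat_entry_3[OF c(1) A] mult_mat_entry_3[OF A c(2)] adj_mat_entry_3[OF A]
  show "2 * mtrace (adj_mat A) = mtrace A ^ 2 - mtrace (A * A)"
    by (simp add: e del: index_mult_mat) Groebner_Basis.algebra
  show "mtrace (A * A * A) = mtrace A * mtrace (A * A) - mtrace (adj_mat A) * mtrace A + mtrace (A * adj_mat A)"
    by (simp add: e del: index_mult_mat) Groebner_Basis.algebra
qed

lemma SU_simps:
  "A \<in> carrier (SU n) \<longleftrightarrow> A \<in> carrier_mat n n \<and> A * mat_adjoint A = 1\<^sub>m n \<and> Determinant.det A = 1"
  "mult (SU n) = (*)" "one (SU n) = 1\<^sub>m n"
  by (auto simp: SU_def GL_simps)

lemma SU_adjoint:
  assumes "A \<in> carrier (SU n)"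
  shows "mat_adjoint A \<in> carrier_mat n n" "mat_adjoint A * A = 1\<^sub>m n" "A * mat_adjoint A = 1\<^sub>m n"
    "A \<in> carrier_mat n n"
  using assms mat_adjoint_carrier[of A n n] mat_mult_left_right_inverse[of A n "mat_adjoint A"]
  by (auto simp: SU_simps)

lemma mat_adjoint_mult:
  fixes A B :: "complex mat"
  assumes A: "A \<in> carrier_mat n k" and B: "B \<in> carrier_mat k m"
  shows "mat_adjoint (A * B) = mat_adjoint B * mat_adjoint A"
proof -
  note a = mat_adjoint_carrier[OF A] mat_adjoint_carrier[OF B] mat_adjoint_carrier[OF mult_carrier_mat[OF A B]]
  show ?thesis
  proof (rule eq_matI)
    fix i j assume "i < dim_row (mat_adjoint B * mat_adjoint A)" "j < dim_col (mat_adjoint B * mat_adjoint A)"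
    then have ij: "i < m" "j < n" using a by auto
    have "mat_adjoint (A * B) $$ (i, j) = conjugate (\<Sum>l<k. A $$ (j, l) * B $$ (l, i))"
      using mat_adjoint_entry[OF mult_carrier_mat[OF A B] ij] mult_mat_entry[OF A B ij(2,1)] by simp
    also have "\<dots> = (\<Sum>l<k. mat_adjoint B $$ (i, l) * mat_adjoint A $$ (l, j))"
      using ij by (simp add: mat_adjoint_entry[OF A] mat_adjoint_entry[OF B] mult.commute)
    finally show "mat_adjoint (A * B) $$ (i, j) = (mat_adjoint B * mat_adjoint A) $$ (i, j)"
      using mult_mat_entry[OF a(2,1) ij] by simp
  qed (use a in auto)
qed

lemma mtrace_adjoint: "A \<in> carrier_mat n n \<Longrightarrow> mtrace (mat_adjoint A) = cnj (mtrace A)"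
  using mat_adjoint_carrier[of A n n] by (simp add: mtrace_def mat_adjoint_entry[of A n n])

lemma det_mat_adjoint:
  fixes A :: "complex mat"
  assumes A: "A \<in> carrier_mat n n"
  shows "Determinant.det (mat_adjoint A) = cnj (Determinant.det A)"
proof -
  have "mat_adjoint A = transpose_mat (map_mat cnj A)"
    using A mat_adjoint_carrier[OF A] by (intro eq_matI) (auto simp: mat_adjoint_entry[OF A])
  then have "Determinant.det (mat_adjoint A) = Determinant.det (map_mat cnj A)"
    using A by (simp add: det_transpose[of _ n])
  also have "\<dots> = cnj (Determinant.det A)"
    by (rule comm_ring_hom.hom_det) (unfold_locales, auto)
  finally show ?thesis .
qed

lemma SU_group: "group (SU n)"
proof (rule groupI)
  fix A B assume AB: "A \<in> carrier (SU n)" "B \<in> carrier (SU n)"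
  note a = SU_adjoint[OF AB(1)] SU_adjoint[OF AB(2)]
  have "A * B * mat_adjoint (A * B) = A * (B * mat_adjoint B) * mat_adjoint A"
    unfolding mat_adjoint_mult[OF a(4,8)] using a(1,4,5,8) by (simp add: assoc_mult_mat_dim)
  also have "\<dots> = 1\<^sub>m n" using a by simp
  finally show "A \<otimes>\<^bsub>SU n\<^esub> B \<in> carrier (SU n)"
    using AB a by (auto simp: SU_simps det_mult[of _ n])
next
  fix A assume A: "A \<in> carrier (SU n)"
  note a = SU_adjoint[OF A]
  have "mat_adjoint (mat_adjoint A) = A"
    using a mat_adjoint_carrier[OF a(1)]
    by (intro eq_matI) (auto simp: mat_adjoint_entry[OF a(1)] mat_adjoint_entry[OF a(4)])
  then have "mat_adjoint A \<in> carrier (SU n)"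
    using A a by (auto simp: SU_simps det_mat_adjoint)
  then show "\<exists>B\<in>carrier (SU n). B \<otimes>\<^bsub>SU n\<^esub> A = \<one>\<^bsub>SU n\<^esub>"
    using a by (auto simp: SU_simps)
next
  have "mat_adjoint (1\<^sub>m n :: complex mat) = 1\<^sub>m n"
    using mat_adjoint_carrier[OF one_carrier_mat[of n, where 'a = complex]]
    by (intro eq_matI) (auto simp: mat_adjoint_entry[OF one_carrier_mat] dest!: carrier_matD)
  then show "\<one>\<^bsub>SU n\<^esub> \<in> carrier (SU n)" by (auto simp: SU_simps)
qed (auto simp: SU_simps assoc_mult_mat)

text \<open>Determinant 1 makes the adjugate the inverse and unitarity makes the inverse the
  adjoint, so in Newton's identities the second symmetric function is the conjugate of the
  trace.\<close>

lemma SU3_traces: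
  assumes A: "A \<in> carrier (SU 3)"
  shows "mtrace (A * A) = mtrace A ^ 2 - 2 * cnj (mtrace A)"
    and "mtrace (A * A * A) = mtrace A * mtrace (A * A) - cnj (mtrace A) * mtrace A + 3"
proof -
  note a = SU_adjoint[OF A]
  have d: "Determinant.det A = 1" using A by (simp add: SU_simps)
  have "mat_adjoint A = mat_adjoint A * (A * adj_mat A)"
    using adj_mat(2)[OF a(4)] a d by (auto simp: right_mult_one_mat[OF a(1)])
  also have "\<dots> = adj_mat A"
    using a adj_mat(1)[OF a(4)] by (simp flip: assoc_mult_mat[OF a(1,4) adj_mat(1)[OF a(4)]])
  finally have eq: "adj_mat A = mat_adjoint A" ..
  show "mtrace (A * A) = mtrace A ^ 2 - 2 * cnj (mtrace A)"
    using newton_3(1)[OF a(4)] by (simp add: eq mtrace_adjoint[OF a(4)] algebra_simps)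
  show "mtrace (A * A * A) = mtrace A * mtrace (A * A) - cnj (mtrace A) * mtrace A + 3"
    using newton_3(2)[OF a(4)] by (simp add: eq a(3) mtrace_one mtrace_adjoint[OF a(4)])
qed

text \<open>Rows of a unitary matrix have norm 1, so the squared entrywise distance from the
  identity is 2 n minus twice the real part of the trace. This excludes the root 3 in the trace
  equations below.\<close>

lemma SU_trace_eq_dim:
  assumes A: "A \<in> carrier (SU n)" and tr: "mtrace A = of_nat n"
  shows "A = 1\<^sub>m n"
proof -
  note a = SU_adjoint[OF A]
  have row: "(\<Sum>j<n. (cmod (A $$ (i, j)))\<^sup>2) = 1" if i: "i < n" for i
  proof -
    have "complex_of_real (\<Sum>j<n. (cmod (A $$ (i, j)))\<^sup>2) = (\<Sum>j<n. A $$ (i, j) * mat_adjoint A $$ (j, i))"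
      using i by (simp add: mat_adjoint_entry[OF a(4)] complex_norm_square del: of_real_power)
    also have "\<dots> = (A * mat_adjoint A) $$ (i, i)" using mult_mat_entry[OF a(4,1) i i] by simp
    also have "\<dots> = 1" using i by (simp add: a(3))
    finally show ?thesis by (simp only: of_real_eq_1_iff)
  qed
  have sq: "(cmod (z - w))\<^sup>2 = (cmod z)\<^sup>2 - 2 * Re (z * cnj w) + (cmod w)\<^sup>2" for z w
    unfolding cmod_power2 by (simp add: power2_eq_square algebra_simps)
  have "(\<Sum>i<n. \<Sum>j<n. (cmod (A $$ (i, j) - 1\<^sub>m n $$ (i, j)))\<^sup>2) = (\<Sum>i<n. 2 - 2 * Re (A $$ (i, i)))"
  proof (rule sum.cong)
    fix i assume i: "i \<in> {..<n}"
    have "(\<Sum>j<n. (cmod (A $$ (i, j) - 1\<^sub>m n $$ (i, j)))\<^sup>2) =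
        (\<Sum>j<n. (cmod (A $$ (i, j)))\<^sup>2 + (if j = i then 1 - 2 * Re (A $$ (i, i)) else 0))"
      using i by (intro sum.cong) (auto simp: sq)
    also have "\<dots> = 2 - 2 * Re (A $$ (i, i))" using row i by (simp add: sum.distrib)
    finally show "(\<Sum>j<n. (cmod (A $$ (i, j) - 1\<^sub>m n $$ (i, j)))\<^sup>2) = 2 - 2 * Re (A $$ (i, i))" .
  qed simp
  also have "\<dots> = 2 * real n - 2 * Re (mtrace A)"
    using a(4) by (simp add: sum_subtractf mtrace_def sum_distrib_left)
  finally have "(\<Sum>i<n. \<Sum>j<n. (cmod (A $$ (i, j) - 1\<^sub>m n $$ (i, j)))\<^sup>2) = 0" by (simp add: tr)
  then have "\<forall>i<n. \<forall>j<n. A $$ (i, j) = 1\<^sub>m n $$ (i, j)"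
    by (subst (asm) sum_nonneg_eq_0_iff) (auto intro!: sum_nonneg simp: sum_nonneg_eq_0_iff)
  then show ?thesis using a(4) by (intro eq_matI) auto
qed

lemma frobenius_zero:
  fixes E :: "complex mat"
  assumes E: "E \<in> carrier_mat n n" and tr: "mtrace (E * mat_adjoint E) = 0"
  shows "E = 0\<^sub>m n n"
proof -
  have "mtrace (E * mat_adjoint E) = (\<Sum>i<n. \<Sum>j<n. E $$ (i, j) * mat_adjoint E $$ (j, i))"
    using E mult_mat_entry[OF E mat_adjoint_carrier[OF E]] by (simp add: mtrace_def del: index_mult_mat(1))
  also have "\<dots> = complex_of_real (\<Sum>i<n. \<Sum>j<n. (cmod (E $$ (i, j)))\<^sup>2)"
    by (simp add: mat_adjoint_entry[OF E] complex_norm_square del: of_real_power)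
  finally have "(\<Sum>i<n. \<Sum>j<n. (cmod (E $$ (i, j)))\<^sup>2) = 0" using tr by (metis of_real_eq_0_iff)
  then have "\<forall>i<n. \<forall>j<n. E $$ (i, j) = 0"
    by (subst (asm) sum_nonneg_eq_0_iff) (auto intro!: sum_nonneg simp: sum_nonneg_eq_0_iff)
  then show ?thesis using E by (intro eq_matI) auto
qed

lemma SU_involution_adjoint:
  assumes A: "A \<in> carrier (SU n)" and sq: "A * A = 1\<^sub>m n"
  shows "mat_adjoint A = A"
proof -
  note a = SU_adjoint[OF A]
  have "mat_adjoint A = mat_adjoint A * (A * A)"
    using right_mult_one_mat[OF a(1)] sq by simp
  also have "\<dots> = mat_adjoint A * A * A" by (rule assoc_mult_mat[OF a(1,4,4), symmetric])
  finally show ?thesis using a by simp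
qed

text \<open>An involution in the unitary group is self-adjoint, so its trace is real and the
  squaring identity becomes t^2 - 2 t - 3 = 0.\<close>

lemma SU3_involution_trace:
  assumes A: "A \<in> carrier (SU 3)" and sq: "A * A = 1\<^sub>m 3" and ne: "A \<noteq> 1\<^sub>m 3"
  shows "mtrace A = - 1"
proof -
  let ?t = "mtrace A"
  have real: "cnj ?t = ?t"
    using mtrace_adjoint[of A 3] SU_involution_adjoint[OF A sq] SU_adjoint(4)[OF A] by simp
  have "3 = ?t ^ 2 - 2 * ?t" using SU3_traces(1)[OF A] by (simp add: sq real mtrace_one)
  then have "(?t - 3) * (?t + 1) = 0" by Groebner_Basis.algebra
  moreover have "?t \<noteq> 3" using SU_trace_eq_dim[OF A] ne by auto
  ultimately show ?thesis by (simp add: add_eq_0_iff2)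
qed

text \<open>The square is an involution, of trace -1, and the squaring identity becomes (t - 1)^2 =
  0.\<close>

lemma SU3_order4_trace:
  assumes A: "A \<in> carrier (SU 3)" and sq: "A * A * (A * A) = 1\<^sub>m 3" and ne: "A * A \<noteq> 1\<^sub>m 3"
    and real: "cnj (mtrace A) = mtrace A"
  shows "mtrace A = 1"
proof -
  let ?t = "mtrace A"
  have "A * A \<in> carrier (SU 3)"
    using group.is_monoid[OF SU_group, THEN monoid.m_closed, OF A A] by (simp add: SU_simps)
  then have "mtrace (A * A) = - 1" using SU3_involution_trace sq ne by blast
  then have "- 1 = ?t ^ 2 - 2 * ?t" using SU3_traces(1)[OF A] by (simp add: real)
  then have "(?t - 1) ^ 2 = 0" by Groebner_Basis.algebra
  then show ?thesis by simp
qed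

text \<open>Order 5 makes the cube of \<open>A\<close> inverse to its square, so the traces of cube
  and square are conjugate. With the identity for the cube this is t^3 - 4 t^2 + 2 t + 3 = (t - 3)
  (t^2 - t - 1) = 0.\<close>

lemma SU3_order5_trace:
  assumes A: "A \<in> carrier (SU 3)" and five: "A * A * (A * A * A) = 1\<^sub>m 3" and ne: "A \<noteq> 1\<^sub>m 3"
    and real: "cnj (mtrace A) = mtrace A"
  shows "mtrace A ^ 2 = mtrace A + 1" and "mtrace (A * A) = 1 - mtrace A"
proof -
  let ?t = "mtrace A"
  have A2: "A * A \<in> carrier (SU 3)"
    using group.is_monoid[OF SU_group, THEN monoid.m_closed, OF A A] by (simp add: SU_simps)
  note a = SU_adjoint[OF A] SU_adjoint[OF A2]
  have c3: "A * A * A \<in> carrier_mat 3 3" using a by auto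
  have "A * A * A = mat_adjoint (A * A) * (A * A) * (A * A * A)" using a c3 by simp
  also have "\<dots> = mat_adjoint (A * A)"
    using five by (simp add: assoc_mult_mat[OF a(5,8) c3] right_mult_one_mat[OF a(5)])
  finally have cube: "mtrace (A * A * A) = cnj (mtrace (A * A))"
    using mtrace_adjoint[OF a(8)] by simp
  have s: "mtrace (A * A) = ?t ^ 2 - 2 * ?t" using SU3_traces(1)[OF A] by (simp add: real)
  then have "cnj (mtrace (A * A)) = mtrace (A * A)" by (simp add: real)
  then have "?t ^ 2 - 2 * ?t = ?t * (?t ^ 2 - 2 * ?t) - ?t * ?t + 3"
    using SU3_traces(2)[OF A] cube s by (simp add: real)
  then have "(?t - 3) * (?t ^ 2 - ?t - 1) = 0" by Groebner_Basis.algebra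
  moreover have "?t \<noteq> 3" using SU_trace_eq_dim[OF A] ne by auto
  ultimately have "?t ^ 2 - ?t - 1 = 0" by simp
  then show *: "?t ^ 2 = ?t + 1" by Groebner_Basis.algebra
  show "mtrace (A * A) = 1 - ?t" using s * by simp
qed

text \<open>A quarter of the sum is the projection onto the common fixed vectors. The sum
  \<open>E\<close> is self-adjoint with E^2 = 4 E and trace 3 - 1 - 1 - 1 = 0, so the squared moduli
  of its entries add up to 0.\<close>

lemma SU3_klein_sum:
  assumes A: "A \<in> carrier (SU 3)" "A * A = 1\<^sub>m 3" and B: "B \<in> carrier (SU 3)" "B * B = 1\<^sub>m 3"
    and comm: "A * B = B * A"
    and tr: "mtrace A = - 1" "mtrace B = - 1" "mtrace (A * B) = - 1"
  shows "1\<^sub>m 3 + A + B + A * B = 0\<^sub>m 3 3"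
proof -
  define E where "E = 1\<^sub>m 3 + A + B + A * B"
  have c: "A \<in> carrier_mat 3 3" "B \<in> carrier_mat 3 3" "A * B \<in> carrier_mat 3 3"
    using SU_adjoint(4)[OF A(1)] SU_adjoint(4)[OF B(1)] by auto
  have E: "E \<in> carrier_mat 3 3" using c by (simp add: E_def)
  have adj: "mat_adjoint E = E"
  proof (rule eq_matI)
    have AB: "mat_adjoint (A * B) = A * B"
      using mat_adjoint_mult[OF c(1,2)] SU_involution_adjoint[OF A] SU_involution_adjoint[OF B] comm by simp
    fix i j assume "i < dim_row E" "j < dim_col E"
    then have ij: "i < 3" "j < 3" using E by auto
    have e: "conjugate (M $$ (j, i)) = M $$ (i, j)" if "M \<in> carrier_mat 3 3" "mat_adjoint M = M" for M :: "complex mat"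
      using mat_adjoint_entry[OF that(1) ij] that(2) by simp
    have "mat_adjoint E $$ (i, j) = conjugate (E $$ (j, i))" by (rule mat_adjoint_entry[OF E ij])
    also have "\<dots> = E $$ (i, j)"
      using ij c e[OF c(1) SU_involution_adjoint[OF A]] e[OF c(2) SU_involution_adjoint[OF B]] e[OF c(3) AB]
      unfolding E_def by (simp del: index_mult_mat(1) add: index_mult_mat(2,3))
    finally show "mat_adjoint E $$ (i, j) = E $$ (i, j)" .
  qed (use E mat_adjoint_carrier[OF E] in auto)
  have AE: "A * E = E"
  proof -
    have "A * E = A * (1\<^sub>m 3 + A + B) + A * (A * B)"
      unfolding E_def using c by (intro mult_add_distrib_mat[of _ 3 3 _ 3]) auto
    also have "A * (1\<^sub>m 3 + A + B) = A * (1\<^sub>m 3 + A) + A * B"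
      using c by (intro mult_add_distrib_mat[of _ 3 3 _ 3]) auto
    also have "A * (1\<^sub>m 3 + A) = A * 1\<^sub>m 3 + A * A"
      using c by (intro mult_add_distrib_mat[of _ 3 3 _ 3]) auto
    also have "A * (A * B) = B" using c A by (simp flip: assoc_mult_mat[OF c(1,1,2)])
    also have "A * 1\<^sub>m 3 + A * A + A * B + B = E"
      unfolding E_def A(2) right_mult_one_mat[OF c(1)] using c
      by (intro eq_matI) (auto simp del: index_mult_mat(1) simp: index_mult_mat(2,3))
    finally show ?thesis .
  qed
  have BE: "B * E = E"
  proof -
    have "B * E = B * (1\<^sub>m 3 + A + B) + B * (A * B)"
      unfolding E_def using c by (intro mult_add_distrib_mat[of _ 3 3 _ 3]) auto
    also have "B * (1\<^sub>m 3 + A + B) = B * (1\<^sub>m 3 + A) + B * B"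
      using c by (intro mult_add_distrib_mat[of _ 3 3 _ 3]) auto
    also have "B * (1\<^sub>m 3 + A) = B * 1\<^sub>m 3 + B * A"
      using c by (intro mult_add_distrib_mat[of _ 3 3 _ 3]) auto
    also have "B * (A * B) = A" unfolding comm using c B by (simp flip: assoc_mult_mat[OF c(2,2,1)])
    also have "B * 1\<^sub>m 3 + B * A + B * B + A = E"
      unfolding E_def B(2) right_mult_one_mat[OF c(2)] comm[symmetric] using c
      by (intro eq_matI) (auto simp del: index_mult_mat(1) simp: index_mult_mat(2,3))
    finally show ?thesis .
  qed
  have "E * E = (1\<^sub>m 3 + A + B) * E + A * B * E"
    using c E by (subst (1) E_def) (intro add_mult_distrib_mat[of _ 3 3 _ _ 3], auto)
  also have "(1\<^sub>m 3 + A + B) * E = (1\<^sub>m 3 + A) * E + B * E"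
    using c E by (intro add_mult_distrib_mat[of _ 3 3 _ _ 3]) auto
  also have "(1\<^sub>m 3 + A) * E = 1\<^sub>m 3 * E + A * E"
    using c E by (intro add_mult_distrib_mat[of _ 3 3 _ _ 3]) auto
  also have "A * B * E = E" using c E AE BE by (simp add: assoc_mult_mat[OF c(1,2) E])
  finally have "E * E = E + E + E + E" using E AE BE by simp
  moreover have "mtrace E = 0"
    unfolding E_def using c tr by (simp add: mtrace_add[of _ 3] mtrace_one)
  ultimately have "mtrace (E * mat_adjoint E) = 0"
    using E by (simp add: adj mtrace_add[of _ 3])
  then show ?thesis using frobenius_zero[OF E] by (simp add: E_def)
qed

text \<open>Conjugation by \<open>g\<close> permutes the three involutions of a Klein four group cyclically, so \<open>g\<close>
  permutes their common eigenlines cyclically.\<close>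

lemma SU3_klein_trace_zero:
  assumes A: "A \<in> carrier (SU 3)" "A * A = 1\<^sub>m 3" and B: "B \<in> carrier (SU 3)" "B * B = 1\<^sub>m 3"
    and comm: "A * B = B * A"
    and tr: "mtrace A = - 1" "mtrace B = - 1" "mtrace (A * B) = - 1"
    and g: "g \<in> carrier_mat 3 3" and conj: "g * A = B * g" "g * B = A * B * g"
  shows "mtrace g = 0"
proof -
  have c: "A \<in> carrier_mat 3 3" "B \<in> carrier_mat 3 3" "A * B \<in> carrier_mat 3 3"
    using SU_adjoint(4)[OF A(1)] SU_adjoint(4)[OF B(1)] by auto
  \<comment> \<open>The traces of \<open>g\<close>, \<open>g * A\<close>, \<open>g * B\<close> and
    \<open>g * (A * B)\<close> turn out equal, while by \<open>SU3_klein_sum\<close> they add up to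
    0.\<close>
  have 1: "mtrace (g * A) = mtrace (g * B)"
    unfolding conj(1) by (rule mtrace_mult_commute[OF c(2) g])
  have 2: "mtrace (g * B) = mtrace (g * (A * B))"
    unfolding conj(2) by (rule mtrace_mult_commute[OF c(3) g])
  have "mtrace g = mtrace (A * A * g)" using A g by simp
  also have "\<dots> = mtrace (A * (A * g))" by (simp add: assoc_mult_mat[OF c(1,1) g])
  also have "\<dots> = mtrace (A * g * A)" using c g by (intro mtrace_mult_commute) auto
  also have "A * g * A = A * B * g"
    by (simp add: assoc_mult_mat[OF c(1) g c(1)] conj(1) assoc_mult_mat[OF c(1,2) g])
  also have "mtrace (A * B * g) = mtrace (g * (A * B))" by (rule mtrace_mult_commute[OF c(3) g])
  finally have 3: "mtrace g = mtrace (g * (A * B))" .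
  have "0 = mtrace (g * (1\<^sub>m 3 + A + B + A * B))"
    unfolding SU3_klein_sum[OF A B comm tr] using g by (simp add: mtrace_def)
  also have "g * (1\<^sub>m 3 + A + B + A * B) = g * (1\<^sub>m 3 + A + B) + g * (A * B)"
    using c g by (intro mult_add_distrib_mat[of _ 3 3 _ 3]) auto
  also have "g * (1\<^sub>m 3 + A + B) = g * (1\<^sub>m 3 + A) + g * B"
    using c g by (intro mult_add_distrib_mat[of _ 3 3 _ 3]) auto
  also have "g * (1\<^sub>m 3 + A) = g * 1\<^sub>m 3 + g * A"
    using c g by (intro mult_add_distrib_mat[of _ 3 3 _ 3]) auto
  also have "mtrace (g * 1\<^sub>m 3 + g * A + g * B + g * (A * B)) = mtrace g + mtrace (g * A) + mtrace (g * B) + mtrace (g * (A * B))"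
    using c g by (simp add: mtrace_add[of _ 3])
  finally have "4 * mtrace g = 0" using 1 2 3 by simp
  then show ?thesis by simp
qed

section \<open>Lifting elements of \<open>A\<^sub>6\<close>\<close>

definition cube_roots :: "complex set" where
  "cube_roots = {1, \<omega>, \<omega>\<^sup>2}"

lemma omega_cube: "\<omega> ^ 3 = 1"
proof -
  have "\<omega> ^ 3 = cis (real 3 * (2 * pi / 3))" unfolding \<omega>_def by (rule Complex.DeMoivre)
  also have "real 3 * (2 * pi / 3) = 2 * pi" by simp
  finally show ?thesis by simp
qed

lemma omega_explicit: "\<omega> = Complex (- 1 / 2) (sqrt 3 / 2)"
proof -
  have "2 * pi / 3 = pi - pi / 3" by simp
  then show ?thesis
    unfolding \<omega>_def by (simp only: complex_eq_iff cis.simps complex.sel cos_pi_minus sin_pi_minus cos_60 sin_60) simp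
qed

lemma cube_roots_distinct: "\<omega> \<noteq> 1" "\<omega>\<^sup>2 \<noteq> 1" "\<omega>\<^sup>2 \<noteq> \<omega>"
  by (simp_all add: omega_explicit complex_eq_iff power2_eq_square)

lemma cube_roots_eq: "cube_roots = range (\<lambda>j. \<omega> ^ j)"
proof
  show "cube_roots \<subseteq> range (\<lambda>j. \<omega> ^ j)"
    by (auto simp: cube_roots_def image_iff intro: exI[of _ "0::nat"] exI[of _ "1::nat"])
  show "range (\<lambda>j. \<omega> ^ j) \<subseteq> cube_roots"
  proof
    fix z assume "z \<in> range (\<lambda>j. \<omega> ^ j)"
    then obtain j where "z = \<omega> ^ j" by blast
    also have "\<omega> ^ j = \<omega> ^ (3 * (j div 3) + j mod 3)" by simp
    also have "\<dots> = \<omega> ^ (j mod 3)" by (simp only: power_add power_mult omega_cube power_one mult_1)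
    finally have z: "z = \<omega> ^ (j mod 3)" .
    have "j mod 3 < 3" by simp
    then have "j mod 3 = 0 \<or> j mod 3 = 1 \<or> j mod 3 = 2" by linarith
    then show "z \<in> cube_roots" using z by (auto simp: cube_roots_def)
  qed
qed

lemma cube_roots_power: "c \<in> cube_roots \<Longrightarrow> c ^ n \<in> cube_roots"
  by (auto simp: cube_roots_eq simp flip: power_mult)

lemma cube_roots_cube: "c \<in> cube_roots \<Longrightarrow> c ^ 3 = 1"
  by (auto simp: cube_roots_eq simp flip: power_mult) (metis mult.commute omega_cube power_mult power_one)

lemma cube_roots_nonzero: "c \<in> cube_roots \<Longrightarrow> c \<noteq> 0"
  using cube_roots_cube by fastforce

lemma smult_pow_mat:
  "A \<in> carrier_mat n n \<Longrightarrow> (c \<cdot>\<^sub>m A) ^\<^sub>m k = c ^ k \<cdot>\<^sub>m (A ^\<^sub>m k :: 'a::comm_semiring_1 mat)"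
proof (induction k)
  case 0 then show ?case by (auto intro!: eq_matI)
next
  case (Suc k)
  have Ak: "A ^\<^sub>m k \<in> carrier_mat n n" using Suc.prems by auto
  have "(c \<cdot>\<^sub>m A) ^\<^sub>m Suc k = c ^ k \<cdot>\<^sub>m (A ^\<^sub>m k) * (c \<cdot>\<^sub>m A)" using Suc by simp
  also have "\<dots> = c ^ k \<cdot>\<^sub>m (A ^\<^sub>m k * (c \<cdot>\<^sub>m A))"
    using Ak Suc.prems by (intro mult_smult_assoc_mat) auto
  also have "A ^\<^sub>m k * (c \<cdot>\<^sub>m A) = c \<cdot>\<^sub>m (A ^\<^sub>m k * A)"
    by (rule mult_smult_distrib[OF Ak Suc.prems])
  also have "c ^ k \<cdot>\<^sub>m (c \<cdot>\<^sub>m (A ^\<^sub>m k * A)) = c ^ Suc k \<cdot>\<^sub>m (A ^\<^sub>m Suc k)"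
    using Suc.prems by (intro eq_matI) (auto simp: mult_ac simp del: index_mult_mat(1))
  finally show ?case .
qed

lemma conj_pow_mat:
  assumes "A \<in> carrier_mat n n" "P \<in> carrier_mat n n" "Q \<in> carrier_mat n n" "P * Q = 1\<^sub>m n" "Q * P = 1\<^sub>m n"
  shows "(P * A * Q) ^\<^sub>m k = P * (A ^\<^sub>m k) * (Q :: 'a::semiring_1 mat)"
proof (induction k)
  case 0 then show ?case using assms by auto
next
  case (Suc k)
  have Ak: "A ^\<^sub>m k \<in> carrier_mat n n" using assms by auto
  have "(P * A * Q) ^\<^sub>m Suc k = P * A ^\<^sub>m k * Q * (P * A * Q)" using Suc by simp
  also have "\<dots> = P * A ^\<^sub>m k * (Q * P) * A * Q"
    using assms(1-3) Ak by (simp add: assoc_mult_mat_dim)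
  also have "\<dots> = P * (A ^\<^sub>m k * A) * Q"
    unfolding assms(5) using assms(1-3) Ak by (simp add: assoc_mult_mat_dim right_mult_one_mat[of "P * A ^\<^sub>m k" n])
  finally show ?case by simp
qed

text \<open>The bracketing is the one in which the trace lemmas for \<open>SU 3\<close> state their
  hypotheses.\<close>

lemma pow_mat_numerals:
  fixes A :: "'a::semiring_1 mat"
  assumes A: "A \<in> carrier_mat n n"
  shows "A ^\<^sub>m 2 = A * A" "A ^\<^sub>m 4 = A * A * (A * A)" "A ^\<^sub>m 5 = A * A * (A * A * A)"
  using A by (simp_all add: eval_nat_numeral assoc_mult_mat_dim)

text \<open>The quotient by the centre as a concrete map: \<open>f_kernel\<close>,
  \<open>centre\<close> and \<open>f_centre\<close> together say that the fibre through
  \<open>g\<close> consists exactly of the multiples of \<open>g\<close> by cube roots of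
  unity.\<close>

locale ternary_A6 =
  fixes L :: "complex mat set" and f :: "complex mat \<Rightarrow> nat \<Rightarrow> nat"
  assumes subgroup: "subgroup L (SU 3)" and finite_L: "finite L"
    and f_mult: "g \<in> L \<Longrightarrow> h \<in> L \<Longrightarrow> f (g * h) = f g \<circ> f h"
    and f_image: "f ` L = A6"
    and f_kernel: "g \<in> L \<Longrightarrow> h \<in> L \<Longrightarrow> f g = f h \<Longrightarrow> \<exists>c\<in>cube_roots. h = c \<cdot>\<^sub>m g"
    and centre: "c \<in> cube_roots \<Longrightarrow> g \<in> L \<Longrightarrow> c \<cdot>\<^sub>m g \<in> L"
    and f_centre: "c \<in> cube_roots \<Longrightarrow> g \<in> L \<Longrightarrow> f (c \<cdot>\<^sub>m g) = f g"
begin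

lemma L_SU: "g \<in> L \<Longrightarrow> g \<in> carrier (SU 3)"
  using subgroup.subset[OF subgroup] by blast

lemma L_carrier: "g \<in> L \<Longrightarrow> g \<in> carrier_mat 3 3"
  using L_SU SU_adjoint(4) by blast

lemma L_mult: "g \<in> L \<Longrightarrow> h \<in> L \<Longrightarrow> g * h \<in> L"
  using subgroup.m_closed[OF subgroup] by (simp add: SU_simps)

lemma L_one: "1\<^sub>m 3 \<in> L"
  using subgroup.one_closed[OF subgroup] by (simp add: SU_simps)

lemma SU_inv: "g \<in> carrier (SU n) \<Longrightarrow> inv\<^bsub>SU n\<^esub> g = mat_adjoint g"
proof (rule group.inv_equality[OF SU_group])
  assume g: "g \<in> carrier (SU n)"
  then show "mat_adjoint g \<otimes>\<^bsub>SU n\<^esub> g = \<one>\<^bsub>SU n\<^esub>" using SU_adjoint(2) by (simp add: SU_simps)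
  obtain h where h: "h \<in> carrier (SU n)" "h * g = 1\<^sub>m n"
    using group.l_inv_ex[OF SU_group g] by (auto simp: SU_simps)
  note a = SU_adjoint[OF g] SU_adjoint[OF h(1)]
  have "mat_adjoint g = h * g * mat_adjoint g" using h a by simp
  also have "\<dots> = h" using a by (simp add: assoc_mult_mat[OF a(8,4,1)] right_mult_one_mat[OF a(8)])
  finally show "mat_adjoint g \<in> carrier (SU n)" using h by simp
qed

lemma L_adjoint: "g \<in> L \<Longrightarrow> mat_adjoint g \<in> L"
  using subgroup.m_inv_closed[OF subgroup, of g] SU_inv[OF L_SU] by simp

lemma f_A6: "g \<in> L \<Longrightarrow> f g \<in> A6" using f_image by blast

lemma bij_A6: "x \<in> A6 \<Longrightarrow> bij x"
  by (auto simp: alt_group_carrier permutes_bij)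

lemma f_one: "f (1\<^sub>m 3) = id"
proof -
  have "f (1\<^sub>m 3) \<circ> f (1\<^sub>m 3) = f (1\<^sub>m 3)" using f_mult[OF L_one L_one] by simp
  then have "f (1\<^sub>m 3) (f (1\<^sub>m 3) n) = f (1\<^sub>m 3) n" for n by (metis comp_apply)
  moreover have "inj (f (1\<^sub>m 3))" using bij_A6[OF f_A6[OF L_one]] by (rule bij_is_inj)
  ultimately show ?thesis by (auto simp: inj_def)
qed

lemma L_pow: "g \<in> L \<Longrightarrow> g ^\<^sub>m k \<in> L"
  using L_carrier[of g] L_one by (induction k) (auto intro: L_mult)

lemma f_pow: "g \<in> L \<Longrightarrow> f (g ^\<^sub>m k) = f g ^^ k"
proof (induction k)
  case 0 then show ?case using L_carrier[of g] f_one by auto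
next
  case (Suc k)
  then show ?case using f_mult[OF L_pow[of g k], of g] by (simp add: funpow_Suc_right del: funpow.simps)
qed

text \<open>The power \<open>g ^\<^sub>m k\<close> of any preimage is a central scalar, which can be
  scaled away because \<open>k\<close> is prime to 3.\<close>

lemma lift_exists:
  assumes x: "x \<in> A6" "x ^^ k = id" and k: "k \<in> {2, 4, 5}"
  shows "\<exists>g\<in>L. f g = x \<and> g ^\<^sub>m k = 1\<^sub>m 3"
proof -
  have "x \<in> f ` L" using x(1) by (simp only: f_image)
  then obtain g where g: "g \<in> L" "f g = x" by blast
  have "f (1\<^sub>m 3) = f (g ^\<^sub>m k)" using f_pow[OF g(1)] g x by (simp add: f_one)
  then obtain c where c: "c \<in> cube_roots" "g ^\<^sub>m k = c \<cdot>\<^sub>m 1\<^sub>m 3"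
    using f_kernel[OF L_one L_pow[OF g(1)]] by blast
  \<comment> \<open>The exponent 2 k works because 2 k^2 + 1 is divisible by 3 for each admissible
    \<open>k\<close>.\<close>
  have cr: "c ^ (2 * k) \<in> cube_roots" by (rule cube_roots_power[OF c(1)])
  have "(c ^ (2 * k)) ^ k * c = c ^ (2 * k * k + 1)"
    by (simp only: power_add power_mult power_one_right)
  also have "2 * k * k + 1 = 3 * ((2 * k * k + 1) div 3)" using k by auto
  also have "c ^ \<dots> = 1" by (simp only: power_mult cube_roots_cube[OF c(1)] power_one)
  finally have 1: "(c ^ (2 * k)) ^ k * c = 1" .
  have "(c ^ (2 * k) \<cdot>\<^sub>m g) ^\<^sub>m k = (c ^ (2 * k)) ^ k \<cdot>\<^sub>m (c \<cdot>\<^sub>m 1\<^sub>m 3)"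
    by (simp only: smult_pow_mat[OF L_carrier[OF g(1)]] c(2))
  also have "\<dots> = ((c ^ (2 * k)) ^ k * c) \<cdot>\<^sub>m 1\<^sub>m 3" by (intro eq_matI) auto
  also have "\<dots> = 1\<^sub>m 3" unfolding 1 by (intro eq_matI) auto
  finally show ?thesis
    using centre[OF cr g(1)] f_centre[OF cr g(1)] g(2)
    by (intro bexI[of _ "c ^ (2 * k) \<cdot>\<^sub>m g"]) simp_all
qed

text \<open>Two lifts differ by a scalar \<open>c\<close> whose cube and \<open>k\<close>-th power
  are both 1, and \<open>k\<close> is prime to 3. This is the device for turning relations in A_6
  into equations of matrices.\<close>

lemma lift_unique:
  assumes g: "g \<in> L" "g ^\<^sub>m k = 1\<^sub>m 3" and h: "h \<in> L" "h ^\<^sub>m k = 1\<^sub>m 3" and eq: "f g = f h"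
    and k: "k \<in> {2, 4, 5}"
  shows "g = h"
proof -
  obtain c where c: "c \<in> cube_roots" "h = c \<cdot>\<^sub>m g" using f_kernel[OF g(1) h(1) eq] by blast
  have "c ^ k \<cdot>\<^sub>m 1\<^sub>m 3 = 1\<^sub>m 3"
    using h(2) smult_pow_mat[OF L_carrier[OF g(1)], of c k] g(2) by (simp add: c(2))
  then have "(c ^ k \<cdot>\<^sub>m 1\<^sub>m 3) $$ (0, 0) = (1\<^sub>m 3 :: complex mat) $$ (0, 0)" by (rule arg_cong)
  then have ck: "c ^ k = 1" by simp
  have c3: "c ^ 3 = 1" by (rule cube_roots_cube[OF c(1)])
  have "c = 1"
  proof -
    consider "k = 2" | "k = 4" | "k = 5" using k by auto
    then show ?thesis
    proof cases
      case 1
      have "c ^ 3 = c ^ 2 * c" by (simp add: eval_nat_numeral)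
      then show ?thesis using c3 ck 1 by simp
    next
      case 2
      have "c ^ 4 = c ^ 3 * c" by (simp add: eval_nat_numeral)
      then show ?thesis using c3 ck 2 by simp
    next
      case 3
      have "(c ^ 3) ^ 2 = c ^ 5 * c" by (simp add: eval_nat_numeral)
      then show ?thesis using c3 ck 3 by simp
    qed
  qed
  then show ?thesis using c(2) by (auto intro!: eq_matI)
qed

lemma f_adjoint: "g \<in> L \<Longrightarrow> f g \<circ> f (mat_adjoint g) = id" "g \<in> L \<Longrightarrow> f (mat_adjoint g) \<circ> f g = id"
  using SU_adjoint(2,3)[OF L_SU] by (simp_all add: L_adjoint f_one flip: f_mult)

lemma lift_A6_2:
  assumes a: "a \<in> A6_2"
  obtains A where "A \<in> L" "f A = a" "A * A = 1\<^sub>m 3" "mtrace A = - 1"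
proof -
  have "a ^^ 2 = id" using a by (simp add: A6_2_def numeral_2_eq_2)
  then obtain A where A: "A \<in> L" "f A = a" "A ^\<^sub>m 2 = 1\<^sub>m 3"
    using lift_exists[of a 2] a by (auto simp: A6_2_def)
  have sq: "A * A = 1\<^sub>m 3" using A pow_mat_numerals(1)[OF L_carrier[OF A(1)]] by simp
  have "A \<noteq> 1\<^sub>m 3" using A(2) f_one a by (auto simp: A6_2_def)
  then have "mtrace A = - 1" using SU3_involution_trace[OF L_SU[OF A(1)] sq] by simp
  with A sq that show ?thesis by blast
qed

text \<open>By uniqueness of lifts, a lift of the inverting involution conjugates \<open>g\<close> to its inverse.\<close>

lemma lift_trace_real:
  assumes g: "g \<in> L" "g ^\<^sub>m k = 1\<^sub>m 3" and k: "k \<in> {2, 4, 5}"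
    and y: "y \<in> A6_2" "(y \<circ> f g) \<circ> (y \<circ> f g) = id"
  shows "cnj (mtrace g) = mtrace g"
proof -
  obtain Y where Y: "Y \<in> L" "f Y = y" "Y * Y = 1\<^sub>m 3" by (rule lift_A6_2[OF y(1)])
  note c = L_carrier[OF g(1)] L_carrier[OF Y(1)]
  note a = SU_adjoint[OF L_SU[OF g(1)]]
  have 1: "(Y * g * Y) ^\<^sub>m k = 1\<^sub>m 3"
    using conj_pow_mat[OF c(1,2,2) Y(3,3), of k] c Y(3) by (simp add: g(2))
  have "(mat_adjoint g) ^\<^sub>m k * g ^\<^sub>m k = 1\<^sub>m 3"
  proof (induction k)
    case (Suc k)
    have p: "mat_adjoint g ^\<^sub>m k \<in> carrier_mat 3 3" "g ^\<^sub>m k \<in> carrier_mat 3 3" using a by auto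
    have "mat_adjoint g ^\<^sub>m Suc k * g ^\<^sub>m Suc k = mat_adjoint g ^\<^sub>m k * mat_adjoint g * (g * g ^\<^sub>m k)"
      using pow_mat_Suc_left[OF a(4), of k] by simp
    also have "\<dots> = mat_adjoint g ^\<^sub>m k * (mat_adjoint g * g) * g ^\<^sub>m k"
      using p a(1,4) by (simp add: assoc_mult_mat_dim)
    also have "\<dots> = 1\<^sub>m 3" unfolding a(2) right_mult_one_mat[OF p(1)] by (rule Suc)
    finally show ?case .
  qed (use a in auto)
  moreover have "mat_adjoint g ^\<^sub>m k \<in> carrier_mat 3 3" using a by auto
  ultimately have 2: "mat_adjoint g ^\<^sub>m k = 1\<^sub>m 3" using right_mult_one_mat by (metis g(2))
  have YgY: "Y * g * Y \<in> L" using g Y by (intro L_mult)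
  have fY: "f (Y * g * Y) = y \<circ> f g \<circ> y" using f_mult g Y L_mult by simp
  have "f (Y * g * Y) \<circ> f g = id" using y(2) by (simp add: fY comp_assoc)
  then have "f (Y * g * Y) \<circ> (f g \<circ> f (mat_adjoint g)) = f (mat_adjoint g)"
    by (simp flip: comp_assoc)
  then have "f (Y * g * Y) = f (mat_adjoint g)" by (simp add: f_adjoint(1)[OF g(1)])
  then have "Y * g * Y = mat_adjoint g"
    by (rule lift_unique[OF YgY 1 L_adjoint[OF g(1)] 2 _ k])
  \<comment> \<open>Conjugation by the involution \<open>Y\<close> keeps the trace, whereas the
    adjoint has the conjugate trace.\<close>
  moreover have "mtrace (Y * g * Y) = mtrace (Y * (Y * g))"
    using c by (intro mtrace_mult_commute) auto
  moreover have "Y * (Y * g) = g" using c Y(3) by (simp flip: assoc_mult_mat[OF c(2,2,1)])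
  ultimately show ?thesis using mtrace_adjoint[OF c(1)] by simp
qed

text \<open>The claim covers every preimage \<open>g\<close>, since none is distinguished. What is
  lifted is the Klein four group: \<open>A\<close> is the involution over \<open>a\<close>, its
  conjugates \<open>B\<close> and \<open>C\<close> under \<open>g\<close> are involutions too, and
  the relation a b = c in A_6 lifts to \<open>A * B = C\<close>.\<close>

lemma lift_A6_3_trace:
  assumes x: "x \<in> A6_3" and g: "g \<in> L" "f g = x"
  shows "mtrace g = 0"
proof -
  obtain a where a: "a \<in> A6_2" "a \<circ> (x \<circ> (a \<circ> (x \<circ> x))) = (x \<circ> x) \<circ> (a \<circ> x)"
    using A6_3_conj[OF x] by blast
  obtain A where A: "A \<in> L" "f A = a" "A * A = 1\<^sub>m 3" "mtrace A = - 1" by (rule lift_A6_2[OF a(1)])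
  have x3: "x \<circ> (x \<circ> x) = id" using x by (simp add: A6_3_def)
  let ?h = "mat_adjoint g"
  have h: "?h \<in> L" by (rule L_adjoint[OF g(1)])
  note s = SU_adjoint[OF L_SU[OF g(1)]]
  have fh: "f ?h = x \<circ> x"
  proof -
    have "f ?h = f ?h \<circ> (x \<circ> (x \<circ> x))" by (simp add: x3)
    also have "\<dots> = x \<circ> x" using f_adjoint(2)[OF g(1)] g(2) by (simp flip: comp_assoc)
    finally show ?thesis .
  qed
  define B where "B = g * A * ?h"
  define C where "C = g * B * ?h"
  have L: "B \<in> L" "C \<in> L" using g A h by (auto simp: B_def C_def intro!: L_mult)
  note c = L_carrier[OF A(1)] L_carrier[OF L(1)] L_carrier[OF L(2)]
  have A2: "A ^\<^sub>m 2 = 1\<^sub>m 3" using A pow_mat_numerals(1)[OF c(1)] by simp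
  have B2: "B ^\<^sub>m 2 = 1\<^sub>m 3"
    using conj_pow_mat[OF c(1) s(4,1,3,2), of 2] s A2 by (simp add: B_def)
  have C2: "C ^\<^sub>m 2 = 1\<^sub>m 3"
    using conj_pow_mat[OF c(2) s(4,1,3,2), of 2] s B2 by (simp add: C_def)
  have B2': "B * B = 1\<^sub>m 3" and C2': "C * C = 1\<^sub>m 3"
    using B2 C2 pow_mat_numerals(1)[OF c(2)] pow_mat_numerals(1)[OF c(3)] by auto
  have fB: "f B = x \<circ> (a \<circ> (x \<circ> x))" using f_mult g A h L_mult fh by (simp add: B_def comp_assoc)
  have "f C = x \<circ> f B \<circ> (x \<circ> x)" using f_mult g L h L_mult fh by (simp add: C_def)
  also have "\<dots> = (x \<circ> x) \<circ> (a \<circ> (x \<circ> (x \<circ> (x \<circ> x))))" by (simp add: fB comp_assoc)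
  also have "\<dots> = (x \<circ> x) \<circ> (a \<circ> x)" by (simp add: x3)
  also have "\<dots> = f A \<circ> f B" by (simp add: fB A(2) flip: a(2))
  finally have fC: "f C = f (A * B)" using f_mult[OF A(1) L(1)] by simp
  \<comment> \<open>The product of the images of \<open>A\<close> and \<open>B\<close> is that of
    the involution \<open>C\<close>; this is what makes the two images commute.\<close>
  have sq: "(f A \<circ> f B) \<circ> (f A \<circ> f B) = id"
    using f_mult[OF L(2) L(2)] f_mult[OF A(1) L(1)] by (simp add: C2' f_one fC)
  \<comment> \<open>\<open>B * A * B\<close> is an involution over the same element as
    \<open>A\<close>, so by uniqueness of lifts the two agree and \<open>A\<close> commutes with
    \<open>B\<close>.\<close>
  have BAB: "B * A * B \<in> L" using A L by (intro L_mult)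
  have "f (B * A * B) = f A"
  proof -
    have "f (B * A * B) = (f A \<circ> f A) \<circ> (f B \<circ> f A \<circ> f B)"
      using f_mult[OF A(1) A(1)] f_mult L A L_mult by (simp add: A(3) f_one)
    also have "\<dots> = f A \<circ> ((f A \<circ> f B) \<circ> (f A \<circ> f B))" by (simp add: comp_assoc)
    finally show ?thesis by (simp add: sq)
  qed
  moreover have "(B * A * B) ^\<^sub>m 2 = 1\<^sub>m 3"
    using conj_pow_mat[OF c(1,2,2) B2' B2', of 2] c B2' A2 by simp
  ultimately have "B * A * B = A" using lift_unique[OF BAB _ A(1) A2] by simp
  then have "A * B = B * A * B * B" by simp
  also have "\<dots> = B * A" using c B2' by (simp add: assoc_mult_mat_dim)
  finally have comm: "A * B = B * A" .
  have "A * B * (A * B) = A * (B * A) * B" using c by (simp add: assoc_mult_mat_dim)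
  also have "\<dots> = (A * A) * (B * B)" unfolding comm[symmetric] using c by (simp add: assoc_mult_mat_dim)
  finally have "(A * B) ^\<^sub>m 2 = 1\<^sub>m 3"
    using pow_mat_numerals(1)[of "A * B" 3] c A(3) B2' by simp
  then have AB: "A * B = C"
    using lift_unique[OF L_mult[OF A(1) L(1)] _ L(2) C2] fC by simp
  have tr: "mtrace (g * M * ?h) = mtrace M" if M: "M \<in> carrier_mat 3 3" for M
  proof -
    have "mtrace (g * M * ?h) = mtrace (?h * (g * M))" using s M by (intro mtrace_mult_commute) auto
    also have "?h * (g * M) = M" using s M by (simp flip: assoc_mult_mat[OF s(1,4) M])
    finally show ?thesis .
  qed
  have trB: "mtrace B = - 1" using tr[OF c(1)] A(4) by (simp add: B_def)
  then have trC: "mtrace (A * B) = - 1" using tr[OF c(2)] by (simp add: AB C_def)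
  have gM: "g * M * ?h * g = g * M" if M: "M \<in> carrier_mat 3 3" for M
  proof -
    have "g * M * ?h * g = g * M * (?h * g)" using s M by (intro assoc_mult_mat) auto
    then show ?thesis unfolding s(2) using s M by simp
  qed
  show ?thesis
  proof (rule SU3_klein_trace_zero[OF L_SU[OF A(1)] A(3) L_SU[OF L(1)] B2' comm A(4) trB trC s(4)])
    show "g * A = B * g" using gM[OF c(1)] by (simp add: B_def)
    show "g * B = A * B * g" unfolding AB using gM[OF c(2)] by (simp add: C_def)
  qed
qed

lemma lift_A6_4:
  assumes x: "x \<in> A6_4"
  shows "\<exists>g\<in>L. f g = x \<and> mtrace g = 1"
proof -
  have "x ^^ 4 = id" using x by (simp add: A6_4_def eval_nat_numeral comp_assoc)
  then obtain g where g: "g \<in> L" "f g = x" "g ^\<^sub>m 4 = 1\<^sub>m 3"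
    using lift_exists[of x 4] x by (auto simp: A6_4_def)
  have "g * g \<noteq> 1\<^sub>m 3" using f_mult[OF g(1,1)] g(2) x f_one by (auto simp: A6_4_def)
  moreover obtain y where "y \<in> A6_2" "(y \<circ> f g) \<circ> (y \<circ> f g) = id"
    using A6_4_conj[OF x] g(2) by blast
  then have "cnj (mtrace g) = mtrace g" by (intro lift_trace_real[OF g(1,3)]) auto
  ultimately have "mtrace g = 1"
    using SU3_order4_trace[OF L_SU[OF g(1)]] g(3) pow_mat_numerals(2)[OF L_carrier[OF g(1)]] by simp
  with g show ?thesis by blast
qed

lemma lift_A6_5:
  assumes x: "x \<in> A6_5"
  shows "\<exists>g\<in>L. f g = x \<and> g ^\<^sub>m 5 = 1\<^sub>m 3"
proof -
  have "x ^^ 5 = id" using x by (simp add: A6_5_def eval_nat_numeral comp_assoc)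
  then show ?thesis using lift_exists[of x 5] x by (auto simp: A6_5_def)
qed

lemma lift_A6_5_trace:
  assumes x: "x \<in> A6_5" and g: "g \<in> L" "f g = x" "g ^\<^sub>m 5 = 1\<^sub>m 3"
  shows "mtrace g ^ 2 = mtrace g + 1" "mtrace (g * g) = 1 - mtrace g"
proof -
  have ne: "g \<noteq> 1\<^sub>m 3" using g(2) x f_one by (auto simp: A6_5_def)
  obtain y where "y \<in> A6_2" "(y \<circ> f g) \<circ> (y \<circ> f g) = id"
    using A6_5_conj[OF x] g(2) by blast
  then have real: "cnj (mtrace g) = mtrace g" by (intro lift_trace_real[OF g(1,3)]) auto
  have "g * g * (g * g * g) = 1\<^sub>m 3" using g(3) pow_mat_numerals(3)[OF L_carrier[OF g(1)]] by simp
  from SU3_order5_trace[OF L_SU[OF g(1)] this ne real]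
  show "mtrace g ^ 2 = mtrace g + 1" "mtrace (g * g) = 1 - mtrace g" .
qed

end

section \<open>The moments of the trace\<close>

text \<open>The common currency of both sides: the group average and the torus integrals become sums
  of \<open>moment m n t\<close> over values \<open>t\<close> of the trace.\<close>

definition moment :: "nat \<Rightarrow> nat \<Rightarrow> complex \<Rightarrow> complex" where
  "moment m n t = t ^ m * cnj t ^ n"

text \<open>The factor due to central multiples; it is 3 if 3 divides m - n and 0 otherwise.\<close>

definition cube_moment :: "nat \<Rightarrow> nat \<Rightarrow> complex" where
  "cube_moment m n = (\<Sum>c\<in>cube_roots. moment m n c)"

lemma moment_mult: "moment m n (s * t) = moment m n s * moment m n t"
  by (simp add: moment_def power_mult_distrib mult_ac)

text \<open>The two values are 1 + 2 cos (2 pi / 5) and 1 + 2 cos (4 pi / 5), the traces of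
  rotations of order 5.\<close>

definition golden :: complex where "golden = complex_of_real ((1 + sqrt 5) / 2)"
definition golden' :: complex where "golden' = complex_of_real ((1 - sqrt 5) / 2)"

lemma golden_sum: "golden' = 1 - golden" "golden = 1 - golden'"
  by (simp_all add: golden_def golden'_def field_simps)

lemma golden_cases:
  assumes "t ^ 2 = t + 1"
  shows "t = golden \<or> t = golden'"
proof -
  have "golden * golden' = complex_of_real (((1 + sqrt 5) / 2) * ((1 - sqrt 5) / 2))"
    by (simp add: golden_def golden'_def)
  also have "((1 + sqrt 5) / 2) * ((1 - sqrt 5) / 2) = - 1" by (simp add: field_simps)
  finally have p: "golden * golden' = - 1" by simp
  have "(t - golden) * (t - golden') = t ^ 2 - (golden + golden') * t + golden * golden'"
    by (simp add: algebra_simps power2_eq_square)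
  also have "\<dots> = 0" unfolding p using assms by (simp add: golden_sum(1))
  finally show ?thesis by simp
qed

lemma A6_classes_disjoint:
  "A6_2 \<inter> A6_3 = {}" "A6_2 \<inter> A6_4 = {}" "A6_2 \<inter> A6_5 = {}" "A6_3 \<inter> A6_4 = {}"
  "A6_3 \<inter> A6_5 = {}" "A6_4 \<inter> A6_5 = {}"
  "id \<notin> A6_2" "id \<notin> A6_3" "id \<notin> A6_4" "id \<notin> A6_5"
  unfolding A6_2_def A6_3_def A6_4_def A6_5_def by (auto simp: comp_assoc)

context ternary_A6
begin

text \<open>A fibre is one matrix times the three cube roots of unity, and \<open>moment\<close> is
  multiplicative, so the central factor splits off.\<close>

lemma fibre_sum:
  assumes g: "g \<in> L"
  shows "(\<Sum>h\<in>{h \<in> L. f h = f g}. moment m n (mtrace h)) = cube_moment m n * moment m n (mtrace g)"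
proof -
  have fibre: "{h \<in> L. f h = f g} = (\<lambda>c. c \<cdot>\<^sub>m g) ` cube_roots"
    using f_kernel[OF g] centre[OF _ g] f_centre[OF _ g] by (auto simp: image_iff)
  have inj: "inj_on (\<lambda>c. c \<cdot>\<^sub>m g) cube_roots"
  proof (rule inj_onI)
    fix c d assume "c \<cdot>\<^sub>m g = d \<cdot>\<^sub>m g"
    then have "c \<cdot>\<^sub>m g * mat_adjoint g = d \<cdot>\<^sub>m g * mat_adjoint g" by simp
    moreover note a = SU_adjoint[OF L_SU[OF g]]
    ultimately have "c \<cdot>\<^sub>m 1\<^sub>m 3 = d \<cdot>\<^sub>m (1\<^sub>m 3 :: complex mat)"
      using mult_smult_assoc_mat[OF a(4,1)] a(3) by simp
    then have "(c \<cdot>\<^sub>m 1\<^sub>m 3) $$ (0, 0) = (d \<cdot>\<^sub>m (1\<^sub>m 3 :: complex mat)) $$ (0, 0)" by (rule arg_cong)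
    then show "c = d" by simp
  qed
  show ?thesis
    unfolding fibre sum.reindex[OF inj] cube_moment_def
    by (simp add: mtrace_smult[OF L_carrier[OF g]] moment_mult sum_distrib_right)
qed

text \<open>Since x^6 = x, cubing undoes squaring; this makes squaring a permutation of
  \<open>A6_5\<close> along which a sum can be reindexed.\<close>

lemma A6_5_square:
  assumes x: "x \<in> A6_5"
  shows "x \<circ> x \<in> A6_5" "(x \<circ> x) \<circ> ((x \<circ> x) \<circ> (x \<circ> x)) = x"
proof -
  from x have five: "x \<circ> (x \<circ> (x \<circ> (x \<circ> x))) = id" and ne: "x \<noteq> id" and A: "x \<in> A6"
    by (auto simp: A6_5_def comp_assoc)
  have cancel: "x \<circ> (x \<circ> (x \<circ> (x \<circ> (x \<circ> y)))) = y" for y :: "nat \<Rightarrow> nat"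
    using arg_cong[OF five, of "\<lambda>z. z \<circ> y"] by (simp add: comp_assoc)
  have six: "(x \<circ> x) \<circ> ((x \<circ> x) \<circ> (x \<circ> x)) = x" by (simp add: comp_assoc cancel)
  then show "(x \<circ> x) \<circ> ((x \<circ> x) \<circ> (x \<circ> x)) = x" .
  have "x \<circ> x \<noteq> id" using six ne by auto
  then show "x \<circ> x \<in> A6_5" using comp_in_alt[OF A A] by (simp add: A6_5_def comp_assoc cancel five)
qed

text \<open>Squaring replaces the trace t by 1 - t and so swaps the golden values. Adding the sum to
  its reindexed copy, every element contributes both values once, and 144 / 2 = 72. No knowledge of
  which element has which trace is required.\<close>

lemma sum_A6_5:
  assumes lft: "\<And>x. x \<in> A6_5 \<Longrightarrow> lft x \<in> L \<and> f (lft x) = x \<and> lft x ^\<^sub>m 5 = 1\<^sub>m 3"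
  shows "(\<Sum>x\<in>A6_5. F (mtrace (lft x))) = 72 * (F golden + F golden' :: complex)"
proof -
  have sq: "mtrace (lft (x \<circ> x)) = 1 - mtrace (lft x)" if x: "x \<in> A6_5" for x
  proof -
    have l: "lft x \<in> L" "f (lft x) = x" "lft x ^\<^sub>m 5 = 1\<^sub>m 3" using lft[OF x] by auto
    note s = A6_5_square(1)[OF x]
    have l': "lft (x \<circ> x) \<in> L" "f (lft (x \<circ> x)) = x \<circ> x" "lft (x \<circ> x) ^\<^sub>m 5 = 1\<^sub>m 3" using lft[OF s] by auto
    note c = L_carrier[OF l(1)]
    let ?g = "lft x"
    have g5: "?g * ?g * (?g * ?g * ?g) = 1\<^sub>m 3" using l(3) pow_mat_numerals(3)[OF c] by simp
    have "(?g * ?g) ^\<^sub>m 5 = ?g * ?g * (?g * ?g) * (?g * ?g * (?g * ?g) * (?g * ?g))"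
      using pow_mat_numerals(3)[of "?g * ?g" 3] c by auto
    also have "\<dots> = (?g * ?g * (?g * ?g * ?g)) * (?g * ?g * (?g * ?g * ?g))"
      using c by (simp add: assoc_mult_mat_dim)
    also have "\<dots> = 1\<^sub>m 3" by (simp add: g5)
    finally have "lft (x \<circ> x) = ?g * ?g"
      using lift_unique[OF l'(1,3) L_mult[OF l(1,1)], of] l' f_mult[OF l(1,1)] l(2) by simp
    then show ?thesis using lift_A6_5_trace(2)[OF x l] by simp
  qed
  have "(\<Sum>x\<in>A6_5. F (mtrace (lft x))) = (\<Sum>x\<in>A6_5. F (mtrace (lft (x \<circ> x))))"
    using A6_5_square
    by (intro sum.reindex_bij_witness[of _ "\<lambda>x. x \<circ> x" "\<lambda>x. x \<circ> (x \<circ> x)"])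
       (auto simp: comp_assoc A6_5_def comp_in_alt)
  also have "\<dots> = (\<Sum>x\<in>A6_5. F (1 - mtrace (lft x)))" using sq by (intro sum.cong) auto
  finally have "2 * (\<Sum>x\<in>A6_5. F (mtrace (lft x))) = (\<Sum>x\<in>A6_5. F (mtrace (lft x)) + F (1 - mtrace (lft x)))"
    by (simp add: sum.distrib)
  also have "\<dots> = (\<Sum>x\<in>A6_5. F golden + F golden')"
  proof (intro sum.cong refl)
    fix x assume x: "x \<in> A6_5"
    have "mtrace (lft x) = golden \<or> mtrace (lft x) = golden'"
      using lift_A6_5_trace(1)[OF x] lft[OF x] by (intro golden_cases) auto
    then show "F (mtrace (lft x)) + F (1 - mtrace (lft x)) = F golden + F golden'"
      using golden_sum by (metis add.commute)
  qed
  also have "\<dots> = 2 * (72 * (F golden + F golden'))" by (simp add: card_A6_classes)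
  finally show ?thesis by (metis mult_cancel_left zero_neq_numeral)
qed

lemma sum_A6_classes:
  fixes F :: "(nat \<Rightarrow> nat) \<Rightarrow> complex"
  shows "sum F A6 = F id + sum F A6_2 + sum F A6_3 + sum F A6_4 + sum F A6_5"
proof -
  have fin: "finite A6_2" "finite A6_3" "finite A6_4" "finite A6_5"
    using card_A6_classes by (auto intro: card_ge_0_finite)
  note d = A6_classes_disjoint
  have "sum F (((({id} \<union> A6_2) \<union> A6_3) \<union> A6_4) \<union> A6_5) = F id + sum F A6_2 + sum F A6_3 + sum F A6_4 + sum F A6_5"
    using fin d by (subst sum.union_disjoint; auto)+
  then show ?thesis by (subst A6_Un_classes)
qed

theorem trace_moments:
  "(\<Sum>g\<in>L. moment m n (mtrace g)) = cube_moment m n *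
    (moment m n 3 + 45 * moment m n (- 1) + 80 * moment m n 0 + 90 * moment m n 1
     + 72 * (moment m n golden + moment m n golden'))"
proof -
  \<comment> \<open>One lift is chosen over each element. In order 3 any preimage will do; in order
    5 only the normalisation is recorded, since the trace is not determined by the order.\<close>
  let ?P = "\<lambda>x g. g \<in> L \<and> f g = x \<and> (x = id \<longrightarrow> mtrace g = 3) \<and> (x \<in> A6_2 \<longrightarrow> mtrace g = - 1)
    \<and> (x \<in> A6_3 \<longrightarrow> mtrace g = 0) \<and> (x \<in> A6_4 \<longrightarrow> mtrace g = 1) \<and> (x \<in> A6_5 \<longrightarrow> g ^\<^sub>m 5 = 1\<^sub>m 3)"
  have "\<exists>g. ?P x g" if x: "x \<in> A6" for x
  proof -
    note d = A6_classes_disjoint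
    consider "x = id" | "x \<in> A6_2" | "x \<in> A6_3" | "x \<in> A6_4" | "x \<in> A6_5"
      using x A6_Un_classes by blast
    then show ?thesis
    proof cases
      case 1
      then show ?thesis using L_one f_one d by (intro exI[of _ "1\<^sub>m 3"]) (auto simp: mtrace_one)
    next
      case 2
      then obtain g where "g \<in> L" "f g = x" "mtrace g = - 1" by (rule lift_A6_2)
      with 2 d show ?thesis by (intro exI[of _ g]) auto
    next
      case 3
      have "x \<in> f ` L" using x by (simp only: f_image)
      then obtain g where "g \<in> L" "f g = x" by blast
      with 3 d lift_A6_3_trace show ?thesis by (intro exI[of _ g]) auto
    next
      case 4
      with d lift_A6_4[OF 4] show ?thesis by auto
    next
      case 5
      with d lift_A6_5[OF 5] show ?thesis by auto
    qed
  qed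
  then obtain lft where lft: "\<And>x. x \<in> A6 \<Longrightarrow> ?P x (lft x)" by metis
  have sub: "A6_2 \<subseteq> A6" "A6_3 \<subseteq> A6" "A6_4 \<subseteq> A6" "A6_5 \<subseteq> A6" "id \<in> A6"
    using A6_Un_classes by blast+
  have "(\<Sum>g\<in>L. moment m n (mtrace g)) = (\<Sum>x\<in>A6. \<Sum>g\<in>{g \<in> L. f g = x}. moment m n (mtrace g))"
    using sum.image_gen[OF finite_L, of "\<lambda>g. moment m n (mtrace g)" f] by (simp add: f_image)
  also have "\<dots> = (\<Sum>x\<in>A6. cube_moment m n * moment m n (mtrace (lft x)))"
  proof (intro sum.cong refl)
    fix x assume "x \<in> A6"
    then have l: "lft x \<in> L" "f (lft x) = x" using lft by blast+
    show "(\<Sum>g\<in>{g \<in> L. f g = x}. moment m n (mtrace g)) = cube_moment m n * moment m n (mtrace (lft x))"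
      using fibre_sum[OF l(1), of m n] by (simp add: l(2))
  qed
  also have "\<dots> = cube_moment m n * (\<Sum>x\<in>A6. moment m n (mtrace (lft x)))"
    by (simp add: sum_distrib_left)
  also have "(\<Sum>x\<in>A6. moment m n (mtrace (lft x))) = moment m n 3 + (\<Sum>x\<in>A6_2. moment m n (- 1))
      + (\<Sum>x\<in>A6_3. moment m n 0) + (\<Sum>x\<in>A6_4. moment m n 1) + (\<Sum>x\<in>A6_5. moment m n (mtrace (lft x)))"
    unfolding sum_A6_classes using lft sub by (intro arg_cong2[of _ _ _ _ "(+)"] sum.cong) auto
  also have "(\<Sum>x\<in>A6_5. moment m n (mtrace (lft x))) = 72 * (moment m n golden + moment m n golden')"
    using lft sub by (intro sum_A6_5) auto
  finally show ?thesis by (simp add: card_A6_classes)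
qed

end

section \<open>From the abstract quotient to the lifting map\<close>

lemma smult_one_mult:
  "A \<in> carrier_mat n m \<Longrightarrow> (c \<cdot>\<^sub>m 1\<^sub>m n) * A = c \<cdot>\<^sub>m (A :: 'a::comm_semiring_1 mat)"
  "A \<in> carrier_mat n m \<Longrightarrow> A * (c \<cdot>\<^sub>m 1\<^sub>m m) = c \<cdot>\<^sub>m A"
  by (simp_all add: mult_smult_assoc_mat[of _ n n _ m] mult_smult_distrib[of _ n m _ m])

lemma SU3_centre_eq: "SU3_centre = (\<lambda>c. c \<cdot>\<^sub>m 1\<^sub>m 3) ` cube_roots"
  by (auto simp: SU3_centre_def cube_roots_def)

lemma cube_roots_mult: "c \<in> cube_roots \<Longrightarrow> d \<in> cube_roots \<Longrightarrow> c * d \<in> cube_roots"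
  by (auto simp: cube_roots_eq simp flip: power_add)

context
  fixes L :: "complex mat set"
  assumes L: "subgroup L (SU 3)" and card_L: "card L = 1080" and Z: "SU3_centre \<subseteq> L"
    and iso: "((SU 3)\<lparr>carrier := L\<rparr> Mod SU3_centre) \<cong> alt_group 6"
begin

abbreviation (input) sub_SU3 :: "complex mat monoid" where
  "sub_SU3 \<equiv> (SU 3)\<lparr>carrier := L\<rparr>"

lemma group_L: "group sub_SU3"
  using subgroup.subgroup_is_group[OF L SU_group] .

lemma L_sub: "g \<in> L \<Longrightarrow> g \<in> carrier (SU 3)"
  using subgroup.subset[OF L] by blast

lemma L_mat: "g \<in> L \<Longrightarrow> g \<in> carrier_mat 3 3"
  using L_sub SU_adjoint(4) by blast

lemma centre_normal: "SU3_centre \<lhd> sub_SU3"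
proof (rule group.normalI[OF group_L])
  show "subgroup SU3_centre sub_SU3"
  proof (rule group.subgroupI[OF group_L])
    show "SU3_centre \<subseteq> carrier sub_SU3" using Z by simp
    show "SU3_centre \<noteq> {}" by (auto simp: SU3_centre_def)
    fix a assume "a \<in> SU3_centre"
    then obtain c where c: "c \<in> cube_roots" "a = c \<cdot>\<^sub>m 1\<^sub>m 3" by (auto simp: SU3_centre_eq)
    have mem: "c ^ 2 \<cdot>\<^sub>m 1\<^sub>m 3 \<in> SU3_centre" using cube_roots_power[OF c(1)] by (auto simp: SU3_centre_eq)
    have "c ^ 2 \<cdot>\<^sub>m 1\<^sub>m 3 * a = c ^ 2 \<cdot>\<^sub>m a" unfolding c(2) by (rule smult_one_mult(1)[of _ 3 3]) simp
    also have "\<dots> = c ^ 3 \<cdot>\<^sub>m 1\<^sub>m 3" unfolding c(2) by (intro eq_matI) (auto simp: eval_nat_numeral)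
    also have "\<dots> = 1\<^sub>m 3" by (intro eq_matI) (auto simp: cube_roots_cube[OF c(1)])
    finally have "inv\<^bsub>sub_SU3\<^esub> a = c ^ 2 \<cdot>\<^sub>m 1\<^sub>m 3"
      using mem Z \<open>a \<in> SU3_centre\<close> by (intro group.inv_equality[OF group_L]) (auto simp: SU_simps)
    then show "inv\<^bsub>sub_SU3\<^esub> a \<in> SU3_centre" using mem by simp
    fix b assume "b \<in> SU3_centre"
    then obtain d where d: "d \<in> cube_roots" "b = d \<cdot>\<^sub>m 1\<^sub>m 3" by (auto simp: SU3_centre_eq)
    have "a * b = c \<cdot>\<^sub>m b" unfolding c(2) d(2) by (rule smult_one_mult(1)[of _ 3 3]) simp
    also have "\<dots> = (c * d) \<cdot>\<^sub>m 1\<^sub>m 3" unfolding d(2) by (intro eq_matI) auto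
    finally show "a \<otimes>\<^bsub>sub_SU3\<^esub> b \<in> SU3_centre"
      using cube_roots_mult[OF c(1) d(1)] by (auto simp: SU3_centre_eq SU_simps)
  qed
  show "\<forall>x\<in>carrier sub_SU3. SU3_centre #>\<^bsub>sub_SU3\<^esub> x = x <#\<^bsub>sub_SU3\<^esub> SU3_centre"
  proof
    fix x assume "x \<in> carrier sub_SU3"
    then have "x \<in> carrier_mat 3 3" using L_mat by simp
    then show "SU3_centre #>\<^bsub>sub_SU3\<^esub> x = x <#\<^bsub>sub_SU3\<^esub> SU3_centre"
      by (simp add: r_coset_def l_coset_def SU_simps SU3_centre_eq smult_one_mult)
  qed
qed

lemma rcoset_eq: "g \<in> L \<Longrightarrow> SU3_centre #>\<^bsub>sub_SU3\<^esub> g = (\<lambda>c. c \<cdot>\<^sub>m g) ` cube_roots"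
  using L_mat[of g] by (auto simp: r_coset_def SU_simps SU3_centre_eq smult_one_mult)

text \<open>The map sends a matrix to its coset and then through the given isomorphism; injectivity
  of the latter turns equal images into equal cosets.\<close>

lemma obtain_ternary_A6: "\<exists>f. ternary_A6 L f"
proof -
  obtain h where h: "h \<in> iso (sub_SU3 Mod SU3_centre) (alt_group 6)"
    using iso by (auto simp: is_iso_def)
  define f where "f g = h (SU3_centre #>\<^bsub>sub_SU3\<^esub> g)" for g
  have coset: "SU3_centre #>\<^bsub>sub_SU3\<^esub> g \<in> carrier (sub_SU3 Mod SU3_centre)" if "g \<in> L" for g
    using that by (auto simp: FactGroup_def RCOSETS_def)
  have hom: "h (x \<otimes>\<^bsub>sub_SU3 Mod SU3_centre\<^esub> y) = h x \<circ> h y"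
    if "x \<in> carrier (sub_SU3 Mod SU3_centre)" "y \<in> carrier (sub_SU3 Mod SU3_centre)" for x y
    using h that by (auto simp: iso_def hom_def alt_group_mult)
  have bij: "bij_betw h (carrier (sub_SU3 Mod SU3_centre)) A6" using h by (simp add: iso_def)
  have sub: "subgroup SU3_centre sub_SU3" by (rule normal_imp_subgroup[OF centre_normal])
  have mem: "c \<cdot>\<^sub>m g \<in> L" if "c \<in> cube_roots" "g \<in> L" for c g
  proof -
    have "c \<cdot>\<^sub>m 1\<^sub>m 3 \<in> L" using that Z by (auto simp: SU3_centre_eq)
    then have "c \<cdot>\<^sub>m 1\<^sub>m 3 * g \<in> L" using subgroup.m_closed[OF L] that(2) by (simp add: SU_simps)
    then show ?thesis using smult_one_mult(1)[OF L_mat[OF that(2)]] by simp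
  qed
  have "ternary_A6 L f"
  proof (rule ternary_A6.intro)
    show "subgroup L (SU 3)" by (rule L)
    show "finite L" using card_L card_ge_0_finite by force
    show "f ` L = A6"
    proof -
      have "carrier (sub_SU3 Mod SU3_centre) = (\<lambda>g. SU3_centre #>\<^bsub>sub_SU3\<^esub> g) ` L"
        by (auto simp: FactGroup_def RCOSETS_def)
      then show ?thesis using bij_betw_imp_surj_on[OF bij] by (simp add: f_def image_image)
    qed
    fix g k assume g: "g \<in> L" "k \<in> L"
    show "f (g * k) = f g \<circ> f k"
      using hom[OF coset[OF g(1)] coset[OF g(2)]] normal.rcos_sum[OF centre_normal, of g k] g
      by (simp add: f_def FactGroup_def SU_simps)
    assume "f g = f k"
    then have "SU3_centre #>\<^bsub>sub_SU3\<^esub> g = SU3_centre #>\<^bsub>sub_SU3\<^esub> k"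
      using bij coset g unfolding f_def bij_betw_def by (auto dest: inj_onD)
    moreover have "k \<in> SU3_centre #>\<^bsub>sub_SU3\<^esub> k"
    proof -
      have "k = 1 \<cdot>\<^sub>m k" by (intro eq_matI) auto
      then show ?thesis unfolding rcoset_eq[OF g(2)] by (rule image_eqI) (simp add: cube_roots_def)
    qed
    ultimately show "\<exists>c\<in>cube_roots. k = c \<cdot>\<^sub>m g" unfolding rcoset_eq[OF g(1), symmetric]
      using rcoset_eq[OF g(1)] by auto
  next
    fix c g assume c: "c \<in> cube_roots" and g: "g \<in> L"
    show "c \<cdot>\<^sub>m g \<in> L" by (rule mem[OF c g])
    have "c \<cdot>\<^sub>m g \<in> SU3_centre #>\<^bsub>sub_SU3\<^esub> g" unfolding rcoset_eq[OF g] using c by (rule imageI)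
    then have "SU3_centre #>\<^bsub>sub_SU3\<^esub> g = SU3_centre #>\<^bsub>sub_SU3\<^esub> (c \<cdot>\<^sub>m g)"
      using g sub by (intro group.repr_independence[OF group_L]) auto
    then show "f (c \<cdot>\<^sub>m g) = f g" by (simp add: f_def)
  qed
  then show ?thesis by (rule exI[of _ f])
qed

text \<open>In \<open>SU 3\<close> inversion conjugates the trace, so the form \<open>cip\<close> of
  powers of the character becomes the mean of \<open>moment m n\<close> over the group.\<close>

theorem mckay_trace_moments:
  defines "\<Delta> \<equiv> mckay_matrix L"
  shows "(((\<Delta> ^\<^sub>m m) * (mat_adjoint \<Delta> ^\<^sub>m n)) *\<^sub>v unit_vec (dim_row \<Delta>) 0) \<bullet>c unit_vec (dim_row \<Delta>) 0
    = cube_moment m n *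
      (moment m n 3 + 45 * moment m n (- 1) + 80 * moment m n 0 + 90 * moment m n 1
       + 72 * (moment m n golden + moment m n golden')) / 1080"
proof -
  obtain f where "ternary_A6 L f" using obtain_ternary_A6 by blast
  then interpret ternary_A6 L f .
  interpret G: finite_group sub_SU3
    using group_L finite_L by (simp add: finite_group_def finite_group_axioms_def)
  define \<sigma>s where "\<sigma>s = mckay_vertices L"
  have list: "irrep_list sub_SU3 \<sigma>s"
    unfolding \<sigma>s_def mckay_vertices_def using G.irrep_list_exists by (rule someI_ex)
  have \<rho>: "(\<lambda>g. g) \<in> hom sub_SU3 (GL 3)"
    by (rule G.repI) (auto simp: L_carrier SU_simps)
  define k where "k = length \<sigma>s"
  have \<Delta>_eq: "\<Delta> = Matrix.mat k k (\<lambda>(i, j). of_nat (multiplicity_rep sub_SU3 (\<sigma>s ! j) (tensor_rep (\<lambda>g. g) (\<sigma>s ! i))))"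
    by (simp add: \<Delta>_def mckay_matrix_def Let_def \<sigma>s_def k_def)
  have k: "k > 0"
    and entry: "((\<Delta> ^\<^sub>m m) * (mat_adjoint \<Delta> ^\<^sub>m n)) $$ (0, 0) = G.cip (\<lambda>g. mtrace g ^ m) (\<lambda>g. mtrace g ^ n)"
    using G.mckay_moments(1)[OF list \<rho>] G.mckay_moments(2)[OF list \<rho>, where m = m and n = n] unfolding \<Delta>_eq k_def by auto
  have \<Delta>: "\<Delta> \<in> carrier_mat k k" by (simp add: \<Delta>_eq)
  define M where "M = (\<Delta> ^\<^sub>m m) * (mat_adjoint \<Delta> ^\<^sub>m n)"
  have M: "M \<in> carrier_mat k k" using \<Delta> mat_adjoint_carrier[OF \<Delta>] by (auto simp: M_def)
  have u: "conjugate (unit_vec k 0 :: complex vec) = unit_vec k 0"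
    by (intro eq_vecI) (auto simp: unit_vec_def)
  have "(M *\<^sub>v unit_vec k 0) \<bullet>c unit_vec k 0 = (M *\<^sub>v unit_vec k 0) $ 0"
    unfolding u using M k by (intro scalar_prod_right_unit) auto
  also have "\<dots> = M $$ (0, 0)" using M k by (intro mult_unit_vec_entry)
  also have "\<dots> = (\<Sum>g\<in>L. moment m n (mtrace g)) / 1080"
  proof -
    have "mtrace (inv\<^bsub>sub_SU3\<^esub> g) = cnj (mtrace g)" if g: "g \<in> L" for g
    proof -
      have "inv\<^bsub>sub_SU3\<^esub> g = mat_adjoint g"
        using g L_adjoint[OF g] SU_adjoint(2)[OF L_SU[OF g]]
        by (intro group.inv_equality[OF group_L]) (auto simp: SU_simps)
      then show ?thesis using mtrace_adjoint[OF L_carrier[OF g]] by simp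
    qed
    then show ?thesis
      unfolding M_def entry by (simp add: G.cip_def card_L moment_def)
  qed
  finally show ?thesis using \<Delta> by (simp add: trace_moments M_def)
qed

end

section \<open>Finitely supported measures on the torus\<close>

abbreviation torus_set :: "(complex \<times> complex) set" where
  "torus_set \<equiv> sphere 0 1 \<times> sphere 0 1"

lemma space_torus: "space torus = torus_set"
  by (simp add: torus_def space_restrict_space)

text \<open>Phrased with the real-valued \<open>measure\<close>, in which a combination with a
  negative coefficient can be stated.\<close>

definition finite_weighted :: "(complex \<times> complex) measure \<Rightarrow> (complex \<times> complex) set \<Rightarrow>
    (complex \<times> complex \<Rightarrow> real) \<Rightarrow> bool" where
  "finite_weighted M D w \<longleftrightarrow> finite D \<and> D \<subseteq> torus_set \<and> (\<forall>A\<in>sets torus. measure M A = sum w (D \<inter> A))"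

lemma measure_uniform_on_torus:
  assumes "finite D" "D \<subseteq> torus_set" "D \<noteq> {}"
  shows "finite_weighted (uniform_on_torus D) D (\<lambda>_. 1 / real (card D))"
  unfolding finite_weighted_def
proof (intro conjI ballI assms)
  fix A assume A: "A \<in> sets torus"
  have id: "(\<lambda>w. w) \<in> measurable (uniform_count_measure D) torus"
    using assms by (auto simp: measurable_def space_torus space_uniform_count_measure sets_uniform_count_measure)
  have "measure (uniform_on_torus D) A = measure (uniform_count_measure D) ((\<lambda>w. w) -` A \<inter> D)"
    unfolding uniform_on_torus_def using A by (simp add: measure_distr[OF id] space_uniform_count_measure)
  also have "\<dots> = real (card (A \<inter> D)) / real (card D)"
    using assms by (subst measure_uniform_count_measure) auto
  finally show "measure (uniform_on_torus D) A = (\<Sum>_\<in>D \<inter> A. 1 / real (card D))"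
    by (simp add: Int_commute)
qed

text \<open>Replaces the discontinuous \<open>Arg\<close> in \<open>J\<close> by a polynomial in the
  coordinates and their conjugates. Measurability and all later evaluations use this form.\<close>

lemma J_torus:
  assumes "(z, w) \<in> torus_set"
  shows "J (z, w) = 4 * pi\<^sup>2 * (Im (z * w) - Im (z\<^sup>2 * cnj w) - Im (w\<^sup>2 * cnj z))"
proof -
  have unit: "cis (Arg x) = x" if "cmod x = 1" for x
    using that cis_Arg[of x] by (cases "x = 0") (auto simp: sgn_div_norm)
  have "z = cis (2 * pi * (Arg z / (2 * pi)))" "w = cis (2 * pi * (Arg w / (2 * pi)))"
    using assms unit by auto
  then obtain a b where z: "z = cis (2 * pi * a)" and w: "w = cis (2 * pi * b)" by blast
  have "z * w = cis (2 * pi * (a + b))" by (simp add: z w cis_mult distrib_left)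
  moreover have "z\<^sup>2 * cnj w = cis (2 * pi * (2 * a - b))"
    by (simp add: z w cis_cnj cis_mult power2_eq_square algebra_simps)
  moreover have "w\<^sup>2 * cnj z = cis (2 * pi * (2 * b - a))"
    by (simp add: z w cis_cnj cis_mult power2_eq_square algebra_simps)
  ultimately show ?thesis unfolding z w J_cis by (simp only: cis.simps)
qed

lemma J_measurable: "J \<in> borel_measurable torus"
proof -
  have "(\<lambda>x. 4 * pi\<^sup>2 * (Im (fst x * snd x) - Im ((fst x)\<^sup>2 * cnj (snd x)) - Im ((snd x)\<^sup>2 * cnj (fst x))))
      \<in> borel_measurable torus"
    unfolding torus_def by (intro borel_measurable_continuous_on_restrict continuous_intros)
  then show ?thesis
    by (subst measurable_cong[of _ _ "\<lambda>x. 4 * pi\<^sup>2 * (Im (fst x * snd x) - Im ((fst x)\<^sup>2 * cnj (snd x))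
        - Im ((snd x)\<^sup>2 * cnj (fst x)))"]) (auto simp: space_torus J_torus)
qed

lemma measure_J2_uniform:
  assumes D: "finite D" "D \<subseteq> torus_set" "D \<noteq> {}"
  shows "finite_weighted (density (uniform_on_torus D) (\<lambda>w. ennreal ((J w)\<^sup>2))) D (\<lambda>w. (J w)\<^sup>2 / real (card D))"
  unfolding finite_weighted_def
proof (intro conjI ballI assms)
  fix A assume A: "A \<in> sets torus"
  let ?M = "uniform_on_torus D"
  have sets: "sets ?M = sets torus" by (simp add: uniform_on_torus_def)
  have id: "(\<lambda>w. w) \<in> measurable (uniform_count_measure D) torus"
    using D by (auto simp: measurable_def space_torus space_uniform_count_measure sets_uniform_count_measure)
  have meas: "(\<lambda>w. ennreal ((J w)\<^sup>2)) \<in> borel_measurable torus" using J_measurable by simp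
  have "emeasure (density ?M (\<lambda>w. ennreal ((J w)\<^sup>2))) A = (\<integral>\<^sup>+ w. ennreal ((J w)\<^sup>2) * indicator A w \<partial>?M)"
    using A meas by (intro emeasure_density) (auto simp: sets measurable_cong_sets[OF sets refl])
  also have "\<dots> = (\<integral>\<^sup>+ w. ennreal ((J w)\<^sup>2) * indicator A w \<partial>uniform_count_measure D)"
    unfolding uniform_on_torus_def using A meas by (subst nn_integral_distr[OF id]) auto
  also have "\<dots> = (\<Sum>w\<in>D. ennreal ((J w)\<^sup>2) * indicator A w * ennreal (1 / real (card D)))"
    unfolding uniform_count_measure_def by (subst nn_integral_point_measure_finite) (auto simp: D mult.commute)
  also have "\<dots> = (\<Sum>w\<in>D. ennreal (if w \<in> A then (J w)\<^sup>2 / real (card D) else 0))"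
    by (intro sum.cong) (auto simp: ennreal_mult'[symmetric])
  also have "\<dots> = ennreal (\<Sum>w\<in>D. if w \<in> A then (J w)\<^sup>2 / real (card D) else 0)"
    by (intro sum_ennreal) auto
  also have "(\<Sum>w\<in>D. if w \<in> A then (J w)\<^sup>2 / real (card D) else 0) = (\<Sum>w\<in>D \<inter> A. (J w)\<^sup>2 / real (card D))"
    using D(1) by (simp add: sum.inter_restrict)
  finally show "measure (density ?M (\<lambda>w. ennreal ((J w)\<^sup>2))) A = (\<Sum>w\<in>D \<inter> A. (J w)\<^sup>2 / real (card D))"
    by (simp add: measure_def sum_nonneg)
qed

lemma R_measurable: "R m n \<in> borel_measurable torus"
proof -
  have "(\<lambda>x. (fst x + inverse (snd x) + inverse (fst x) * snd x) ^ m *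
      (inverse (fst x) + snd x + fst x * inverse (snd x)) ^ n) \<in> borel_measurable torus"
    unfolding torus_def by (intro borel_measurable_continuous_on_restrict continuous_intros) auto
  then show ?thesis by (simp add: R_def case_prod_beta)
qed

text \<open>A finite sum of point masses, carried over to the sigma-algebra of the torus.\<close>

lemma finite_weighted_exists:
  assumes S: "finite S" "S \<subseteq> torus_set" and W: "\<And>x. x \<in> S \<Longrightarrow> 0 \<le> W x"
  obtains \<epsilon> where "finite_measure \<epsilon>" "sets \<epsilon> = sets torus" "\<And>A. A \<in> sets torus \<Longrightarrow> measure \<epsilon> A = sum W (S \<inter> A)"
    "\<And>m n. (\<integral>w. R m n w \<partial>\<epsilon>) = (\<Sum>x\<in>S. of_real (W x) * R m n x)"
proof -
  \<comment> \<open>The truncation changes nothing on \<open>S\<close>, where \<open>W\<close> is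
    nonnegative, and makes nonnegativity of the density unconditional.\<close>
  define P where "P = point_measure S (\<lambda>x. ennreal (max 0 (W x)))"
  define \<epsilon> where "\<epsilon> = distr P torus (\<lambda>w. w)"
  have id: "(\<lambda>w. w) \<in> measurable P torus"
    using S by (auto simp: P_def measurable_def space_torus space_point_measure sets_point_measure)
  have em: "emeasure \<epsilon> A = ennreal (sum W (S \<inter> A))" if A: "A \<in> sets torus" for A
  proof -
    have "emeasure \<epsilon> A = emeasure P (S \<inter> A)"
      unfolding \<epsilon>_def by (subst emeasure_distr[OF id A]) (simp add: P_def space_point_measure Int_commute)
    also have "\<dots> = (\<Sum>x\<in>S \<inter> A. ennreal (max 0 (W x)))"
      unfolding P_def using S by (intro emeasure_point_measure_finite) auto
    also have "\<dots> = ennreal (\<Sum>x\<in>S \<inter> A. max 0 (W x))" by (intro sum_ennreal) auto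
    also have "(\<Sum>x\<in>S \<inter> A. max 0 (W x)) = sum W (S \<inter> A)"
      using W by (intro sum.cong) (auto simp: max_def)
    finally show ?thesis .
  qed
  have sets: "sets \<epsilon> = sets torus" by (simp add: \<epsilon>_def)
  have "finite_measure \<epsilon>"
  proof
    have "space \<epsilon> = space torus" by (simp add: \<epsilon>_def)
    then show "emeasure \<epsilon> (space \<epsilon>) \<noteq> \<infinity>" using em[OF sets.top] by simp
  qed
  moreover have "measure \<epsilon> A = sum W (S \<inter> A)" if "A \<in> sets torus" for A
    using em[OF that] W sum_nonneg[of "S \<inter> A" W] by (simp add: measure_def)
  moreover have "(\<integral>w. R m n w \<partial>\<epsilon>) = (\<Sum>x\<in>S. of_real (W x) * R m n x)" for m n
  proof -
    have "(\<integral>w. R m n w \<partial>\<epsilon>) = (\<integral>w. R m n w \<partial>P)"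
      unfolding \<epsilon>_def by (rule integral_distr[OF id R_measurable])
    also have "\<dots> = (\<Sum>x\<in>S. max 0 (W x) *\<^sub>R R m n x)"
      unfolding P_def by (rule lebesgue_integral_point_measure_finite[OF S(1)]) simp
    also have "\<dots> = (\<Sum>x\<in>S. of_real (W x) * R m n x)"
      using W by (intro sum.cong refl) (simp add: scaleR_conv_of_real max_def)
    finally show ?thesis .
  qed
  ultimately show ?thesis using sets that by blast
qed

text \<open>On the unit circle inverses are conjugates, so the second base in \<open>R\<close> is
  the conjugate of the first. The three summands have product 1: they are the eigenvalues of a
  diagonal matrix in \<open>SU 3\<close>.\<close>

lemma R_moment:
  assumes "(z, w) \<in> torus_set"
  shows "R m n (z, w) = moment m n (z + inverse w + inverse z * w)"
proof -
  have "cnj z = inverse z" "cnj w = inverse w"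
    using assms by (auto simp: inverse_eq_divide complex_cnj_cancel_iff divide_conv_cnj)
  then show ?thesis by (simp add: R_def moment_def)
qed

section \<open>The lattice measures\<close>

definition unity_roots :: "nat \<Rightarrow> complex set" where
  "unity_roots n = {z. z ^ n = 1}"

lemma unity_roots_cis: "n > 0 \<Longrightarrow> unity_roots n = (\<lambda>k. cis (2 * pi * real k / real n)) ` {..<n}"
  using bij_betw_imp_surj_on[OF Complex.bij_betw_roots_unity[of n]] by (simp add: unity_roots_def)

lemma card_unity_roots: "n > 0 \<Longrightarrow> card (unity_roots n) = n"
  unfolding unity_roots_def by (rule card_roots_unity_eq)

lemma finite_unity_roots: "n > 0 \<Longrightarrow> finite (unity_roots n)"
  unfolding unity_roots_def by (rule finite_roots_unity) simp

lemma unity_roots_norm: "z \<in> unity_roots n \<Longrightarrow> n > 0 \<Longrightarrow> cmod z = 1"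
  by (auto simp: unity_roots_def dest: power_eq_1_iff)

lemma unity_roots_nonzero: "z \<in> unity_roots n \<Longrightarrow> n > 0 \<Longrightarrow> z \<noteq> 0"
  using unity_roots_norm[of z n] by auto

lemma cube_root_mult_unity_root:
  assumes "c \<in> cube_roots" "v \<in> unity_roots N"
  shows "c * v \<in> unity_roots (3 * N)"
proof -
  have "(c * v) ^ (3 * N) = (c ^ 3) ^ N * (v ^ N) ^ 3"
    by (simp add: power_mult_distrib mult.commute flip: power_mult)
  then show ?thesis using assms by (simp add: unity_roots_def cube_roots_cube)
qed

lemma unity_roots_3: "unity_roots 3 = cube_roots"
proof (rule card_subset_eq[symmetric])
  show "cube_roots \<subseteq> unity_roots 3" using cube_roots_cube by (auto simp: unity_roots_def)
  have "card cube_roots = 3" using cube_roots_distinct by (simp add: cube_roots_def)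
  then show "card cube_roots = card (unity_roots 3)" by (simp add: card_unity_roots)
qed (simp add: finite_unity_roots)

text \<open>The parameter \<open>u\<close> is the product \<open>\<omega>\<^sub>1\<omega>\<^sub>2\<close>; in these coordinates \<open>J\<close> depends only on \<open>u\<close> and \<open>z\<^sup>3\<close>.\<close>

definition torus_lattice :: "nat \<Rightarrow> (complex \<times> complex) set" where
  "torus_lattice N = (\<lambda>(z, u). (z, u / z)) ` (unity_roots (3 * N) \<times> unity_roots N)"

lemma omega_power_eq_1: "\<omega> ^ k = 1 \<longleftrightarrow> k mod 3 = 0"
proof -
  have "\<omega> ^ k = \<omega> ^ (3 * (k div 3) + k mod 3)" by simp
  also have "\<dots> = \<omega> ^ (k mod 3)" by (simp only: power_add power_mult omega_cube power_one mult_1)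
  finally have e: "\<omega> ^ k = \<omega> ^ (k mod 3)" .
  have "k mod 3 < 3" by simp
  then have "k mod 3 = 0 \<or> k mod 3 = 1 \<or> k mod 3 = 2" by linarith
  then show ?thesis unfolding e using cube_roots_distinct by auto
qed

text \<open>The product of the two coordinates has \<open>N\<close>-th power
  \<open>\<omega> ^ (q1 + q2)\<close>, so the congruence modulo 3 says that it is an
  \<open>N\<close>-th root of unity.\<close>

lemma lattice_eq:
  assumes N: "N > 0"
  shows "{(cis (2 * pi * real q1 / (3 * real N)), cis (2 * pi * real q2 / (3 * real N))) | q1 q2.
        q1 < 3 * N \<and> q2 < 3 * N \<and> (q1 + q2) mod 3 = 0} = torus_lattice N"
proof -
  define e where "e q = cis (2 * pi * real q / (3 * real N))" for q
  have prod: "(e q1 * e q2) ^ N = \<omega> ^ (q1 + q2)" for q1 q2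
  proof -
    have "(e q1 * e q2) ^ N = cis (real N * (2 * pi * real q1 / (3 * real N) + 2 * pi * real q2 / (3 * real N)))"
      by (simp only: e_def cis_mult Complex.DeMoivre)
    also have "real N * (2 * pi * real q1 / (3 * real N) + 2 * pi * real q2 / (3 * real N))
        = real (q1 + q2) * (2 * pi / 3)" using N by (simp add: field_simps)
    finally show ?thesis by (simp only: \<omega>_def Complex.DeMoivre)
  qed
  have roots: "unity_roots (3 * N) = e ` {..<3 * N}"
    using unity_roots_cis[of "3 * N"] N by (simp add: e_def)
  have "{(e q1, e q2) | q1 q2. q1 < 3 * N \<and> q2 < 3 * N \<and> (q1 + q2) mod 3 = 0}
      = {(z, w). z \<in> unity_roots (3 * N) \<and> w \<in> unity_roots (3 * N) \<and> (z * w) ^ N = 1}"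
    (is "?A = ?B")
  proof
    show "?A \<subseteq> ?B" unfolding roots by (auto simp: prod omega_power_eq_1)
    show "?B \<subseteq> ?A"
    proof
      fix x assume "x \<in> ?B"
      then obtain q1 q2 where q: "q1 < 3 * N" "q2 < 3 * N" "x = (e q1, e q2)" "(e q1 * e q2) ^ N = 1"
        unfolding roots by auto
      from q(4) have m: "(q1 + q2) mod 3 = 0" by (simp only: prod omega_power_eq_1)
      show "x \<in> ?A" by (intro CollectI exI[of _ q1] exI[of _ q2] conjI q(1-3) m)
    qed
  qed
  also have "?B = torus_lattice N"
  proof
    show "?B \<subseteq> torus_lattice N"
    proof
      fix x assume "x \<in> ?B"
      then obtain z w where x: "x = (z, w)" "z \<in> unity_roots (3 * N)" "(z * w) ^ N = 1" by auto
      have "z \<noteq> 0" using unity_roots_nonzero[OF x(2)] N by simp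
      then have "x = (\<lambda>(z, u). (z, u / z)) (z, z * w)" using x by simp
      then show "x \<in> torus_lattice N" unfolding torus_lattice_def
        by (rule image_eqI) (use x in \<open>simp add: unity_roots_def\<close>)
    qed
    show "torus_lattice N \<subseteq> ?B"
    proof
      fix x assume "x \<in> torus_lattice N"
      then obtain z u where x: "x = (z, u / z)" "z ^ (3 * N) = 1" "u ^ N = 1"
        by (auto simp: torus_lattice_def unity_roots_def)
      have z: "z \<noteq> 0" using unity_roots_nonzero[of z "3 * N"] x(2) N by (simp add: unity_roots_def)
      have "u ^ (3 * N) = 1" using x(3) by (metis mult.commute power_mult power_one)
      then show "x \<in> ?B" using x z by (simp add: unity_roots_def power_divide)
    qed
  qed
  finally show ?thesis by (simp only: e_def)
qed

lemma inj_lattice: "N > 0 \<Longrightarrow> inj_on (\<lambda>(z, u). (z, u / z)) (unity_roots (3 * N) \<times> unity_roots N)"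
  using unity_roots_nonzero[of _ "3 * N"] by (auto simp: inj_on_def)

lemma card_lattice: "N > 0 \<Longrightarrow> card (torus_lattice N) = 3 * N * N"
  unfolding torus_lattice_def by (simp add: card_image[OF inj_lattice] card_cartesian_product card_unity_roots)

lemma sum_lattice:
  assumes N: "N > 0"
  shows "(\<Sum>x\<in>torus_lattice N. h x) = (\<Sum>z\<in>unity_roots (3 * N). \<Sum>u\<in>unity_roots N. h (z, u / z))"
  unfolding torus_lattice_def sum.reindex[OF inj_lattice[OF N]]
  by (simp add: sum.cartesian_product case_prod_beta)

lemma lattice_torus: "N > 0 \<Longrightarrow> torus_lattice N \<subseteq> torus_set"
  by (auto simp: torus_lattice_def norm_divide unity_roots_norm)

lemma finite_lattice: "N > 0 \<Longrightarrow> finite (torus_lattice N)"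
  unfolding torus_lattice_def by (simp add: finite_unity_roots)

lemma lattice_nonempty: "N > 0 \<Longrightarrow> torus_lattice N \<noteq> {}"
  using card_lattice[of N] by auto

lemma R_lattice:
  assumes "z \<in> unity_roots (3 * N)" "u \<in> unity_roots N" "N > 0"
  shows "R m n (z, u / z) = moment m n (z + z / u + u / z\<^sup>2)"
proof -
  have "(z, u / z) \<in> torus_lattice N" using assms by (auto simp: torus_lattice_def)
  then have "(z, u / z) \<in> torus_set" using lattice_torus[OF assms(3)] by blast
  then show ?thesis by (simp add: R_moment divide_simps power2_eq_square)
qed

lemma J_lattice:
  assumes "z \<in> unity_roots (3 * N)" "u \<in> unity_roots N" "N > 0"
  shows "J (z, u / z) = 4 * pi\<^sup>2 * (Im u - Im (z ^ 3 * cnj u) - Im (u\<^sup>2 * cnj (z ^ 3)))"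
proof -
  have z: "cmod z = 1" "cmod u = 1" "z \<noteq> 0" using assms unity_roots_norm[of z "3 * N"] unity_roots_norm[of u N] by auto
  then have zz: "z * cnj z = 1" "cnj z * z = 1" using complex_norm_square[of z] by (auto simp: mult.commute)
  have w: "u / z = u * cnj z" using zz z by (simp add: field_simps)
  have "(z, u / z) \<in> torus_set" using z by (simp add: norm_divide)
  from J_torus[OF this] show ?thesis
    unfolding w using zz by (simp add: power2_eq_square power3_eq_cube mult_ac)
qed

text \<open>The Chinese remainder theorem for roots of unity. It separates the central factor and
  covers the lattices for 1, 2 and 4; the lattice for 3 needs its own treatment.\<close>

lemma sum_unity_roots_coprime:
  assumes N: "N > 0" "coprime 3 N"
  shows "(\<Sum>z\<in>unity_roots (3 * N). h z) = (\<Sum>c\<in>cube_roots. \<Sum>v\<in>unity_roots N. h (c * v))"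
proof -
  have inj: "inj_on (\<lambda>(c, v). c * v) (cube_roots \<times> unity_roots N)"
  proof (rule inj_onI, clarify)
    fix c v d w assume c: "c \<in> cube_roots" "d \<in> cube_roots" and v: "v \<in> unity_roots N" "w \<in> unity_roots N"
      and eq: "c * v = d * w"
    have nz: "c \<noteq> 0" "d \<noteq> 0" "v \<noteq> 0" "w \<noteq> 0"
      using c v N cube_roots_nonzero unity_roots_nonzero by auto
    have q: "c / d = w / v" using eq nz by (simp add: field_simps)
    have 3: "(c / d) ^ 3 = 1" using c by (simp add: power_divide cube_roots_cube)
    have n: "(c / d) ^ N = 1" unfolding q using v by (simp add: power_divide unity_roots_def)
    \<comment> \<open>Both the cube and the \<open>N\<close>-th power of \<open>c / d\<close> are 1,
      so this Bezout relation forces \<open>c = d\<close>. The case \<open>N = 1\<close> is split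
      off because the Bezout lemma excludes it.\<close>
    obtain a b where ab: "3 * a = N * b + 1"
    proof (cases "N = 1")
      case True
      then show ?thesis using that[of 1 2] by simp
    next
      case False
      then show ?thesis using coprime_bezout_strong[OF N(2) False] that by blast
    qed
    have "(c / d) ^ (3 * a) = (c / d) ^ (N * b) * (c / d)" unfolding ab by simp
    then have "c / d = 1" using 3 n by (simp add: power_mult)
    then show "c = d \<and> v = w" using eq nz by simp
  qed
  have "(\<lambda>(c, v). c * v) ` (cube_roots \<times> unity_roots N) = unity_roots (3 * N)"
  proof (rule card_subset_eq)
    show "finite (unity_roots (3 * N))" using N by (simp add: finite_unity_roots)
    show "(\<lambda>(c, v). c * v) ` (cube_roots \<times> unity_roots N) \<subseteq> unity_roots (3 * N)"
      using cube_root_mult_unity_root by auto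
    show "card ((\<lambda>(c, v). c * v) ` (cube_roots \<times> unity_roots N)) = card (unity_roots (3 * N))"
      using N by (simp add: card_image[OF inj] card_cartesian_product card_unity_roots
          card_unity_roots[of 3, unfolded unity_roots_3])
  qed
  then have "(\<Sum>z\<in>unity_roots (3 * N). h z) = (\<Sum>z\<in>(\<lambda>(c, v). c * v) ` (cube_roots \<times> unity_roots N). h z)" by simp
  also have "\<dots> = (\<Sum>c\<in>cube_roots. \<Sum>v\<in>unity_roots N. h (c * v))"
    unfolding sum.reindex[OF inj] by (simp add: sum.cartesian_product case_prod_beta)
  finally show ?thesis .
qed

text \<open>Multiplying the first coordinate by a cube root of unity, with the product of the
  coordinates fixed, multiplies the trace by it, because c^-2 = c.\<close>

lemma sum_lattice_coprime:
  assumes N: "N > 0" "coprime 3 N"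
  shows "(\<Sum>x\<in>torus_lattice N. of_real (g x) * R m n x) = (\<Sum>c\<in>cube_roots. \<Sum>v\<in>unity_roots N. \<Sum>u\<in>unity_roots N.
     of_real (g (c * v, u / (c * v))) * (moment m n c * moment m n (v + v / u + u / v\<^sup>2)))"
  unfolding sum_lattice[OF N(1)] sum_unity_roots_coprime[OF N]
proof (intro sum.cong refl)
  fix c v u assume c: "c \<in> cube_roots" and v: "v \<in> unity_roots N" and u: "u \<in> unity_roots N"
  have nz: "c \<noteq> 0" "v \<noteq> 0" "u \<noteq> 0" using c v u N cube_roots_nonzero unity_roots_nonzero by auto
  have c3: "c ^ 3 = 1" by (rule cube_roots_cube[OF c])
  note mem = cube_root_mult_unity_root[OF c v]
  have "1 / c\<^sup>2 = c" using c3 nz by (simp add: field_simps power2_eq_square power3_eq_cube)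
  then have "c * v + c * v / u + u / (c * v)\<^sup>2 = c * (v + v / u + u / v\<^sup>2)"
    by (simp add: power_mult_distrib distrib_left) (metis times_divide_times_eq mult_1 times_divide_eq_right)
  then show "of_real (g (c * v, u / (c * v))) * R m n (c * v, u / (c * v)) =
     of_real (g (c * v, u / (c * v))) * (moment m n c * moment m n (v + v / u + u / v\<^sup>2))"
    unfolding R_lattice[OF mem u N(1)] by (simp only: moment_mult)
qed

lemma unity_roots_1: "unity_roots 1 = {1}"
  by (auto simp: unity_roots_def)

lemma unity_roots_2: "unity_roots 2 = {1, - 1}"
  by (auto simp: unity_roots_def power2_eq_1_iff)

lemma unity_roots_4: "unity_roots 4 = {1, - 1, \<i>, - \<i>}"
proof -
  have "z ^ 4 = 1 \<longleftrightarrow> z = 1 \<or> z = - 1 \<or> z = \<i> \<or> z = - \<i>" for z :: complex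
  proof -
    have "z ^ 4 = 1 \<longleftrightarrow> z ^ 4 - 1 = 0" by simp
    also have "z ^ 4 - 1 = (z - 1) * (z - (- 1)) * ((z - \<i>) * (z - (- \<i>)))"
      by (simp add: algebra_simps eval_nat_numeral)
    finally show ?thesis by (simp only: mult_eq_0_iff right_minus_eq) blast
  qed
  then show ?thesis by (auto simp: unity_roots_def)
qed

lemma coprime_3: "coprime 3 (2::nat)" "coprime 3 (4::nat)"
  using coprime_Suc_left_nat[of 2] coprime_Suc_right_nat[of 3] by (simp_all add: eval_nat_numeral)

lemma lattice_1_sum: "(\<Sum>x\<in>torus_lattice 1. R m n x) = cube_moment m n * moment m n 3"
  using sum_lattice_coprime[of 1 "\<lambda>_. 1" m n]
  by (simp add: unity_roots_1[unfolded One_nat_def] cube_moment_def sum_distrib_right)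

text \<open>Of the four pairs of signs, (1, 1) has trace 3 and the other three have trace
  -1.\<close>

lemma lattice_2_sum: "(\<Sum>x\<in>torus_lattice 2. R m n x) = cube_moment m n * (moment m n 3 + 3 * moment m n (- 1))"
  using sum_lattice_coprime[of 2 "\<lambda>_. 1" m n, OF zero_less_numeral coprime_3(1)]
  by (simp add: unity_roots_2 cube_moment_def sum_distrib_right sum_distrib_left algebra_simps)

text \<open>\<open>J\<close> vanishes where two of the eigenvalues v, v / u, u / v^2 coincide. The
  only three distinct fourth roots of unity with product 1 are 1, i and -i, with sum 1; each of
  their six orderings gives the square of \<open>J\<close> the value 64 pi^4, and 6 times 64 is
  384.\<close>

lemma lattice_4_sum:
  "(\<Sum>x\<in>torus_lattice 4. of_real ((J x)\<^sup>2) * R m n x) = cube_moment m n * (384 * of_real (pi ^ 4) * moment m n 1)"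
proof -
  have J: "(J (c * v, u / (c * v)))\<^sup>2 = 16 * pi ^ 4 * (Im u - Im (v ^ 3 * cnj u) - Im (u\<^sup>2 * cnj (v ^ 3)))\<^sup>2"
    if c: "c \<in> cube_roots" and v: "v \<in> unity_roots 4" and u: "u \<in> unity_roots 4" for c v u
  proof -
    have c3: "c ^ 3 = 1" by (rule cube_roots_cube[OF c])
    note mem = cube_root_mult_unity_root[OF c v]
    from J_lattice[OF mem u] show ?thesis
      by (simp add: power_mult_distrib c3)
  qed
  have "(\<Sum>x\<in>torus_lattice 4. of_real ((J x)\<^sup>2) * R m n x) =
      (\<Sum>c\<in>cube_roots. \<Sum>v\<in>unity_roots 4. \<Sum>u\<in>unity_roots 4.
       of_real (16 * pi ^ 4 * (Im u - Im (v ^ 3 * cnj u) - Im (u\<^sup>2 * cnj (v ^ 3)))\<^sup>2)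
        * (moment m n c * moment m n (v + v / u + u / v\<^sup>2)))"
    unfolding sum_lattice_coprime[of 4, OF zero_less_numeral coprime_3(2)]
    by (intro sum.cong refl) (simp only: J)
  also have "\<dots> = (\<Sum>c\<in>cube_roots. moment m n c * (384 * of_real (pi ^ 4) * moment m n 1))"
    by (intro sum.cong refl)
       (simp add: unity_roots_4 complex_eq_iff power2_eq_square power3_eq_cube)
  finally show ?thesis by (simp add: cube_moment_def sum_distrib_right)
qed

lemma omega_square_explicit: "\<omega>\<^sup>2 = Complex (- 1 / 2) (- sqrt 3 / 2)"
  by (simp add: omega_explicit complex_eq_iff power2_eq_square)

lemma cube_roots_sum:
  assumes "u \<in> cube_roots" "u \<noteq> 1"
  shows "1 + u\<^sup>2 + u = 0"
proof -
  have "(u - 1) * (1 + u\<^sup>2 + u) = u ^ 3 - 1" by (simp add: algebra_simps eval_nat_numeral)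
  then show ?thesis using assms cube_roots_cube[OF assms(1)] by simp
qed

text \<open>Here \<open>v\<close> stands for the cube of a ninth root of unity z. The value is
  nonzero exactly when z, z / u and u / z^2 are the three cube roots of unity in some order.\<close>

lemma cube_roots_J:
  assumes "u \<in> cube_roots" "v \<in> cube_roots"
  shows "(Im u - Im (v * cnj u) - Im (u\<^sup>2 * cnj v))\<^sup>2 = (if v = 1 \<and> u \<noteq> 1 then 27 / 4 else 0)"
proof -
  have "x = 1 \<or> x = Complex (- 1 / 2) (sqrt 3 / 2) \<or> x = Complex (- 1 / 2) (- sqrt 3 / 2)" if "x \<in> cube_roots" for x
    using that by (simp only: cube_roots_def omega_square_explicit insert_iff empty_iff) (simp add: omega_explicit)
  from this[OF assms(1)] this[OF assms(2)] show ?thesis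
    by (elim disjE; hypsubst) (simp_all add: complex_eq_iff power2_eq_square)
qed

text \<open>Six points survive, three choices of z and two of u, each with 108 pi^4 as the square of
  \<open>J\<close> and with trace 1 + u + u^2 = 0 up to the factor z.\<close>

lemma lattice_3_sum:
  "(\<Sum>x\<in>torus_lattice 3. of_real ((J x)\<^sup>2) * R m n x) = 648 * of_real (pi ^ 4) * moment m n 0"
proof -
  have "(\<Sum>x\<in>torus_lattice 3. of_real ((J x)\<^sup>2) * R m n x) =
     (\<Sum>z\<in>unity_roots (3 * 3). \<Sum>u\<in>cube_roots. if z \<in> cube_roots \<and> u \<noteq> 1 then 108 * of_real (pi ^ 4) * moment m n 0 else 0)"
    unfolding sum_lattice[of 3, OF zero_less_numeral] unity_roots_3
  proof (intro sum.cong refl)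
    fix z u assume z: "z \<in> unity_roots (3 * 3)" and u: "u \<in> cube_roots"
    have u3: "u \<in> unity_roots 3" using u by (simp add: unity_roots_3)
    note JR = J_lattice[OF z u3 zero_less_numeral] R_lattice[OF z u3 zero_less_numeral, of m n]
    have "(z ^ 3) ^ 3 = 1" using z by (simp add: unity_roots_def flip: power_mult)
    then have v: "z ^ 3 \<in> cube_roots" unfolding unity_roots_3[symmetric] by (simp add: unity_roots_def)
    have zc: "z \<in> cube_roots \<longleftrightarrow> z ^ 3 = 1" unfolding unity_roots_3[symmetric] by (simp add: unity_roots_def)
    have J2: "(J (z, u / z))\<^sup>2 = (if z ^ 3 = 1 \<and> u \<noteq> 1 then 108 * pi ^ 4 else 0)"
      unfolding JR(1) power_mult_distrib cube_roots_J[OF u v] by simp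
    show "of_real ((J (z, u / z))\<^sup>2) * R m n (z, u / z) =
        (if z \<in> cube_roots \<and> u \<noteq> 1 then 108 * of_real (pi ^ 4) * moment m n 0 else 0)"
    proof (cases "z ^ 3 = 1 \<and> u \<noteq> 1")
      case True
      have nz: "z \<noteq> 0" "u \<noteq> 0" using True u cube_roots_nonzero by auto
      have "1 / z\<^sup>2 = z" using True nz by (simp add: field_simps power2_eq_square power3_eq_cube)
      then have "z + z / u + u / z\<^sup>2 = z * (1 + 1 / u + u)"
        by (simp add: distrib_left) (metis mult.commute times_divide_eq_right mult_1_right)
      also have "1 / u = u\<^sup>2"
        using cube_roots_cube[OF u] nz by (simp add: field_simps power2_eq_square power3_eq_cube)
      also have "1 + u\<^sup>2 + u = 0"
        using True u cube_roots_sum by auto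
      finally show ?thesis unfolding JR(2) J2 zc using True by simp
    next
      case False
      then show ?thesis unfolding J2 zc by auto
    qed
  qed
  also have "\<dots> = (\<Sum>z\<in>unity_roots (3 * 3). if z \<in> cube_roots then 216 * of_real (pi ^ 4) * moment m n 0 else 0)"
    using cube_roots_distinct by (intro sum.cong refl) (auto simp: cube_roots_def)
  also have "\<dots> = (\<Sum>z\<in>cube_roots. 216 * of_real (pi ^ 4) * moment m n 0)"
  proof (rule sum.mono_neutral_cong_right)
    show "finite (unity_roots (3 * 3))" by (simp add: finite_unity_roots)
    show "cube_roots \<subseteq> unity_roots (3 * 3)"
    proof
      fix z assume "z \<in> cube_roots"
      then have "(z ^ 3) ^ 3 = 1" using cube_roots_cube by simp
      then show "z \<in> unity_roots (3 * 3)" unfolding unity_roots_def by (simp only: mem_Collect_eq power_mult)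
    qed
  qed auto
  also have "\<dots> = 648 * of_real (pi ^ 4) * moment m n 0"
    using card_unity_roots[of 3] by (simp add: unity_roots_3)
  finally show ?thesis .
qed

section \<open>The orbit measures\<close>

text \<open>In the coordinates (c x, 1 / (c y)) the eigenvalues are c x, c y, c z. The first
  generator swaps the first two and the second shifts all three cyclically, so the orbit consists of
  all ordered pairs of them.\<close>

lemma S3_orbit_eq:
  assumes c: "c ^ 3 = 1" and xyz: "x * y * z = 1"
  shows "S3_orbit (c * x, inverse (c * y)) =
    (\<lambda>(p, q). (c * p, inverse (c * q))) ` {(x, y), (y, x), (y, z), (z, y), (z, x), (x, z)}"
    (is "_ = ?f ` ?P")
proof -
  have c0: "c \<noteq> 0" using c by auto
  have product: "c * p * (c * q) = inverse (c * r)" if "p * q * r = 1" for p q r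
  proof -
    have "(c * r) * (c * p * (c * q)) = c ^ 3 * (p * q * r)" by (simp add: power3_eq_cube mult_ac)
    also have "\<dots> = 1" using c that by simp
    finally show ?thesis by (rule inverse_unique[symmetric])
  qed
  have perm: "x * z * y = 1" "y * x * z = 1" "y * z * x = 1" "z * x * y = 1" "z * y * x = 1"
    using xyz by (simp_all add: mult_ac)
  show ?thesis
  proof
    show "S3_orbit (c * x, inverse (c * y)) \<subseteq> ?f ` ?P"
    proof
      fix v assume "v \<in> S3_orbit (c * x, inverse (c * y))"
      then show "v \<in> ?f ` ?P"
      proof (induction rule: S3_orbit.induct)
        case base show ?case by simp
      next
        case (flip w1 w2) then show ?case by auto
      next
        case (rot w1 w2)
        then obtain p q where pq: "(p, q) \<in> ?P" "w1 = c * p" "w2 = inverse (c * q)" by auto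
        have "\<exists>r. p * q * r = 1 \<and> (q, r) \<in> ?P" using pq(1) xyz perm by auto
        then obtain r where r: "p * q * r = 1" "(q, r) \<in> ?P" by blast
        have "(inverse w2, w1 * inverse w2) = ?f (q, r)" using product[OF r(1)] by (simp add: pq)
        then show ?case using r(2) by (rule image_eqI)
      qed
    qed
    let ?O = "S3_orbit (c * x, inverse (c * y))"
    have fl: "(c * q, inverse (c * p)) \<in> ?O" if "(c * p, inverse (c * q)) \<in> ?O" for p q
      using S3_orbit.flip[OF that] by simp
    have ro: "(c * q, inverse (c * r)) \<in> ?O" if "(c * p, inverse (c * q)) \<in> ?O" "p * q * r = 1" for p q r
      using S3_orbit.rot[OF that(1)] product[OF that(2)] by simp
    have 1: "(c * x, inverse (c * y)) \<in> ?O" by (rule S3_orbit.base)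
    have 2: "(c * y, inverse (c * z)) \<in> ?O" by (rule ro[OF 1 xyz])
    have 3: "(c * z, inverse (c * x)) \<in> ?O" by (rule ro[OF 2 perm(3)])
    show "?f ` ?P \<subseteq> ?O" using 1 2 3 fl[OF 1] fl[OF 2] fl[OF 3] by auto
  qed
qed

text \<open>The ordered pairs taken from the eigenvalues 1, \<open>\<tau>\<close> and
  \<open>inverse \<tau>\<close>; the remaining eigenvalue is determined by product 1.\<close>

definition orbit_pairs :: "complex \<Rightarrow> (complex \<times> complex) set" where
  "orbit_pairs \<tau> = {(1, \<tau>), (\<tau>, 1), (1, inverse \<tau>), (inverse \<tau>, 1), (\<tau>, inverse \<tau>), (inverse \<tau>, \<tau>)}"

definition orbit_set :: "complex \<Rightarrow> (complex \<times> complex) set" where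
  "orbit_set \<tau> = (\<lambda>(c, p, q). (c * p, inverse (c * q))) ` (cube_roots \<times> orbit_pairs \<tau>)"

lemma image_triple_Times:
  "(\<lambda>(c, p, q). f c p q) ` (C \<times> P) = (\<Union>c\<in>C. (\<lambda>(p, q). f c p q) ` P)"
  by force

lemma cnj_omega: "cnj \<omega> = \<omega>\<^sup>2"
  unfolding omega_square_explicit by (simp add: omega_explicit complex_eq_iff)

text \<open>The three base points have the eigenvalues 1, \<open>\<tau>\<close> and
  \<open>inverse \<tau>\<close> multiplied by 1, by the square of \<open>\<omega>\<close>, and by
  \<open>\<omega>\<close>.\<close>

lemma orbit_union:
  assumes \<tau>: "cmod \<tau> = 1"
  shows "S3_orbit (\<tau>, \<tau>) \<union> S3_orbit (cnj \<omega> * cnj \<tau>, \<omega>) \<union> S3_orbit (\<omega>, cnj \<omega> * cnj \<tau>) = orbit_set \<tau>"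
proof -
  have t0: "\<tau> \<noteq> 0" using \<tau> by auto
  have ct: "cnj \<tau> = inverse \<tau>"
    using \<tau> t0 complex_norm_square[of \<tau>] by (simp add: field_simps)
  have w0: "\<omega> \<noteq> 0" using omega_cube by auto
  have w2: "inverse (\<omega>\<^sup>2) = \<omega>" "inverse \<omega> = \<omega>\<^sup>2"
    using omega_cube w0 by (auto simp: field_simps power2_eq_square power3_eq_cube)
  have "(\<omega>\<^sup>2) ^ 3 = (\<omega> ^ 3)\<^sup>2" by (simp flip: power_mult)
  then have w6: "(\<omega>\<^sup>2) ^ 3 = 1" by (simp add: omega_cube)
  have 1: "S3_orbit (\<tau>, \<tau>) = (\<lambda>(p, q). (1 * p, inverse (1 * q))) ` orbit_pairs \<tau>"
    using S3_orbit_eq[of 1 \<tau> "inverse \<tau>" 1] t0 by (simp add: orbit_pairs_def insert_commute)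
  have 2: "S3_orbit (cnj \<omega> * cnj \<tau>, \<omega>) = (\<lambda>(p, q). (\<omega>\<^sup>2 * p, inverse (\<omega>\<^sup>2 * q))) ` orbit_pairs \<tau>"
    using S3_orbit_eq[OF w6, of "inverse \<tau>" 1 \<tau>] t0 by (simp add: orbit_pairs_def insert_commute cnj_omega ct w2)
  have 3: "S3_orbit (\<omega>, cnj \<omega> * cnj \<tau>) = (\<lambda>(p, q). (\<omega> * p, inverse (\<omega> * q))) ` orbit_pairs \<tau>"
    using S3_orbit_eq[OF omega_cube, of 1 \<tau> "inverse \<tau>"] t0 by (simp add: orbit_pairs_def insert_commute cnj_omega ct w2)
  show ?thesis
    unfolding 1 2 3 orbit_set_def cube_roots_def image_triple_Times by (simp only: UN_insert UN_empty) blast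
qed

lemma fifth_root:
  assumes \<tau>: "\<tau> ^ 5 = 1" "\<tau> \<noteq> 1"
  shows "cmod \<tau> = 1" "\<tau> \<noteq> 0" "inverse \<tau> = \<tau> ^ 4" "\<tau> \<noteq> inverse \<tau>" "inverse \<tau> \<noteq> 1"
    "(1 + \<tau> + inverse \<tau>)\<^sup>2 = (1 + \<tau> + inverse \<tau>) + 1"
proof -
  show n: "cmod \<tau> = 1" using \<tau>(1) power_eq_1_iff[of \<tau> 5] by auto
  then show t0: "\<tau> \<noteq> 0" by auto
  show i: "inverse \<tau> = \<tau> ^ 4" using \<tau>(1) by (intro inverse_unique) (simp add: eval_nat_numeral)
  show "\<tau> \<noteq> inverse \<tau>"
  proof
    assume "\<tau> = inverse \<tau>"
    then have "\<tau> * \<tau> = 1" using t0 by (metis right_inverse)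
    moreover have "\<tau> ^ 5 = (\<tau> * \<tau>) * (\<tau> * \<tau>) * \<tau>" by (simp add: eval_nat_numeral)
    ultimately show False using \<tau> by simp
  qed
  show "inverse \<tau> \<noteq> 1" using \<tau>(2) by simp
  have "(\<tau> - 1) * (1 + \<tau> + \<tau> ^ 2 + \<tau> ^ 3 + \<tau> ^ 4) = \<tau> ^ 5 - 1" by (simp add: algebra_simps eval_nat_numeral)
  then have s: "1 + \<tau> + \<tau> ^ 2 + \<tau> ^ 3 + \<tau> ^ 4 = 0" using \<tau> by simp
  \<comment> \<open>The difference of the two sides of the golden equation is written as a
    combination of the vanishing sum of all fifth roots of unity and of
    \<open>\<tau> ^ 5 - 1\<close>.\<close>
  have "(1 + \<tau> + \<tau> ^ 4)\<^sup>2 = (1 + \<tau> + \<tau> ^ 4) + 1 + (1 + \<tau> + \<tau> ^ 2 + \<tau> ^ 3 + \<tau> ^ 4) + (\<tau> ^ 5 - 1) * (2 + \<tau> ^ 3)"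
    by (simp add: algebra_simps eval_nat_numeral)
  then show "(1 + \<tau> + inverse \<tau>)\<^sup>2 = (1 + \<tau> + inverse \<tau>) + 1" unfolding i s using \<tau>(1) by simp
qed

text \<open>The quotient of two central factors over the same point is a cube root and a fifth root
  of unity at once, hence 1.\<close>

lemma orbit_inj:
  assumes \<tau>: "\<tau> ^ 5 = 1" "\<tau> \<noteq> 1"
  shows "inj_on (\<lambda>(c, p, q). (c * p, inverse (c * q))) (cube_roots \<times> orbit_pairs \<tau>)"
proof (rule inj_onI)
  fix s t
  assume st: "s \<in> cube_roots \<times> orbit_pairs \<tau>" "t \<in> cube_roots \<times> orbit_pairs \<tau>"
    and e: "(case s of (c, p, q) \<Rightarrow> (c * p, inverse (c * q))) = (case t of (c, p, q) \<Rightarrow> (c * p, inverse (c * q)))"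
  obtain c p q d p' q' where s: "s = (c, p, q)" and t: "t = (d, p', q')" by (metis prod_cases3)
  have c: "c \<in> cube_roots" "d \<in> cube_roots" and P: "(p, q) \<in> orbit_pairs \<tau>" "(p', q') \<in> orbit_pairs \<tau>"
    and eq: "c * p = d * p'" "inverse (c * q) = inverse (d * q')"
    using st e by (simp_all add: s t)
  have i: "inverse \<tau> ^ 5 = 1" using \<tau>(1) by (simp add: power_inverse)
  have 5: "p ^ 5 = 1" "p' ^ 5 = 1" using P \<tau>(1) i by (auto simp: orbit_pairs_def)
  have nz: "c \<noteq> 0" "d \<noteq> 0" "p \<noteq> 0" "p' \<noteq> 0" using c cube_roots_nonzero 5 by auto
  have "c / d = p' / p" using eq(1) nz by (simp add: field_simps)
  then have "(c / d) ^ 5 = 1" using 5 by (simp add: power_divide)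
  moreover have "(c / d) ^ 3 = 1" using c by (simp add: power_divide cube_roots_cube)
  moreover have "x ^ 5 * x = (x ^ 3) ^ 2" for x :: complex by (simp add: eval_nat_numeral)
  then have "(c / d) ^ 5 * (c / d) = ((c / d) ^ 3) ^ 2" .
  ultimately have "c / d = 1" by simp
  then show "s = t" using eq nz by (auto simp: s t)
qed

lemma card_orbit_pairs:
  assumes \<tau>: "\<tau> ^ 5 = 1" "\<tau> \<noteq> 1"
  shows "card (orbit_pairs \<tau>) = 6"
  using fifth_root(4,5)[OF \<tau>] \<tau>(2) by (simp add: orbit_pairs_def)

lemma card_cube_roots: "card cube_roots = 3"
  using card_unity_roots[of 3] by (simp add: unity_roots_3)

lemma orbit_set_props:
  assumes \<tau>: "\<tau> ^ 5 = 1" "\<tau> \<noteq> 1"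
  shows "finite (orbit_set \<tau>)" "orbit_set \<tau> \<subseteq> torus_set" "card (orbit_set \<tau>) = 18" "orbit_set \<tau> \<noteq> {}"
    "(\<Sum>x\<in>orbit_set \<tau>. R m n x) = cube_moment m n * (6 * moment m n (1 + \<tau> + inverse \<tau>))"
proof -
  have fin: "finite cube_roots" "finite (orbit_pairs \<tau>)" by (simp_all add: cube_roots_def orbit_pairs_def)
  show "finite (orbit_set \<tau>)" unfolding orbit_set_def using fin by simp
  have cn: "cmod c = 1" if "c \<in> cube_roots" for c
    using that unity_roots_norm[of c 3] by (simp add: unity_roots_3)
  have pn: "cmod p = 1" "cmod q = 1" if "(p, q) \<in> orbit_pairs \<tau>" for p q
    using that fifth_root(1)[OF \<tau>] by (auto simp: orbit_pairs_def norm_inverse)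
  have mem: "(c * p, inverse (c * q)) \<in> torus_set" if "c \<in> cube_roots" "(p, q) \<in> orbit_pairs \<tau>" for c p q
    using cn[OF that(1)] pn[OF that(2)] by (simp add: norm_mult norm_inverse)
  then show "orbit_set \<tau> \<subseteq> torus_set" unfolding orbit_set_def by auto
  show card: "card (orbit_set \<tau>) = 18"
    unfolding orbit_set_def card_image[OF orbit_inj[OF \<tau>]]
    by (simp add: card_cartesian_product card_cube_roots card_orbit_pairs[OF \<tau>])
  then show "orbit_set \<tau> \<noteq> {}" by auto
  have "(\<Sum>x\<in>orbit_set \<tau>. R m n x) = (\<Sum>c\<in>cube_roots. \<Sum>(p, q)\<in>orbit_pairs \<tau>. R m n (c * p, inverse (c * q)))"
    unfolding orbit_set_def sum.reindex[OF orbit_inj[OF \<tau>]]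
    by (simp add: sum.cartesian_product case_prod_beta)
  also have "\<dots> = (\<Sum>c\<in>cube_roots. \<Sum>(p, q)\<in>orbit_pairs \<tau>. moment m n c * moment m n (1 + \<tau> + inverse \<tau>))"
  proof (intro sum.cong refl, clarify)
    fix c p q assume c: "c \<in> cube_roots" and pq: "(p, q) \<in> orbit_pairs \<tau>"
    have nz: "c \<noteq> 0" "p \<noteq> 0" "q \<noteq> 0" using cn[OF c] pn[OF pq] by auto
    have "inverse c * inverse c = c"
      using cube_roots_cube[OF c] nz by (simp add: field_simps power3_eq_cube)
    then have "inverse (c * p) * inverse (c * q) = c * (inverse p * inverse q)"
      by (simp add: mult_ac)
    moreover have "p + q + inverse p * inverse q = 1 + \<tau> + inverse \<tau>"
      using pq fifth_root(2)[OF \<tau>] by (auto simp: orbit_pairs_def)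
    ultimately have "c * p + inverse (inverse (c * q)) + inverse (c * p) * inverse (c * q) = c * (1 + \<tau> + inverse \<tau>)"
      by (simp add: distrib_left flip: \<open>p + q + inverse p * inverse q = 1 + \<tau> + inverse \<tau>\<close>)
    then show "R m n (c * p, inverse (c * q)) = moment m n c * moment m n (1 + \<tau> + inverse \<tau>)"
      unfolding R_moment[OF mem[OF c pq]] by (simp only: moment_mult)
  qed
  also have "\<dots> = cube_moment m n * (6 * moment m n (1 + \<tau> + inverse \<tau>))"
    by (simp add: card_orbit_pairs[OF \<tau>] cube_moment_def sum_distrib_right sum_distrib_left mult_ac case_prod_beta)
  finally show "(\<Sum>x\<in>orbit_set \<tau>. R m n x) = cube_moment m n * (6 * moment m n (1 + \<tau> + inverse \<tau>))" .
qed

definition tau5 :: complex where "tau5 = cis (2 * pi / 5)"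
text \<open>For s = 5/2 the angle is 2 pi / (5/2) = 4 pi / 5.\<close>

definition tau52 :: complex where "tau52 = cis (4 * pi / 5)"

text \<open>The golden equation leaves two candidates; positivity of cos (2 pi / 5) selects the
  larger. For \<open>tau52\<close> the cosine is negative and selects the other.\<close>

lemma tau5: "tau5 ^ 5 = 1" "tau5 \<noteq> 1" "1 + tau5 + inverse tau5 = golden"
proof -
  show five: "tau5 ^ 5 = 1"
  proof -
    have "tau5 ^ 5 = cis (real 5 * (2 * pi / 5))" unfolding tau5_def by (rule Complex.DeMoivre)
    also have "real 5 * (2 * pi / 5) = 2 * pi" by simp
    finally show ?thesis by simp
  qed
  have cos: "0 < cos (2 * pi / 5)" by (intro cos_gt_zero) (auto simp: field_simps)
  have sin: "0 < sin (2 * pi / 5)" by (intro sin_gt_zero) (auto simp: field_simps)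
  show ne: "tau5 \<noteq> 1" using sin by (auto simp: tau5_def complex_eq_iff)
  have "1 + tau5 + inverse tau5 = golden \<or> 1 + tau5 + inverse tau5 = golden'"
    by (rule golden_cases[OF fifth_root(6)[OF five ne]])
  moreover have "Re (1 + tau5 + inverse tau5) = 1 + 2 * cos (2 * pi / 5)"
    by (simp add: tau5_def cis_inverse)
  then have "Re (1 + tau5 + inverse tau5) > 1" using cos by simp
  moreover have "Re golden' = (1 - sqrt 5) / 2" by (simp add: golden'_def)
  moreover have "0 < sqrt 5" by simp
  ultimately show "1 + tau5 + inverse tau5 = golden" by fastforce
qed

lemma tau52: "tau52 ^ 5 = 1" "tau52 \<noteq> 1" "1 + tau52 + inverse tau52 = golden'"
proof -
  show five: "tau52 ^ 5 = 1"
  proof -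
    have "tau52 ^ 5 = cis (real 5 * (4 * pi / 5))" unfolding tau52_def by (rule Complex.DeMoivre)
    also have "real 5 * (4 * pi / 5) = 2 * pi + 2 * pi" by simp
    also have "cis (2 * pi + 2 * pi) = 1" by (simp only: cis_mult[symmetric] cis_2pi mult_1)
    finally show ?thesis .
  qed
  have cos: "cos (4 * pi / 5) < 0"
  proof -
    have "cos (4 * pi / 5) = - cos (pi - 4 * pi / 5)" by (simp only: cos_pi_minus)
    moreover have "0 < cos (pi - 4 * pi / 5)" by (intro cos_gt_zero) (auto simp: field_simps)
    ultimately show ?thesis by simp
  qed
  then show ne: "tau52 \<noteq> 1" by (auto simp: tau52_def complex_eq_iff)
  have "1 + tau52 + inverse tau52 = golden \<or> 1 + tau52 + inverse tau52 = golden'"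
    by (rule golden_cases[OF fifth_root(6)[OF five ne]])
  moreover have "Re (1 + tau52 + inverse tau52) = 1 + 2 * cos (4 * pi / 5)"
    by (simp add: tau52_def cis_inverse)
  then have "Re (1 + tau52 + inverse tau52) < 1" using cos by simp
  moreover have "Re golden > 1" by (simp add: golden_def)
  ultimately show "1 + tau52 + inverse tau52 = golden'" by (metis less_asym)
qed

section \<open>The spectral measure\<close>

lemma d_lat_eq: "N > 0 \<Longrightarrow> d_lat N = uniform_on_torus (torus_lattice N)"
  unfolding d_lat_def by (subst lattice_eq) simp_all

lemma finite_weighted_d_lat:
  "N > 0 \<Longrightarrow> finite_weighted (d_lat N) (torus_lattice N) (\<lambda>_. 1 / real (3 * N * N))"
  using measure_uniform_on_torus[OF finite_lattice lattice_torus lattice_nonempty, of N]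
  by (simp add: d_lat_eq card_lattice)

lemma finite_weighted_J2_d_lat:
  "N > 0 \<Longrightarrow> finite_weighted (J2_d_lat N) (torus_lattice N) (\<lambda>x. (J x)\<^sup>2 / real (3 * N * N))"
  using measure_J2_uniform[OF finite_lattice lattice_torus lattice_nonempty, of N]
  by (simp add: J2_d_lat_def d_lat_eq card_lattice)

lemma d_orb_eq: "d_orb 5 = uniform_on_torus (orbit_set tau5)" "d_orb (5 / 2) = uniform_on_torus (orbit_set tau52)"
proof -
  have r: "of_rat (5 / 2) = (5 / 2 :: real)" by (simp add: of_rat_divide)
  have "2 * pi / (5 / 2) = 4 * pi / 5" by simp
  then show "d_orb (5 / 2) = uniform_on_torus (orbit_set tau52)"
    using orbit_union[OF fifth_root(1)[OF tau52(1,2)]] unfolding d_orb_def Let_def r tau52_def by simp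
  show "d_orb 5 = uniform_on_torus (orbit_set tau5)"
    using orbit_union[OF fifth_root(1)[OF tau5(1,2)]] by (simp add: d_orb_def Let_def tau5_def)
qed

lemma finite_weighted_orbit:
  assumes "\<tau> ^ 5 = 1" "\<tau> \<noteq> 1"
  shows "finite_weighted (uniform_on_torus (orbit_set \<tau>)) (orbit_set \<tau>) (\<lambda>_. 1 / 18)"
  using measure_uniform_on_torus[OF orbit_set_props(1,2,4)[OF assms]] orbit_set_props(3)[OF assms] by simp

text \<open>Extends the weights of each component by zero, so that the six components can be added
  on one common support.\<close>

lemma sum_if_subset:
  fixes f :: "'a \<Rightarrow> 'b::semiring_0"
  assumes "finite S" "D \<subseteq> S"
  shows "(\<Sum>x\<in>S \<inter> A. c * (if x \<in> D then f x else 0)) = c * sum f (D \<inter> A)"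
proof -
  have "(\<Sum>x\<in>S \<inter> A. if x \<in> D then f x else 0) = sum f ((S \<inter> A) \<inter> D)"
    using assms by (intro sum.inter_restrict[symmetric]) auto
  also have "(S \<inter> A) \<inter> D = D \<inter> A" using assms by auto
  finally show ?thesis by (simp flip: sum_distrib_left)
qed

text \<open>Every point with negative weight from \<open>d_lat 1\<close> also carries positive
  weight from \<open>d_lat 2\<close>.\<close>

lemma torus_lattice_1_subset_2: "torus_lattice 1 \<subseteq> torus_lattice 2"
proof
  fix x assume "x \<in> torus_lattice 1"
  then obtain z where z: "z ^ 3 = 1" "x = (z, 1 / z)"
    by (auto simp: torus_lattice_def unity_roots_def)
  have "z ^ (3 * 2) = 1" by (simp only: power_mult z(1) power_one)
  then show "x \<in> torus_lattice 2"
    unfolding torus_lattice_def using z(2)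
    by (intro image_eqI[of _ _ "(z, 1)"]) (auto simp: unity_roots_def)
qed

text \<open>Because of the negative coefficient the six terms cannot simply be added as measures.
  Their weights are added pointwise instead, and the nonnegative total defines a single point
  measure.\<close>

lemma spectral_measure_exists:
  obtains \<epsilon> where "finite_measure \<epsilon>" "sets \<epsilon> = sets torus"
    "\<And>A. A \<in> sets torus \<Longrightarrow> measure \<epsilon> A =
                1 / (96 * pi ^ 4) * measure (J2_d_lat 4) A
              + 1 / (108 * pi ^ 4) * measure (J2_d_lat 3) A
              + 1 / 6 * measure (d_lat 2) A
              - 7 / 180 * measure (d_lat 1) A
              + 1 / 5 * measure (d_orb 5) A
              + 1 / 5 * measure (d_orb (5 / 2)) A"
    "\<And>m n. (\<integral>w. R m n w \<partial>\<epsilon>) = cube_moment m n *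
      (moment m n 3 + 45 * moment m n (- 1) + 80 * moment m n 0 + 90 * moment m n 1
       + 72 * (moment m n golden + moment m n golden')) / 1080"
proof -
  define L where "L = torus_lattice"
  define O5 where "O5 = orbit_set tau5"
  define O52 where "O52 = orbit_set tau52"
  define S where "S = L 4 \<union> L 3 \<union> L 2 \<union> L 1 \<union> O5 \<union> O52"
  define j where "j N x = (J x)\<^sup>2 / real (3 * N * N)" for N :: nat and x
  define W where "W x = 1 / (96 * pi ^ 4) * (if x \<in> L 4 then j 4 x else 0)
      + 1 / (108 * pi ^ 4) * (if x \<in> L 3 then j 3 x else 0)
      + 1 / 6 * (if x \<in> L 2 then 1 / 12 else 0)
      + (- 7 / 180) * (if x \<in> L 1 then 1 / 3 else 0)
      + 1 / 5 * (if x \<in> O5 then 1 / 18 else 0)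
      + 1 / 5 * (if x \<in> O52 then 1 / 18 else 0)" for x
  have S: "finite S" "S \<subseteq> torus_set"
    unfolding S_def L_def O5_def O52_def
    using finite_lattice lattice_torus orbit_set_props(1,2)[OF tau5(1,2)] orbit_set_props(1,2)[OF tau52(1,2)]
    by auto
  have sub: "L 4 \<subseteq> S" "L 3 \<subseteq> S" "L 2 \<subseteq> S" "L 1 \<subseteq> S" "O5 \<subseteq> S" "O52 \<subseteq> S"
    by (auto simp: S_def)
  have W: "0 \<le> W x" for x
  proof -
    have a: "0 \<le> 1 / (96 * pi ^ 4) * (if x \<in> L 4 then j 4 x else 0)"
      "0 \<le> 1 / (108 * pi ^ 4) * (if x \<in> L 3 then j 3 x else 0)" by (simp_all add: j_def)
    \<comment> \<open>At a point of \<open>L 1\<close> the two weights add up to 1/72 - 7/540 =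
      1/1080.\<close>
    have b: "0 \<le> 1 / 6 * (if x \<in> L 2 then 1 / 12 else 0) + (- 7 / 180) * (if x \<in> L 1 then 1 / 3 else (0::real))"
      using torus_lattice_1_subset_2 by (auto simp: L_def)
    have c: "0 \<le> 1 / 5 * (if x \<in> O5 then 1 / 18 else (0::real))" "0 \<le> 1 / 5 * (if x \<in> O52 then 1 / 18 else (0::real))" by simp_all
    show ?thesis unfolding W_def using a b c by linarith
  qed
  obtain \<epsilon> where \<epsilon>: "finite_measure \<epsilon>" "sets \<epsilon> = sets torus"
    and meas: "\<And>A. A \<in> sets torus \<Longrightarrow> measure \<epsilon> A = sum W (S \<inter> A)"
    and int: "\<And>m n. (\<integral>w. R m n w \<partial>\<epsilon>) = (\<Sum>x\<in>S. of_real (W x) * R m n x)"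
    using finite_weighted_exists[OF S, of W] W by blast
  show ?thesis
  proof (rule that[OF \<epsilon>])
    fix A assume A: "A \<in> sets torus"
    have m4: "measure (J2_d_lat 4) A = sum (j 4) (L 4 \<inter> A)" and m3: "measure (J2_d_lat 3) A = sum (j 3) (L 3 \<inter> A)"
      using finite_weighted_J2_d_lat[of 4] finite_weighted_J2_d_lat[of 3] A
      unfolding finite_weighted_def L_def j_def by auto
    have m2: "measure (d_lat 2) A = (\<Sum>x\<in>L 2 \<inter> A. 1 / 12)" and m1: "measure (d_lat 1) A = (\<Sum>x\<in>L 1 \<inter> A. 1 / 3)"
      using finite_weighted_d_lat[of 2] finite_weighted_d_lat[of 1] A
      unfolding finite_weighted_def L_def by auto
    have m5: "measure (d_orb 5) A = (\<Sum>x\<in>O5 \<inter> A. 1 / 18)" and m52: "measure (d_orb (5 / 2)) A = (\<Sum>x\<in>O52 \<inter> A. 1 / 18)"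
      using finite_weighted_orbit[OF tau5(1,2)] finite_weighted_orbit[OF tau52(1,2)] A
      unfolding finite_weighted_def O5_def O52_def d_orb_eq by blast+
    show "measure \<epsilon> A =
                1 / (96 * pi ^ 4) * measure (J2_d_lat 4) A
              + 1 / (108 * pi ^ 4) * measure (J2_d_lat 3) A
              + 1 / 6 * measure (d_lat 2) A
              - 7 / 180 * measure (d_lat 1) A
              + 1 / 5 * measure (d_orb 5) A
              + 1 / 5 * measure (d_orb (5 / 2)) A"
      unfolding meas[OF A] W_def sum.distrib m4 m3 m2 m1 m5 m52
        sum_if_subset[OF S(1) sub(1)] sum_if_subset[OF S(1) sub(2)] sum_if_subset[OF S(1) sub(3)]
        sum_if_subset[OF S(1) sub(4)] sum_if_subset[OF S(1) sub(5)] sum_if_subset[OF S(1) sub(6)]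
      by simp
  next
    fix m n
    let ?r = "R m n" and ?k = "cube_moment m n" and ?M = "moment m n"
    \<comment> \<open>Intersecting with \<open>UNIV\<close> gives the sum the shape of
      \<open>sum_if_subset\<close>, which thus serves for both the measure and the integral.\<close>
    have "(\<integral>w. R m n w \<partial>\<epsilon>) = (\<Sum>x\<in>S \<inter> UNIV.
        of_real (1 / (96 * pi ^ 4)) * (if x \<in> L 4 then of_real (j 4 x) * ?r x else 0)
      + of_real (1 / (108 * pi ^ 4)) * (if x \<in> L 3 then of_real (j 3 x) * ?r x else 0)
      + of_real (1 / 6) * (if x \<in> L 2 then of_real (1 / 12) * ?r x else 0)
      + of_real (- 7 / 180) * (if x \<in> L 1 then of_real (1 / 3) * ?r x else 0)
      + of_real (1 / 5) * (if x \<in> O5 then of_real (1 / 18) * ?r x else 0)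
      + of_real (1 / 5) * (if x \<in> O52 then of_real (1 / 18) * ?r x else 0))"
    proof -
      have "of_real (c * (if P then a else 0)) * r = of_real c * (if P then of_real a * r else 0)"
        for c a :: real and r :: complex and P by simp
      then show ?thesis unfolding int W_def by (simp only: of_real_add distrib_right Int_UNIV_right)
    qed
    also have "\<dots> = of_real (1 / (96 * pi ^ 4)) * (\<Sum>x\<in>L 4. of_real (j 4 x) * ?r x)
      + of_real (1 / (108 * pi ^ 4)) * (\<Sum>x\<in>L 3. of_real (j 3 x) * ?r x)
      + of_real (1 / 6) * (\<Sum>x\<in>L 2. of_real (1 / 12) * ?r x)
      + of_real (- 7 / 180) * (\<Sum>x\<in>L 1. of_real (1 / 3) * ?r x)
      + of_real (1 / 5) * (\<Sum>x\<in>O5. of_real (1 / 18) * ?r x)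
      + of_real (1 / 5) * (\<Sum>x\<in>O52. of_real (1 / 18) * ?r x)"
      unfolding sum.distrib
        sum_if_subset[OF S(1) sub(1)] sum_if_subset[OF S(1) sub(2)] sum_if_subset[OF S(1) sub(3)]
        sum_if_subset[OF S(1) sub(4)] sum_if_subset[OF S(1) sub(5)] sum_if_subset[OF S(1) sub(6)]
      by (simp only: Int_UNIV_right)
    also have "(\<Sum>x\<in>L 4. of_real (j 4 x) * ?r x) = of_real (pi ^ 4) * (?k * (8 * ?M 1))"
    proof -
      have "(\<Sum>x\<in>L 4. of_real (j 4 x) * ?r x) = (\<Sum>x\<in>L 4. of_real ((J x)\<^sup>2) * ?r x) / 48"
        by (simp add: j_def sum_divide_distrib)
      then show ?thesis unfolding L_def lattice_4_sum by simp
    qed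
    also have "(\<Sum>x\<in>L 3. of_real (j 3 x) * ?r x) = of_real (pi ^ 4) * (24 * ?M 0)"
    proof -
      have "(\<Sum>x\<in>L 3. of_real (j 3 x) * ?r x) = (\<Sum>x\<in>L 3. of_real ((J x)\<^sup>2) * ?r x) / 27"
        by (simp add: j_def sum_divide_distrib)
      then show ?thesis unfolding L_def lattice_3_sum by simp
    qed
    also have "(\<Sum>x\<in>L 2. of_real (1 / 12) * ?r x) = of_real (1 / 12) * (?k * (?M 3 + 3 * ?M (- 1)))"
      unfolding L_def lattice_2_sum[symmetric] by (simp only: sum_distrib_left)
    also have "(\<Sum>x\<in>L 1. of_real (1 / 3) * ?r x) = of_real (1 / 3) * (?k * ?M 3)"
      unfolding L_def lattice_1_sum[symmetric] by (simp only: sum_distrib_left)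
    also have "(\<Sum>x\<in>O5. of_real (1 / 18) * ?r x) = of_real (1 / 18) * (?k * (6 * ?M golden))"
      using orbit_set_props(5)[OF tau5(1,2), of m n] unfolding O5_def tau5(3) by (simp only: sum_distrib_left[symmetric])
    also have "(\<Sum>x\<in>O52. of_real (1 / 18) * ?r x) = of_real (1 / 18) * (?k * (6 * ?M golden'))"
      using orbit_set_props(5)[OF tau52(1,2), of m n] unfolding O52_def tau52(3) by (simp only: sum_distrib_left[symmetric])
    also have "of_real (1 / (96 * pi ^ 4)) * (of_real (pi ^ 4) * (?k * (8 * ?M 1))) = 1 / 12 * (?k * ?M 1)"
      by simp
    also have "of_real (1 / (108 * pi ^ 4)) * (of_real (pi ^ 4) * (24 * ?M 0)) = 2 / 27 * (?k * ?M 0)"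
    proof -
      \<comment> \<open>\<open>?M 0\<close> is nonzero only for m = n = 0, where \<open>?k\<close>
        counts the three cube roots; this supplies the central factor absent from
        \<open>lattice_3_sum\<close>.\<close>
      have "?k * ?M 0 = 3 * ?M 0"
        by (cases "m = 0 \<and> n = 0") (auto simp: cube_moment_def moment_def card_cube_roots)
      then show ?thesis by simp
    qed
    finally have "(\<integral>w. R m n w \<partial>\<epsilon>) = 1 / 12 * (?k * ?M 1) + 2 / 27 * (?k * ?M 0)
      + of_real (1 / 6) * (of_real (1 / 12) * (?k * (?M 3 + 3 * ?M (- 1))))
      + of_real (- 7 / 180) * (of_real (1 / 3) * (?k * ?M 3))
      + of_real (1 / 5) * (of_real (1 / 18) * (?k * (6 * ?M golden)))
      + of_real (1 / 5) * (of_real (1 / 18) * (?k * (6 * ?M golden')))" .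
    \<comment> \<open>Over the denominator 1080: 1/12 is 90, 2/27 is 80, 3/72 is 45, 1/72 - 7/540 is
      1, and 6/90 is 72.\<close>
    also have "\<dots> = ?k *
      (?M 3 + 45 * ?M (- 1) + 80 * ?M 0 + 90 * ?M 1 + 72 * (?M golden + ?M golden')) / 1080"
      by (simp add: field_simps)
    finally show "(\<integral>w. R m n w \<partial>\<epsilon>) = ?k *
      (?M 3 + 45 * ?M (- 1) + 80 * ?M 0 + 90 * ?M 1 + 72 * (?M golden + ?M golden')) / 1080" .
  qed
qed

theorem theorem3p12:
  fixes L :: "complex mat set"
  assumes "subgroup L (SU 3)"
    and "card L = 1080"
    and "SU3_centre \<subseteq> L"
    and "((SU 3)\<lparr>carrier := L\<rparr> Mod SU3_centre) \<cong> alt_group 6"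
  shows "\<exists>\<epsilon>. finite_measure \<epsilon> \<and> sets \<epsilon> = sets torus \<and>
           (\<forall>A \<in> sets torus. measure \<epsilon> A =
                1 / (96 * pi ^ 4) * measure (J2_d_lat 4) A
              + 1 / (108 * pi ^ 4) * measure (J2_d_lat 3) A
              + 1 / 6 * measure (d_lat 2) A
              - 7 / 180 * measure (d_lat 1) A
              + 1 / 5 * measure (d_orb 5) A
              + 1 / 5 * measure (d_orb (5 / 2)) A) \<and>
           spectral_measure L \<epsilon>"
proof -
  obtain \<epsilon> where \<epsilon>: "finite_measure \<epsilon>" "sets \<epsilon> = sets torus"
    "\<And>A. A \<in> sets torus \<Longrightarrow> measure \<epsilon> A =
                1 / (96 * pi ^ 4) * measure (J2_d_lat 4) A
              + 1 / (108 * pi ^ 4) * measure (J2_d_lat 3) A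
              + 1 / 6 * measure (d_lat 2) A
              - 7 / 180 * measure (d_lat 1) A
              + 1 / 5 * measure (d_orb 5) A
              + 1 / 5 * measure (d_orb (5 / 2)) A"
    and int: "\<And>m n. (\<integral>w. R m n w \<partial>\<epsilon>) = cube_moment m n *
      (moment m n 3 + 45 * moment m n (- 1) + 80 * moment m n 0 + 90 * moment m n 1
       + 72 * (moment m n golden + moment m n golden')) / 1080"
    using spectral_measure_exists by blast
  have "spectral_measure L \<epsilon>"
    unfolding spectral_measure_def Let_def int mckay_trace_moments[OF assms] using \<epsilon>(2) by simp
  with \<epsilon> show ?thesis by blast
qed

end
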